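(* Let $\lambda>1$, $L=\ln\lambda$, $\alpha$ Diophantine. For any $\Gamma$ with $L<\Gamma\le 2L$, for all sufficiently large $|n|$, $$\ln\int_0^1\sum_s|\phi_{\theta;s}(0)\phi_{\theta;s}(n)|\,d\theta\ge -\Gamma|n|.$$
   Context: For $\theta\in\mathbb{R}$, the almost Mathieu operator $H_\theta$ acts on $u\in\ell^2(\mathbb{Z})$ by $(H_\theta u)(m)=u(m+1)+u(m-1)+2\lambda\cos(2\pi(\theta+m\alpha))u(m)$. The frequency $\alpha$ is Diophantine if there exist $\kappa>0,\tau>0$ such that $\|k\alpha\|_{\mathbb{R}/\mathbb{Z}}\ge \tau/|k|^{\kappa}$ for all integers $k\neq 0$. For almost every $\theta$, $H_\theta$ has pure point spectrum and $\{\phi_{\theta;s}\}_s$ denotes a complete orthonormal basis of eigenfunctions of $H_\theta$. *)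

theory Defs
  imports "HOL-Analysis.Analysis"
begin

definition dist_Z :: "real \<Rightarrow> real" where
  "dist_Z x = \<bar>x - of_int (round x)\<bar>"

definition diophantine :: "real \<Rightarrow> bool" where
  "diophantine \<alpha> \<longleftrightarrow> (\<exists>\<kappa>>0. \<exists>\<tau>>0. \<forall>k::int. k \<noteq> 0 \<longrightarrow>
       dist_Z (of_int k * \<alpha>) \<ge> \<tau> / \<bar>of_int k\<bar> powr \<kappa>)"

definition l2Z :: "(int \<Rightarrow> complex) \<Rightarrow> bool" where
  "l2Z u \<longleftrightarrow> (\<lambda>m. (cmod (u m))\<^sup>2) summable_on UNIV"

definition l2_inner :: "(int \<Rightarrow> complex) \<Rightarrow> (int \<Rightarrow> complex) \<Rightarrow> complex" where
  "l2_inner u v = (\<Sum>\<^sub>\<infinity>m. cnj (u m) * v m)"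

definition amo :: "real \<Rightarrow> real \<Rightarrow> real \<Rightarrow> (int \<Rightarrow> complex) \<Rightarrow> (int \<Rightarrow> complex)" where
  "amo lam \<alpha> \<theta> u = (\<lambda>m. u (m + 1) + u (m - 1)
       + complex_of_real (2 * lam * cos (2 * pi * (\<theta> + of_int m * \<alpha>))) * u m)"

definition is_eigenfunction :: "real \<Rightarrow> real \<Rightarrow> real \<Rightarrow> (int \<Rightarrow> complex) \<Rightarrow> bool" where
  "is_eigenfunction lam \<alpha> \<theta> u \<longleftrightarrow> l2Z u \<and> u \<noteq> (\<lambda>_. 0) \<and>
     (\<exists>E::real. amo lam \<alpha> \<theta> u = (\<lambda>m. complex_of_real E * u m))"

definition eigen_onb :: "real \<Rightarrow> real \<Rightarrow> real \<Rightarrow> (nat \<Rightarrow> int \<Rightarrow> complex) \<Rightarrow> bool" where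
  "eigen_onb lam \<alpha> \<theta> \<phi> \<longleftrightarrow>
     (\<forall>s. is_eigenfunction lam \<alpha> \<theta> (\<phi> s)) \<and>
     (\<forall>s t. l2_inner (\<phi> s) (\<phi> t) = (if s = t then 1 else 0)) \<and>
     (\<forall>u. l2Z u \<longrightarrow> (\<forall>s. l2_inner (\<phi> s) u = 0) \<longrightarrow> u = (\<lambda>_. 0))"

end

theory Submission
  imports Defs "Jordan_Normal_Form.Schur_Decomposition"
begin

text \<open>Completeness of the eigenfunctions gives
  \<open>\<Sum>\<^sub>s \<bar>\<phi>\<^sub>s(0) \<phi>\<^sub>s(n)\<bar> \<ge> Im z \<cdot> \<bar>G\<^sub>\<theta>(0,n;z)\<bar>\<close> for every \<open>z\<close> in the upper half plane, and a box of size
  proportional to \<open>n\<close> computes the Green function up to an exponentially small error. By Cramer's rule and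
  Jensen's inequality, \<open>\<integral> \<bar>G\<^sub>\<theta>(0,n;z)\<bar> d\<theta>\<close> is at least \<open>exp (- n (l(z) + o(1)))\<close>, where \<open>l(z)\<close> is the exponential
  growth rate of the mean logarithm of the box determinants, so a single \<open>z\<close> with \<open>l(z) < \<Gamma>\<close> suffices.

  The rate \<open>l(z)\<close> is the logarithmic potential of the density of states, which is invariant under Aubry duality
  (exchange of hopping and potential), so it may be bounded with the dual determinants. Take \<open>z = E + i\<eta>\<close>
  for an eigenvalue \<open>E\<close> of some \<open>H\<^sub>\<theta>\<close> with \<open>\<theta>\<close> nonresonant. The Fourier series of the eigenfunction and its
  conjugate solve the dual equation at \<open>E\<close>; their Wronskian is a nonzero constant, so the Fourier
  coefficients of the dual determinants of size \<open>n\<close> are \<open>O(\<lambda>\<^sup>n)\<close> and the determinants are \<open>O(n \<lambda>\<^sup>n)\<close>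
  uniformly in the phase. A small \<open>\<eta> > 0\<close> raises the rate \<open>ln \<lambda>\<close> only slightly.\<close>

section \<open>Box determinants\<close>

text \<open>An eigenfunction is only known to be square summable, so its Fourier series f is merely
  an L2 function and the dual solutions cannot be evaluated phase by phase. The dual computations
  are therefore done on Fourier coefficients of products of a translate of f with the conjugate of
  f; these are absolutely convergent sums bounded by the squared norm.

  The dual side is where the rate can be controlled: once the dual solutions are bounded and their
  Wronskian is not zero, only the hopping factor \<lambda> per site is left in the determinant, and
  this is the threshold ln \<lambda>.

  Off the real axis every box determinant is nonzero, its logarithm is continuous in the phase, and
  Green functions decay towards the edges of a box. But \<eta> is tiny and this decay weak, so the
  padding of the box must be a large multiple of |n|. It does not cost anything in the exponent: the
  padding enters the numerator and the denominator of Cramer's rule at the same rate and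
  cancels.\<close>

definition pot :: "real \<Rightarrow> real \<Rightarrow> real \<Rightarrow> int \<Rightarrow> real" where
  "pot \<nu> \<alpha> \<theta> j = 2 * \<nu> * cos (2 * pi * (\<theta> + of_int j * \<alpha>))"

text \<open>Three-term recursion for \<open>det (z - H)\<close>, where \<open>H\<close> is the \<open>n \<times> n\<close> Dirichlet box with hopping \<open>\<mu>\<close> and
  coupling \<open>\<nu>\<close>; the operator itself is \<open>(\<mu>, \<nu>) = (1, \<lambda>)\<close> and its Aubry dual is \<open>(\<lambda>, 1)\<close>.\<close>

fun box_det :: "real \<Rightarrow> real \<Rightarrow> real \<Rightarrow> real \<Rightarrow> complex \<Rightarrow> nat \<Rightarrow> complex" where
  "box_det \<mu> \<nu> \<alpha> \<theta> z 0 = 1"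
| "box_det \<mu> \<nu> \<alpha> \<theta> z (Suc 0) = z - of_real (pot \<nu> \<alpha> \<theta> 0)"
| "box_det \<mu> \<nu> \<alpha> \<theta> z (Suc (Suc n)) =
     (z - of_real (pot \<nu> \<alpha> \<theta> (int (Suc n)))) * box_det \<mu> \<nu> \<alpha> \<theta> z (Suc n)
     - (of_real \<mu>)\<^sup>2 * box_det \<mu> \<nu> \<alpha> \<theta> z n"

lemma pot_shift: "pot \<nu> \<alpha> (\<theta> + of_int i * \<alpha>) j = pot \<nu> \<alpha> \<theta> (i + j)"
  by (simp add: pot_def algebra_simps)

text \<open>The determinant recursion only runs to the right. Reflecting the phase makes it run to
  the left from site r, which gives determinants anchored at the right edge of a box.\<close>

lemma pot_reflect: "pot \<nu> \<alpha> (- (\<theta> + of_int r * \<alpha>)) j = pot \<nu> \<alpha> \<theta> (r - j)"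
proof -
  have "2 * pi * (- (\<theta> + of_int r * \<alpha>) + of_int j * \<alpha>) = - (2 * pi * (\<theta> + of_int (r - j) * \<alpha>))"
    by (simp add: algebra_simps)
  then show ?thesis unfolding pot_def by (simp only: cos_minus)
qed

lemma pot_period: "pot \<nu> \<alpha> (\<theta> + 1) j = pot \<nu> \<alpha> \<theta> j"
proof -
  have "2 * pi * (\<theta> + 1 + of_int j * \<alpha>) = 2 * pi * (\<theta> + of_int j * \<alpha>) + 2 * pi"
    by (simp add: algebra_simps)
  then show ?thesis unfolding pot_def by simp
qed

lemma abs_pot_le: "\<bar>pot \<nu> \<alpha> \<theta> j\<bar> \<le> 2 * \<bar>\<nu>\<bar>"
proof -
  have "\<bar>\<nu>\<bar> * \<bar>cos (2 * pi * (\<theta> + of_int j * \<alpha>))\<bar> \<le> \<bar>\<nu>\<bar> * 1"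
    by (intro mult_left_mono) auto
  then show ?thesis by (simp add: pot_def abs_mult)
qed

lemma continuous_on_pot [continuous_intros]: "continuous_on A (\<lambda>\<theta>. pot \<nu> \<alpha> \<theta> j)"
  unfolding pot_def by (intro continuous_intros)

lemma box_det_period: "box_det \<mu> \<nu> \<alpha> (\<theta> + 1) z n = box_det \<mu> \<nu> \<alpha> \<theta> z n"
  by (induction \<mu> \<nu> \<alpha> \<theta> z n rule: box_det.induct) (simp_all add: pot_period)

lemma continuous_on_box_det [continuous_intros]:
  "continuous_on A (\<lambda>\<theta>. box_det \<mu> \<nu> \<alpha> \<theta> z n)"
proof (induction n rule: induct_nat_012)
  case (ge2 n)
  then show ?case by (simp del: of_nat_Suc) (intro continuous_intros; assumption)
qed (auto intro!: continuous_intros)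

section \<open>Flux and zero-free regions of the box determinants\<close>

lemma box_det_cnj: "box_det \<mu> \<nu> \<alpha> \<theta> (cnj z) n = cnj (box_det \<mu> \<nu> \<alpha> \<theta> z n)"
  by (induction \<mu> \<nu> \<alpha> \<theta> z n rule: box_det.induct) simp_all

text \<open>After multiplication by the conjugate of the middle determinant the real potential drops
  out of the imaginary part. What remains is the current of the difference equation, which gains
  \<open>Im z\<close> times the local density at each site.\<close>

lemma box_det_flux_step:
  "Im (box_det \<mu> \<nu> \<alpha> \<theta> z (Suc (Suc n)) * cnj (box_det \<mu> \<nu> \<alpha> \<theta> z (Suc n)))
   = Im z * (cmod (box_det \<mu> \<nu> \<alpha> \<theta> z (Suc n)))\<^sup>2
     + \<mu>\<^sup>2 * Im (box_det \<mu> \<nu> \<alpha> \<theta> z (Suc n) * cnj (box_det \<mu> \<nu> \<alpha> \<theta> z n))"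
  unfolding cmod_power2 by (simp add: power2_eq_square algebra_simps del: of_nat_Suc)

lemma box_det_flux:
  "Im (box_det 1 \<nu> \<alpha> \<theta> z (Suc n) * cnj (box_det 1 \<nu> \<alpha> \<theta> z n))
   = Im z * (\<Sum>j\<le>n. (cmod (box_det 1 \<nu> \<alpha> \<theta> z j))\<^sup>2)"
proof (induction n)
  case (Suc n)
  then show ?case using box_det_flux_step[of 1 \<nu> \<alpha> \<theta> z n] by (simp add: algebra_simps del: box_det.simps)
qed simp

text \<open>A positive flux forces both of its factors to be nonzero, and
  \<open>box_det_flux_step\<close> preserves positivity. This is later the reason that the
  eigenvalues are real.\<close>

lemma box_det_nonzero_upper:
  assumes "Im z > 0"
  shows "box_det \<mu> \<nu> \<alpha> \<theta> z n \<noteq> 0"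
proof -
  let ?D = "box_det \<mu> \<nu> \<alpha> \<theta> z"
  have "?D n \<noteq> 0 \<and> Im (?D (Suc n) * cnj (?D n)) > 0" for n
  proof (induction n)
    case 0 then show ?case using assms by simp
  next
    case (Suc n)
    then have nz: "?D (Suc n) \<noteq> 0" by auto
    have "Im z * (cmod (?D (Suc n)))\<^sup>2 > 0" using assms nz by simp
    moreover have "\<mu>\<^sup>2 * Im (?D (Suc n) * cnj (?D n)) \<ge> 0"
      using Suc by (intro mult_nonneg_nonneg) auto
    ultimately show ?case using nz box_det_flux_step[of \<mu> \<nu> \<alpha> \<theta> z n] by (simp del: box_det.simps)
  qed
  then show ?thesis by blast
qed

lemma box_det_nonzero:
  assumes "Im z \<noteq> 0"
  shows "box_det \<mu> \<nu> \<alpha> \<theta> z n \<noteq> 0"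
proof (cases "Im z > 0")
  case False
  then have "Im (cnj z) > 0" using assms by simp
  then have "box_det \<mu> \<nu> \<alpha> \<theta> (cnj z) n \<noteq> 0" by (rule box_det_nonzero_upper)
  then show ?thesis by (simp add: box_det_cnj)
qed (rule box_det_nonzero_upper)

text \<open>Here the diagonal dominates: each modulus is at least |\<mu>| times the previous one,
  which the recursion preserves because |z - V| exceeds 2|\<mu>|.\<close>

lemma box_det_nonzero_large:
  assumes z: "cmod z > 2 * \<bar>\<mu>\<bar> + 2 * \<bar>\<nu>\<bar>"
  shows "box_det \<mu> \<nu> \<alpha> \<theta> z n \<noteq> 0"
proof -
  let ?D = "box_det \<mu> \<nu> \<alpha> \<theta> z"
  have zp: "cmod (z - of_real (pot \<nu> \<alpha> \<theta> j)) > 2 * \<bar>\<mu>\<bar>" for j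
    using norm_triangle_ineq2[of z "of_real (pot \<nu> \<alpha> \<theta> j)"] abs_pot_le[of \<nu> \<alpha> \<theta> j] z by simp
  have "?D n \<noteq> 0 \<and> ?D (Suc n) \<noteq> 0 \<and> \<bar>\<mu>\<bar> * cmod (?D n) \<le> cmod (?D (Suc n))" for n
  proof (induction n)
    case 0 then show ?case using zp[of 0] by (auto simp del: of_nat_Suc)
  next
    case (Suc n)
    have "\<bar>\<mu>\<bar> * (\<bar>\<mu>\<bar> * cmod (?D n)) \<le> \<bar>\<mu>\<bar> * cmod (?D (Suc n))"
      using Suc by (intro mult_left_mono) auto
    moreover have "2 * \<bar>\<mu>\<bar> * cmod (?D (Suc n)) < cmod (z - of_real (pot \<nu> \<alpha> \<theta> (int (Suc n)))) * cmod (?D (Suc n))"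
      using zp[of "int (Suc n)"] Suc by (intro mult_strict_right_mono) auto
    moreover have "cmod (?D (Suc (Suc n))) \<ge>
        cmod (z - of_real (pot \<nu> \<alpha> \<theta> (int (Suc n)))) * cmod (?D (Suc n)) - \<bar>\<mu>\<bar> * (\<bar>\<mu>\<bar> * cmod (?D n))"
      using norm_triangle_ineq2[of "(z - of_real (pot \<nu> \<alpha> \<theta> (int (Suc n)))) * ?D (Suc n)" "(of_real \<mu>)\<^sup>2 * ?D n"]
      by (simp add: norm_mult norm_power power2_eq_square mult.assoc del: of_nat_Suc)
    ultimately have *: "cmod (?D (Suc (Suc n))) > \<bar>\<mu>\<bar> * cmod (?D (Suc n))" by linarith
    moreover have "\<bar>\<mu>\<bar> * cmod (?D (Suc n)) \<ge> 0" by simp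
    ultimately have "cmod (?D (Suc (Suc n))) > 0" by linarith
    then have "?D (Suc (Suc n)) \<noteq> 0" by (rule zero_less_norm_iff[THEN iffD1])
    then show ?case using Suc * by (intro conjI) auto
  qed
  then show ?thesis by blast
qed

section \<open>Eigenvalues and traces of the boxes\<close>

definition box_mat :: "real \<Rightarrow> real \<Rightarrow> real \<Rightarrow> real \<Rightarrow> nat \<Rightarrow> complex mat" where
  "box_mat \<mu> \<nu> \<alpha> \<theta> k = Matrix.mat k k (\<lambda>(i, j).
     if i = j then of_real (pot \<nu> \<alpha> \<theta> (int i)) else if i = Suc j \<or> j = Suc i then of_real \<mu> else 0)"

lemma box_mat_carrier [simp]: "box_mat \<mu> \<nu> \<alpha> \<theta> k \<in> carrier_mat k k"
  by (simp add: box_mat_def)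

text \<open>In the product of row i and column j with j at most i, an index below i is killed by the
  first factor and an index above j by the second, so a term survives only for i = j.\<close>

lemma diag_upper_triangular_pow:
  fixes B :: "complex mat"
  assumes B: "B \<in> carrier_mat n n" "upper_triangular B"
  shows "\<forall>i<n. (\<forall>j<i. (B ^\<^sub>m p) $$ (i,j) = 0) \<and> (B ^\<^sub>m p) $$ (i,i) = (B $$ (i,i)) ^ p"
proof (induction p)
  case 0 then show ?case using B by auto
next
  case (Suc p)
  have C: "B ^\<^sub>m p \<in> carrier_mat n n" using B by simp
  show ?case
  proof (intro allI impI)
    fix i assume i: "i < n"
    have e: "(B ^\<^sub>m Suc p) $$ (i,j) = (\<Sum>l<n. (B ^\<^sub>m p) $$ (i,l) * B $$ (l,j))" if "j < n" for j
      using that i B C by (simp add: scalar_prod_def lessThan_atLeast0)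
    have z: "(B ^\<^sub>m p) $$ (i,l) * B $$ (l,j) = 0" if "l < n" "j < n" "j \<le> i" "l \<noteq> i \<or> j \<noteq> i" for l j
    proof (cases "l < i")
      case False
      then have "j < l" using that by auto
      then have "B $$ (l,j) = 0" using B that by (intro upper_triangularD[OF B(2)]) auto
      then show ?thesis by simp
    qed (use Suc i in auto)
    have "(B ^\<^sub>m Suc p) $$ (i,j) = 0" if "j < i" for j
      using e[of j] z[of _ j] that i by (auto intro!: sum.neutral)
    moreover have "(B ^\<^sub>m Suc p) $$ (i,i) = (\<Sum>l\<in>{i}. (B ^\<^sub>m p) $$ (i,l) * B $$ (l,i))"
      unfolding e[OF i] using z[of _ i] i by (intro sum.mono_neutral_right) auto
    ultimately show "(\<forall>j<i. (B ^\<^sub>m Suc p) $$ (i,j) = 0) \<and> (B ^\<^sub>m Suc p) $$ (i,i) = (B $$ (i,i)) ^ Suc p"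
      using Suc i by simp
  qed
qed

lemma trace_mult_commute:
  fixes A B :: "'a :: comm_semiring_0 mat"
  assumes A: "A \<in> carrier_mat n n" and B: "B \<in> carrier_mat n n"
  shows "(\<Sum>i<n. (A * B) $$ (i,i)) = (\<Sum>i<n. (B * A) $$ (i,i))"
proof -
  have "(\<Sum>i<n. (A * B) $$ (i,i)) = (\<Sum>i<n. \<Sum>j<n. A $$ (i,j) * B $$ (j,i))"
    using A B by (auto simp: scalar_prod_def lessThan_atLeast0 intro!: sum.cong)
  also have "\<dots> = (\<Sum>j<n. \<Sum>i<n. A $$ (i,j) * B $$ (j,i))" by (rule sum.swap)
  also have "\<dots> = (\<Sum>i<n. (B * A) $$ (i,i))"
    using A B by (auto simp: scalar_prod_def lessThan_atLeast0 mult.commute intro!: sum.cong)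
  finally show ?thesis .
qed

text \<open>One Schur triangularization supplies a single list of eigenvalues, the diagonal of
  \<open>B\<close>, that serves both the characteristic polynomial and the traces of all powers,
  with multiplicities.\<close>

lemma char_poly_trace_pow:
  fixes A :: "complex mat"
  assumes A: "A \<in> carrier_mat n n"
  obtains e :: "nat \<Rightarrow> complex" where
    "\<And>z. poly (char_poly A) z = (\<Prod>i<n. z - e i)"
    "\<And>p. (\<Sum>i<n. (A ^\<^sub>m p) $$ (i,i)) = (\<Sum>i<n. e i ^ p)"
proof -
  obtain es where es: "char_poly A = (\<Prod> a \<leftarrow> es. [:- a, 1:])" "length es = n"
    using char_poly_factorized[OF A] by blast
  obtain B where B: "B \<in> carrier_mat n n" "upper_triangular B" "similar_mat A B"
    using schur_decomposition_exists[OF A es(1)] by blast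
  obtain P Q where wit: "similar_mat_wit A B P Q" using B(3) by (auto simp: similar_mat_def)
  define e where "e i = B $$ (i,i)" for i
  have "poly (char_poly A) z = (\<Prod>i<n. z - e i)" for z
  proof -
    have "poly (char_poly A) z = (\<Prod>a\<leftarrow>diag_mat B. z - a)"
      unfolding char_poly_similar[OF B(3)] char_poly_upper_triangular[OF B(1,2)]
      by (simp add: poly_prod_list o_def)
    also have "\<dots> = (\<Prod>i<n. z - e i)"
    proof -
      have "diag_mat B = map e [0..<n]" using B(1) by (simp add: diag_mat_def e_def)
      then show ?thesis using prod.distinct_set_conv_list[of "[0..<n]" "\<lambda>i. z - e i"]
        by (simp add: o_def lessThan_atLeast0)
    qed
    finally show ?thesis .
  qed
  moreover have "(\<Sum>i<n. (A ^\<^sub>m p) $$ (i,i)) = (\<Sum>i<n. e i ^ p)" for p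
  proof -
    have w: "similar_mat_wit (A ^\<^sub>m p) (B ^\<^sub>m p) P Q" by (rule similar_mat_wit_pow[OF wit])
    have Ap: "A ^\<^sub>m p \<in> carrier_mat n n" using A by simp
    note D = similar_mat_witD2[OF Ap w]
    have "(\<Sum>i<n. (A ^\<^sub>m p) $$ (i,i)) = (\<Sum>i<n. (Q * (P * B ^\<^sub>m p)) $$ (i,i))"
      unfolding D(3) using D by (intro trace_mult_commute) auto
    also have "Q * (P * B ^\<^sub>m p) = B ^\<^sub>m p"
      using assoc_mult_mat[OF D(7) D(6) D(5)] left_mult_one_mat[OF D(5)] unfolding D(2) by simp
    also have "(\<Sum>i<n. (B ^\<^sub>m p) $$ (i,i)) = (\<Sum>i<n. e i ^ p)"
      using diag_upper_triangular_pow[OF B(1,2)] by (simp add: e_def)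
    finally show ?thesis .
  qed
  ultimately show ?thesis using that by blast
qed

lemma poly_char_poly_box_mat: "poly (char_poly (box_mat \<mu> \<nu> \<alpha> \<theta> k)) z = box_det \<mu> \<nu> \<alpha> \<theta> z k"
proof -
  define M where "M k = Matrix.mat k k (\<lambda>(i, j).
     if i = j then z - of_real (pot \<nu> \<alpha> \<theta> (int i)) else if i = Suc j \<or> j = Suc i then - of_real \<mu> else 0)" for k
  have Mc: "M k \<in> carrier_mat k k" for k by (simp add: M_def)
  have "poly (char_poly (box_mat \<mu> \<nu> \<alpha> \<theta> k)) z = Determinant.det (- (char_matrix (box_mat \<mu> \<nu> \<alpha> \<theta> k) z))"
    by (rule char_poly_matrix[OF box_mat_carrier])
  also have "- (char_matrix (box_mat \<mu> \<nu> \<alpha> \<theta> k) z) = M k"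
    by (rule eq_matI) (auto simp: M_def char_matrix_def box_mat_def)
  also have "Determinant.det (M k) = box_det \<mu> \<nu> \<alpha> \<theta> z k"
  proof (induction k rule: induct_nat_012)
    case 0 show ?case by (simp add: M_def)
  next
    case 1 show ?case by (simp add: M_def det_single)
  next
    case (ge2 n)
    let ?N = "Suc (Suc n)"
    have d1: "mat_delete (M ?N) (Suc n) (Suc n) = M (Suc n)"
      by (rule eq_matI) (auto simp: mat_delete_def M_def)
    \<comment> \<open>The last column of this minor has a single nonzero entry, the hopping in its
      last row. Expanding along it gives the second term of the recursion.\<close>
    define X where "X = mat_delete (M ?N) (Suc n) n"
    have Xc: "X \<in> carrier_mat (Suc n) (Suc n)" by (simp add: X_def M_def mat_delete_def)
    have d2: "mat_delete X n n = M n"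
      by (rule eq_matI) (auto simp: mat_delete_def M_def X_def)
    have "Determinant.det X = (\<Sum>i<Suc n. X $$ (i,n) * cofactor X i n)"
      by (rule laplace_expansion_column[OF Xc]) simp
    also have "\<dots> = X $$ (n,n) * cofactor X n n"
      by (simp add: X_def mat_delete_def M_def)
    also have "\<dots> = - of_real \<mu> * Determinant.det (M n)"
      by (simp add: cofactor_def d2) (simp add: X_def mat_delete_def M_def)
    finally have X: "Determinant.det X = - of_real \<mu> * Determinant.det (M n)" .
    have "Determinant.det (M ?N) = (\<Sum>j<?N. M ?N $$ (Suc n,j) * cofactor (M ?N) (Suc n) j)"
      by (rule laplace_expansion_row[OF Mc]) simp
    also have "\<dots> = M ?N $$ (Suc n,n) * cofactor (M ?N) (Suc n) n
        + M ?N $$ (Suc n,Suc n) * cofactor (M ?N) (Suc n) (Suc n)"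
      by (simp add: M_def)
    also have "\<dots> = (z - of_real (pot \<nu> \<alpha> \<theta> (int (Suc n)))) * Determinant.det (M (Suc n))
        - (of_real \<mu>)\<^sup>2 * Determinant.det (M n)"
      by (simp add: cofactor_def d1 X[unfolded X_def] power2_eq_square) (simp add: M_def)
    finally show ?case using ge2 by simp
  qed
  finally show ?thesis .
qed

text \<open>The roots are real and bounded because of the two zero-free regions. Having the same
  \<open>e\<close> for determinants and traces lets the logarithm of a determinant be approximated
  by traces of powers.\<close>

lemma box_det_eigenvalues:
  obtains e :: "nat \<Rightarrow> real" where
    "\<And>i. i < k \<Longrightarrow> \<bar>e i\<bar> \<le> 2 * \<bar>\<mu>\<bar> + 2 * \<bar>\<nu>\<bar>"
    "\<And>z. box_det \<mu> \<nu> \<alpha> \<theta> z k = (\<Prod>i<k. z - of_real (e i))"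
    "\<And>p. (\<Sum>i<k. (box_mat \<mu> \<nu> \<alpha> \<theta> k ^\<^sub>m p) $$ (i,i)) = of_real (\<Sum>i<k. e i ^ p)"
proof -
  obtain c where c: "\<And>z. poly (char_poly (box_mat \<mu> \<nu> \<alpha> \<theta> k)) z = (\<Prod>i<k. z - c i)"
    "\<And>p. (\<Sum>i<k. (box_mat \<mu> \<nu> \<alpha> \<theta> k ^\<^sub>m p) $$ (i,i)) = (\<Sum>i<k. c i ^ p)"
    using char_poly_trace_pow[OF box_mat_carrier] by metis
  have root: "box_det \<mu> \<nu> \<alpha> \<theta> (c i) k = 0" if "i < k" for i
    using that unfolding poly_char_poly_box_mat[symmetric] c by auto
  have re: "c i = of_real (Re (c i))" if "i < k" for i
    using box_det_nonzero[of "c i" \<mu> \<nu> \<alpha> \<theta> k] root[OF that] by (auto simp: complex_eq_iff)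
  have bd: "\<bar>Re (c i)\<bar> \<le> 2 * \<bar>\<mu>\<bar> + 2 * \<bar>\<nu>\<bar>" if "i < k" for i
    using box_det_nonzero_large[of \<mu> \<nu> "c i" \<alpha> \<theta> k] root[OF that] abs_Re_le_cmod[of "c i"] by force
  show ?thesis
  proof (rule that[of "\<lambda>i. Re (c i)"])
    show "box_det \<mu> \<nu> \<alpha> \<theta> z k = (\<Prod>i<k. z - of_real (Re (c i)))" for z
      unfolding poly_char_poly_box_mat[symmetric] c(1) by (rule prod.cong[OF refl]) (metis lessThan_iff re)
    show "(\<Sum>i<k. (box_mat \<mu> \<nu> \<alpha> \<theta> k ^\<^sub>m p) $$ (i,i)) = of_real (\<Sum>i<k. Re (c i) ^ p)" for p
      unfolding c(2) of_real_sum of_real_power using re by (intro sum.cong) auto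
  qed (rule bd)
qed

section \<open>Aubry duality for the mean logarithm of box determinants\<close>

lemma integral_period_shift:
  fixes f :: "real \<Rightarrow> 'a :: banach"
  assumes cont: "continuous_on UNIV f" and per: "\<And>x. f (x + 1) = f x"
  shows "integral {0..1} (\<lambda>x. f (x + c)) = integral {0..1} f"
proof -
  have per': "f (x + of_int k) = f x" for x k
  proof -
    have p: "f (x + of_nat n) = f x" for x n
    proof (induction n)
      case (Suc n) then show ?case using per[of "x + of_nat n"] by (simp add: add_ac)
    qed simp
    show ?thesis
    proof (cases "k \<ge> 0")
      case True then show ?thesis using p[of x "nat k"] by simp
    next
      case False then show ?thesis using p[of "x + of_int k" "nat (- k)"] by simp
    qed
  qed
  have int: "f integrable_on {a..b}" for a b
    by (rule integrable_continuous_interval) (rule continuous_on_subset[OF cont], simp)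
  define d where "d = frac c"
  have d: "0 \<le> d" "d \<le> 1" unfolding d_def using frac_lt_1[of c] by auto
  have "f (x + c) = f (x + d)" for x
    using per'[of "x + d" "\<lfloor>c\<rfloor>"] by (simp add: d_def frac_def)
  then have "integral {0..1} (\<lambda>x. f (x + c)) = integral {0..1} (f \<circ> (+) d)"
    by (simp add: o_def add.commute)
  also have "\<dots> = integral {d..1 + d} f"
    using integral_shift_Icc_real[of 0 1 f d] by simp
  also have "\<dots> = integral {d..1} f + integral {1..1 + d} f"
    using d int by (intro Henstock_Kurzweil_Integration.integral_combine[symmetric]) auto
  also have "integral {1..1 + d} f = integral {0..d} (f \<circ> (+) 1)"
    using integral_shift_Icc_real[of 0 d f 1] by (simp add: add.commute)
  also have "f \<circ> (+) 1 = f" using per by (auto simp: o_def add.commute)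
  also have "integral {d..1} f + integral {0..d} f = integral {0..1} f"
    using Henstock_Kurzweil_Integration.integral_combine[of 0 d 1 f] d int by (simp add: add.commute)
  finally show ?thesis .
qed

text \<open>\<open>walk p\<close> is H^p applied to the delta function at 0, for H on the whole
  line: the total weight of lattice paths of length p from 0 to a.\<close>

fun walk :: "real \<Rightarrow> real \<Rightarrow> real \<Rightarrow> real \<Rightarrow> nat \<Rightarrow> int \<Rightarrow> real" where
  "walk \<mu> \<nu> \<alpha> \<theta> 0 a = (if a = 0 then 1 else 0)"
| "walk \<mu> \<nu> \<alpha> \<theta> (Suc p) a = \<mu> * (walk \<mu> \<nu> \<alpha> \<theta> p (a - 1) + walk \<mu> \<nu> \<alpha> \<theta> p (a + 1))
     + pot \<nu> \<alpha> \<theta> a * walk \<mu> \<nu> \<alpha> \<theta> p a"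

lemma walk_support: "\<bar>a\<bar> > int p \<Longrightarrow> walk \<mu> \<nu> \<alpha> \<theta> p a = 0"
  by (induction p arbitrary: a) auto

lemma walk_bound: "\<bar>walk \<mu> \<nu> \<alpha> \<theta> p a\<bar> \<le> (2 * \<bar>\<mu>\<bar> + 2 * \<bar>\<nu>\<bar>) ^ p"
proof (induction p arbitrary: a)
  case (Suc p)
  let ?w = "walk \<mu> \<nu> \<alpha> \<theta> p" and ?K = "2 * \<bar>\<mu>\<bar> + 2 * \<bar>\<nu>\<bar>"
  have 1: "\<bar>\<mu> * (?w (a - 1) + ?w (a + 1))\<bar> \<le> \<bar>\<mu>\<bar> * (2 * ?K ^ p)"
    unfolding abs_mult using Suc[of "a - 1"] Suc[of "a + 1"] by (intro mult_left_mono) auto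
  have 2: "\<bar>pot \<nu> \<alpha> \<theta> a * ?w a\<bar> \<le> (2 * \<bar>\<nu>\<bar>) * ?K ^ p"
    unfolding abs_mult using Suc[of a] abs_pot_le by (intro mult_mono) auto
  have "\<bar>walk \<mu> \<nu> \<alpha> \<theta> (Suc p) a\<bar> \<le> \<bar>\<mu>\<bar> * (2 * ?K ^ p) + (2 * \<bar>\<nu>\<bar>) * ?K ^ p"
    unfolding walk.simps by (rule order_trans[OF abs_triangle_ineq add_mono[OF 1 2]])
  then show ?case by (simp add: algebra_simps)
qed simp

lemma walk_period: "walk \<mu> \<nu> \<alpha> (\<theta> + 1) p a = walk \<mu> \<nu> \<alpha> \<theta> p a"
  by (induction p arbitrary: a) (auto simp: pot_period)

lemma continuous_on_walk [continuous_intros]: "continuous_on A (\<lambda>\<theta>. walk \<mu> \<nu> \<alpha> \<theta> p a)"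
  by (induction p arbitrary: a) (auto intro!: continuous_intros)

text \<open>The p-th moment of the density of states, as the phase average of a diagonal entry of
  H^p.\<close>

definition moment :: "real \<Rightarrow> real \<Rightarrow> real \<Rightarrow> nat \<Rightarrow> real" where
  "moment \<mu> \<nu> \<alpha> p = integral {0..1} (\<lambda>\<theta>. walk \<mu> \<nu> \<alpha> \<theta> p 0)"

text \<open>A Fourier expansion in the phase turns the cosine into hops of b by one. Hopping and
  potential become the two directions of a walk on Z^2 with magnetic phases, where they can be
  exchanged.\<close>

definition wcoeff :: "real \<Rightarrow> real \<Rightarrow> real \<Rightarrow> nat \<Rightarrow> int \<Rightarrow> int \<Rightarrow> complex" where
  "wcoeff \<mu> \<nu> \<alpha> p a b = integral {0..1} (\<lambda>\<theta>. of_real (walk \<mu> \<nu> \<alpha> \<theta> p a) * cis (- (2 * pi * (of_int b * \<theta>))))"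

lemma wcoeff_has_integral:
  "((\<lambda>\<theta>. of_real (walk \<mu> \<nu> \<alpha> \<theta> p a) * cis (- (2 * pi * (of_int b * \<theta>)))) has_integral wcoeff \<mu> \<nu> \<alpha> p a b) {0..1}"
  unfolding wcoeff_def
  by (intro integrable_integral integrable_continuous_interval continuous_intros)

lemma wcoeff_0: "wcoeff \<mu> \<nu> \<alpha> 0 a b = (if a = 0 \<and> b = 0 then 1 else 0)"
proof (cases "b = 0")
  case False
  let ?f = "\<lambda>\<theta>. cis (- (2 * pi * (of_int b * \<theta>)))"
  have "?f (x + 1) = ?f x" for x
  proof -
    have "?f (x + 1) = ?f x * cis (2 * pi * of_int (- b))"
      unfolding cis_mult by (rule arg_cong[where f = cis]) (simp add: algebra_simps)
    then show ?thesis by (simp del: of_int_minus)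
  qed
  \<comment> \<open>A shift by half a period of the character reverses its sign, so the integral
    equals its own negative.\<close>
  then have "integral {0..1} (\<lambda>x. ?f (x + 1 / (2 * of_int b))) = integral {0..1} ?f"
    by (intro integral_period_shift[of ?f] continuous_intros)
  moreover have "?f (x + 1 / (2 * of_int b)) = - ?f x" for x
  proof -
    have "?f (x + 1 / (2 * of_int b)) = ?f x * cis (- pi)"
      unfolding cis_mult using False by (intro arg_cong[where f = cis]) (simp add: field_simps)
    moreover have "cis (- pi) = - 1" by (simp add: complex_eq_iff)
    ultimately show ?thesis by simp
  qed
  ultimately have "integral {0..1} ?f = 0" by simp
  then show ?thesis using False by (simp add: wcoeff_def)
qed (simp add: wcoeff_def)

lemma wcoeff_Suc:
  "wcoeff \<mu> \<nu> \<alpha> (Suc p) a b = of_real \<mu> * (wcoeff \<mu> \<nu> \<alpha> p (a - 1) b + wcoeff \<mu> \<nu> \<alpha> p (a + 1) b)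
     + of_real \<nu> * (cis (2 * pi * (of_int a * \<alpha>)) * wcoeff \<mu> \<nu> \<alpha> p a (b - 1)
         + cis (- (2 * pi * (of_int a * \<alpha>))) * wcoeff \<mu> \<nu> \<alpha> p a (b + 1))"
proof -
  let ?g = "\<lambda>a b \<theta>. complex_of_real (walk \<mu> \<nu> \<alpha> \<theta> p a) * cis (- (2 * pi * (of_int b * \<theta>)))"
  have "((\<lambda>\<theta>. of_real \<mu> * (?g (a - 1) b \<theta> + ?g (a + 1) b \<theta>)
     + of_real \<nu> * (cis (2 * pi * (of_int a * \<alpha>)) * ?g a (b - 1) \<theta>
         + cis (- (2 * pi * (of_int a * \<alpha>))) * ?g a (b + 1) \<theta>)) has_integral
    (of_real \<mu> * (wcoeff \<mu> \<nu> \<alpha> p (a - 1) b + wcoeff \<mu> \<nu> \<alpha> p (a + 1) b)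
     + of_real \<nu> * (cis (2 * pi * (of_int a * \<alpha>)) * wcoeff \<mu> \<nu> \<alpha> p a (b - 1)
         + cis (- (2 * pi * (of_int a * \<alpha>))) * wcoeff \<mu> \<nu> \<alpha> p a (b + 1)))) {0..1}"
    by (intro has_integral_add has_integral_mult_right wcoeff_has_integral)
  moreover have "of_real \<mu> * (?g (a - 1) b \<theta> + ?g (a + 1) b \<theta>)
     + of_real \<nu> * (cis (2 * pi * (of_int a * \<alpha>)) * ?g a (b - 1) \<theta>
         + cis (- (2 * pi * (of_int a * \<alpha>))) * ?g a (b + 1) \<theta>)
     = of_real (walk \<mu> \<nu> \<alpha> \<theta> (Suc p) a) * cis (- (2 * pi * (of_int b * \<theta>)))" for \<theta>
  proof -
    let ?t = "2 * pi * (\<theta> + of_int a * \<alpha>)" and ?e = "cis (- (2 * pi * (of_int b * \<theta>)))"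
    have 1: "cis (2 * pi * (of_int a * \<alpha>)) * cis (- (2 * pi * (of_int (b - 1) * \<theta>))) = cis ?t * ?e"
      unfolding cis_mult by (rule arg_cong[where f = cis]) (simp add: algebra_simps)
    have 2: "cis (- (2 * pi * (of_int a * \<alpha>))) * cis (- (2 * pi * (of_int (b + 1) * \<theta>))) = cis (- ?t) * ?e"
      unfolding cis_mult by (rule arg_cong[where f = cis]) (simp add: algebra_simps)
    have 3: "cis ?t + cis (- ?t) = of_real (2 * cos ?t)" by (simp add: complex_eq_iff)
    let ?w = "complex_of_real (walk \<mu> \<nu> \<alpha> \<theta> p a)"
    have "cis (2 * pi * (of_int a * \<alpha>)) * ?g a (b - 1) \<theta> + cis (- (2 * pi * (of_int a * \<alpha>))) * ?g a (b + 1) \<theta>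
      = ?w * (cis (2 * pi * (of_int a * \<alpha>)) * cis (- (2 * pi * (of_int (b - 1) * \<theta>))))
        + ?w * (cis (- (2 * pi * (of_int a * \<alpha>))) * cis (- (2 * pi * (of_int (b + 1) * \<theta>))))"
      by (simp only: mult_ac)
    also have "\<dots> = ?w * (cis ?t + cis (- ?t)) * ?e"
      unfolding 1 2 by (simp add: algebra_simps)
    also have "\<dots> = ?w * of_real (2 * cos ?t) * ?e" unfolding 3 ..
    finally show ?thesis by (simp add: pot_def algebra_simps)
  qed
  ultimately show ?thesis using wcoeff_has_integral[of \<mu> \<nu> \<alpha> "Suc p" a b] by (simp only: has_integral_unique)
qed

text \<open>Aubry duality at the level of moments: rotating the lattice of exponents by a quarter turn
  exchanges hopping and potential, up to a gauge phase.\<close>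

lemma wcoeff_dual: "wcoeff \<mu> \<nu> \<alpha> p a b = cis (2 * pi * (of_int (a * b) * \<alpha>)) * wcoeff \<nu> \<mu> \<alpha> p b (- a)"
proof (induction p arbitrary: a b)
  case 0 show ?case by (auto simp: wcoeff_0)
next
  case (Suc p)
  let ?e = "\<lambda>k. cis (2 * pi * (of_int k * \<alpha>))"
  have e: "?e i * ?e j = ?e (i + j)" for i j by (simp add: cis_mult algebra_simps)
  have m: "cis (- (2 * pi * (of_int k * \<alpha>))) = ?e (- k)" for k by simp
  have "wcoeff \<mu> \<nu> \<alpha> (Suc p) a b
     = of_real \<mu> * (?e ((a - 1) * b) * wcoeff \<nu> \<mu> \<alpha> p b (- (a - 1)) + ?e ((a + 1) * b) * wcoeff \<nu> \<mu> \<alpha> p b (- (a + 1)))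
     + of_real \<nu> * (?e a * (?e (a * (b - 1)) * wcoeff \<nu> \<mu> \<alpha> p (b - 1) (- a))
         + ?e (- a) * (?e (a * (b + 1)) * wcoeff \<nu> \<mu> \<alpha> p (b + 1) (- a)))"
    unfolding wcoeff_Suc[of \<mu> \<nu>] m Suc[of "a - 1" b] Suc[of "a + 1" b] Suc[of a "b - 1"] Suc[of a "b + 1"] ..
  also have "\<dots> = of_real \<mu> * (?e (a * b + (- b)) * wcoeff \<nu> \<mu> \<alpha> p b (- a + 1) + ?e (a * b + b) * wcoeff \<nu> \<mu> \<alpha> p b (- a - 1))
     + of_real \<nu> * (?e (a * b) * wcoeff \<nu> \<mu> \<alpha> p (b - 1) (- a) + ?e (a * b) * wcoeff \<nu> \<mu> \<alpha> p (b + 1) (- a))"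
  proof -
    have i: "(a - 1) * b = a * b + (- b)" "(a + 1) * b = a * b + b" "- (a - 1) = - a + 1" "- (a + 1) = - a - 1"
      by (simp_all add: algebra_simps)
    have "a + a * (b - 1) = a * b" "- a + a * (b + 1) = a * b" by (simp_all add: algebra_simps)
    then have h: "?e a * (?e (a * (b - 1)) * x) = ?e (a * b) * x" "?e (- a) * (?e (a * (b + 1)) * x) = ?e (a * b) * x" for x
      using e[of a "a * (b - 1)"] e[of "- a" "a * (b + 1)"] by (metis mult.assoc)+
    show ?thesis unfolding i h ..
  qed
  also have "\<dots> = ?e (a * b) * wcoeff \<nu> \<mu> \<alpha> (Suc p) b (- a)"
    unfolding wcoeff_Suc[of \<nu> \<mu>] m e[symmetric] by (simp only: algebra_simps)
  finally show ?case .
qed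

lemma moment_dual: "moment \<mu> \<nu> \<alpha> p = moment \<nu> \<mu> \<alpha> p"
proof -
  have "moment \<mu> \<nu> \<alpha> p = Re (wcoeff \<mu> \<nu> \<alpha> p 0 0)" for \<mu> \<nu>
  proof -
    have "((\<lambda>\<theta>. Re (of_real (walk \<mu> \<nu> \<alpha> \<theta> p 0) * cis (- (2 * pi * (of_int 0 * \<theta>))))) has_integral Re (wcoeff \<mu> \<nu> \<alpha> p 0 0)) {0..1}"
      by (rule has_integral_Re[OF wcoeff_has_integral])
    then show ?thesis unfolding moment_def by (simp add: integral_unique)
  qed
  then show ?thesis using wcoeff_dual[of \<mu> \<nu> \<alpha> p 0 0] by simp
qed

section \<open>Powers of a box matrix and their averaged traces\<close>

lemma box_mat_pow_Suc:
  assumes i: "i < k" and j: "j < k"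
  shows "(box_mat \<mu> \<nu> \<alpha> \<theta> k ^\<^sub>m Suc p) $$ (i, j) =
     (box_mat \<mu> \<nu> \<alpha> \<theta> k ^\<^sub>m p) $$ (i, j) * of_real (pot \<nu> \<alpha> \<theta> (int j))
     + (if 0 < j then (box_mat \<mu> \<nu> \<alpha> \<theta> k ^\<^sub>m p) $$ (i, j - 1) else 0) * of_real \<mu>
     + (if Suc j < k then (box_mat \<mu> \<nu> \<alpha> \<theta> k ^\<^sub>m p) $$ (i, Suc j) else 0) * of_real \<mu>"
proof -
  let ?A = "box_mat \<mu> \<nu> \<alpha> \<theta> k"
  have C: "?A ^\<^sub>m p \<in> carrier_mat k k" by simp
  have "(?A ^\<^sub>m Suc p) $$ (i, j) = (\<Sum>l<k. (?A ^\<^sub>m p) $$ (i, l) * ?A $$ (l, j))"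
    using i j carrier_matD[OF C] carrier_matD[OF box_mat_carrier[of \<mu> \<nu> \<alpha> \<theta> k]]
    by (simp add: scalar_prod_def lessThan_atLeast0)
  also have "\<dots> = (\<Sum>l<k. (if l = j then (?A ^\<^sub>m p) $$ (i, j) * of_real (pot \<nu> \<alpha> \<theta> (int j)) else 0)
      + (if l = j - 1 then (if 0 < j then (?A ^\<^sub>m p) $$ (i, j - 1) else 0) * of_real \<mu> else 0)
      + (if l = Suc j then (?A ^\<^sub>m p) $$ (i, Suc j) * of_real \<mu> else 0))"
    using j by (intro sum.cong refl) (auto simp: box_mat_def)
  also have "\<dots> = (?A ^\<^sub>m p) $$ (i, j) * of_real (pot \<nu> \<alpha> \<theta> (int j))
      + (if 0 < j then (?A ^\<^sub>m p) $$ (i, j - 1) else 0) * of_real \<mu>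
      + (if Suc j < k then (?A ^\<^sub>m p) $$ (i, Suc j) else 0) * of_real \<mu>"
    using j by (simp add: sum.distrib)
  finally show ?thesis .
qed

lemma box_mat_pow_bound:
  assumes i: "i < k" and j: "j < k"
  shows "cmod ((box_mat \<mu> \<nu> \<alpha> \<theta> k ^\<^sub>m p) $$ (i, j)) \<le> (2 * \<bar>\<mu>\<bar> + 2 * \<bar>\<nu>\<bar>) ^ p"
  using j
proof (induction p arbitrary: j)
  case 0 then show ?case using i by (auto simp: box_mat_def)
next
  case (Suc p)
  let ?P = "\<lambda>j. (box_mat \<mu> \<nu> \<alpha> \<theta> k ^\<^sub>m p) $$ (i, j)" and ?K = "2 * \<bar>\<mu>\<bar> + 2 * \<bar>\<nu>\<bar>"
  have K: "?K ^ p \<ge> 0" by simp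
  have 1: "cmod (?P j * of_real (pot \<nu> \<alpha> \<theta> (int j))) \<le> ?K ^ p * (2 * \<bar>\<nu>\<bar>)"
    unfolding norm_mult using Suc(1)[OF Suc(2)] abs_pot_le by (intro mult_mono) auto
  have 2: "cmod ((if 0 < j then ?P (j - 1) else 0) * of_real \<mu>) \<le> ?K ^ p * \<bar>\<mu>\<bar>"
    unfolding norm_mult using Suc(1)[of "j - 1"] Suc(2) K by (intro mult_mono) auto
  have 3: "cmod ((if Suc j < k then ?P (Suc j) else 0) * of_real \<mu>) \<le> ?K ^ p * \<bar>\<mu>\<bar>"
    unfolding norm_mult using Suc(1)[of "Suc j"] K by (intro mult_mono) auto
  have "cmod ((box_mat \<mu> \<nu> \<alpha> \<theta> k ^\<^sub>m Suc p) $$ (i, j)) \<le> ?K ^ p * (2 * \<bar>\<nu>\<bar>) + ?K ^ p * \<bar>\<mu>\<bar> + ?K ^ p * \<bar>\<mu>\<bar>"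
    unfolding box_mat_pow_Suc[OF i Suc(2)] by (rule norm_triangle_mono[OF norm_triangle_mono[OF 1 2] 3])
  then show ?case by (simp add: algebra_simps)
qed

lemma continuous_on_box_mat_pow:
  assumes i: "i < k" and j: "j < k"
  shows "continuous_on A (\<lambda>\<theta>. (box_mat \<mu> \<nu> \<alpha> \<theta> k ^\<^sub>m p) $$ (i, j))"
  using j
proof (induction p arbitrary: j)
  case 0 then show ?case using i by (auto simp: box_mat_def)
next
  case (Suc p)
  have "continuous_on A (\<lambda>\<theta>. if 0 < j then (box_mat \<mu> \<nu> \<alpha> \<theta> k ^\<^sub>m p) $$ (i, j - 1) else 0)"
    using Suc(1)[of "j - 1"] Suc(2) by (cases "0 < j") auto
  moreover have "continuous_on A (\<lambda>\<theta>. if Suc j < k then (box_mat \<mu> \<nu> \<alpha> \<theta> k ^\<^sub>m p) $$ (i, Suc j) else 0)"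
    using Suc(1)[of "Suc j"] by (cases "Suc j < k") auto
  ultimately show ?case unfolding box_mat_pow_Suc[OF i Suc(2)]
    using Suc(1)[OF Suc(2)] by (intro continuous_intros)
qed

text \<open>Finite propagation: a path of p steps from site i has not yet felt the edges. The phase
  is moved by i steps so that the path starts at 0.\<close>

lemma box_mat_pow_walk:
  assumes "p \<le> i" "i + p < k" "j < k"
  shows "(box_mat \<mu> \<nu> \<alpha> \<theta> k ^\<^sub>m p) $$ (i, j) = of_real (walk \<mu> \<nu> \<alpha> (\<theta> + of_int (int i) * \<alpha>) p (int j - int i))"
  using assms
proof (induction p arbitrary: j)
  case 0 then show ?case by (auto simp: box_mat_def)
next
  case (Suc p)
  let ?w = "walk \<mu> \<nu> \<alpha> (\<theta> + of_int (int i) * \<alpha>) p" and ?P = "box_mat \<mu> \<nu> \<alpha> \<theta> k ^\<^sub>m p"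
  have i: "i < k" using Suc by simp
  have IH: "?P $$ (i, j) = of_real (?w (int j - int i))" if "j < k" for j
    using Suc that by auto
  have 1: "(if 0 < j then ?P $$ (i, j - 1) else 0) = of_real (?w (int j - int i - 1))"
  proof (cases "0 < j")
    case True
    then have e: "int (j - 1) - int i = int j - int i - 1" by auto
    have "?P $$ (i, j - 1) = of_real (?w (int (j - 1) - int i))" by (rule IH) (use Suc(4) in auto)
    then show ?thesis unfolding e using True by simp
  next
    case False then show ?thesis using Suc(2) by (simp add: walk_support)
  qed
  have 2: "(if Suc j < k then ?P $$ (i, Suc j) else 0) = of_real (?w (int j - int i + 1))"
  proof (cases "Suc j < k")
    case True
    have e: "int (Suc j) - int i = int j - int i + 1" by auto
    show ?thesis using IH[OF True] True unfolding e by simp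
  next
    case False then show ?thesis using Suc(3,4) by (simp add: walk_support)
  qed
  have 3: "pot \<nu> \<alpha> (\<theta> + of_int (int i) * \<alpha>) (int j - int i) = pot \<nu> \<alpha> \<theta> (int j)"
    by (simp only: pot_shift) simp
  show ?case unfolding box_mat_pow_Suc[OF i Suc(4)] IH[OF Suc(4)] 1 2 walk.simps 3
    by (simp add: algebra_simps)
qed

text \<open>A site at distance at least p from the edges contributes \<open>walk\<close> at a
  translated phase, hence the moment after averaging. At most \<open>2 * p\<close> sites remain,
  each off by at most twice the p-th power of the norm bound.\<close>

lemma trace_integral:
  "\<bar>integral {0..1} (\<lambda>\<theta>. Re (\<Sum>i<k. (box_mat \<mu> \<nu> \<alpha> \<theta> k ^\<^sub>m p) $$ (i, i))) - real k * moment \<mu> \<nu> \<alpha> p\<bar>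
    \<le> 4 * real p * (2 * \<bar>\<mu>\<bar> + 2 * \<bar>\<nu>\<bar>) ^ p"
proof -
  let ?K = "2 * \<bar>\<mu>\<bar> + 2 * \<bar>\<nu>\<bar>"
  define I where "I i = integral {0..1} (\<lambda>\<theta>. Re ((box_mat \<mu> \<nu> \<alpha> \<theta> k ^\<^sub>m p) $$ (i, i)))" for i
  define good where "good i \<longleftrightarrow> p \<le> i \<and> i + p < k" for i
  have cont: "continuous_on {0..1} (\<lambda>\<theta>. Re ((box_mat \<mu> \<nu> \<alpha> \<theta> k ^\<^sub>m p) $$ (i, i)))" if "i < k" for i
    by (intro continuous_intros continuous_on_box_mat_pow that)
  have int: "integral {0..1} (\<lambda>\<theta>. Re (\<Sum>i<k. (box_mat \<mu> \<nu> \<alpha> \<theta> k ^\<^sub>m p) $$ (i, i))) = (\<Sum>i<k. I i)"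
    unfolding I_def Re_sum using cont by (intro integral_sum integrable_continuous_interval) auto
  have g: "I i = moment \<mu> \<nu> \<alpha> p" if "good i" for i
  proof -
    have "I i = integral {0..1} (\<lambda>\<theta>. walk \<mu> \<nu> \<alpha> (\<theta> + of_int (int i) * \<alpha>) p 0)"
      using that box_mat_pow_walk[of p i k i] by (simp add: I_def good_def)
    also have "\<dots> = moment \<mu> \<nu> \<alpha> p" unfolding moment_def
      by (rule integral_period_shift[where f = "\<lambda>\<theta>. walk \<mu> \<nu> \<alpha> \<theta> p 0"]) (auto simp: walk_period intro!: continuous_intros)
    finally show ?thesis .
  qed
  have mb: "\<bar>moment \<mu> \<nu> \<alpha> p\<bar> \<le> ?K ^ p"
  proof -
    have "norm (integral {0..1} (\<lambda>\<theta>. walk \<mu> \<nu> \<alpha> \<theta> p 0)) \<le> ?K ^ p * (1 - 0)"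
      by (rule integral_bound) (auto simp: walk_bound intro!: continuous_intros)
    then show ?thesis by (simp add: moment_def)
  qed
  have Ib: "\<bar>I i\<bar> \<le> ?K ^ p" if "i < k" for i
  proof -
    have "norm (integral {0..1} (\<lambda>\<theta>. Re ((box_mat \<mu> \<nu> \<alpha> \<theta> k ^\<^sub>m p) $$ (i, i)))) \<le> ?K ^ p * (1 - 0)"
      using box_mat_pow_bound[OF that that] abs_Re_le_cmod order_trans
      by (intro integral_bound cont[OF that]) (auto, blast)
    then show ?thesis by (simp add: I_def)
  qed
  have "\<bar>(\<Sum>i<k. I i) - real k * moment \<mu> \<nu> \<alpha> p\<bar> = \<bar>\<Sum>i<k. (I i - moment \<mu> \<nu> \<alpha> p)\<bar>"
    by (simp add: sum_subtractf)
  also have "\<dots> \<le> (\<Sum>i<k. \<bar>I i - moment \<mu> \<nu> \<alpha> p\<bar>)" by (rule sum_abs)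
  also have "\<dots> \<le> (\<Sum>i<k. if good i then 0 else 2 * ?K ^ p)"
  proof (rule sum_mono)
    fix i assume "i \<in> {..<k}"
    then have "\<bar>I i - moment \<mu> \<nu> \<alpha> p\<bar> \<le> 2 * ?K ^ p" using Ib[of i] mb by auto
    then show "\<bar>I i - moment \<mu> \<nu> \<alpha> p\<bar> \<le> (if good i then 0 else 2 * ?K ^ p)" using g by auto
  qed
  also have "\<dots> = (\<Sum>i\<in>{i\<in>{..<k}. \<not> good i}. 2 * ?K ^ p)"
    by (subst sum.inter_filter) (auto intro!: sum.cong)
  also have "\<dots> = real (card {i\<in>{..<k}. \<not> good i}) * (2 * ?K ^ p)" by simp
  also have "card {i\<in>{..<k}. \<not> good i} \<le> card ({..<p} \<union> {k - p..<k})"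
    by (rule card_mono) (auto simp: good_def)
  also have "\<dots> \<le> p + p" using card_Un_le[of "{..<p}" "{k - p..<k}"] by simp
  finally have "\<bar>(\<Sum>i<k. I i) - real k * moment \<mu> \<nu> \<alpha> p\<bar> \<le> real (p + p) * (2 * ?K ^ p)"
    by (simp add: mult_right_mono)
  then show ?thesis unfolding int by simp
qed

section \<open>Convergence of the normalized mean logarithms\<close>

definition mean_log_det :: "real \<Rightarrow> real \<Rightarrow> real \<Rightarrow> complex \<Rightarrow> nat \<Rightarrow> real" where
  "mean_log_det \<mu> \<nu> \<alpha> z k = integral {0..1} (\<lambda>\<theta>. ln (cmod (box_det \<mu> \<nu> \<alpha> \<theta> z k)))"

lemma continuous_on_log_det:
  "Im z \<noteq> 0 \<Longrightarrow> continuous_on A (\<lambda>\<theta>. ln (cmod (box_det \<mu> \<nu> \<alpha> \<theta> z k)))"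
  by (intro continuous_intros) (simp add: box_det_nonzero)

text \<open>The logarithm of the determinant is a sum over eigenvalues. A polynomial in place of the
  logarithm turns it into traces of powers, so the error is \<epsilon> per eigenvalue plus an edge
  effect independent of k.\<close>

lemma mean_log_det_approx:
  assumes z: "Im z \<noteq> 0"
    and approx: "\<And>x. \<bar>x\<bar> \<le> 2 * \<bar>\<mu>\<bar> + 2 * \<bar>\<nu>\<bar> \<Longrightarrow> \<bar>ln (cmod (z - of_real x)) - (\<Sum>p\<le>n. a p * x ^ p)\<bar> \<le> \<epsilon>"
  shows "\<bar>mean_log_det \<mu> \<nu> \<alpha> z k - real k * (\<Sum>p\<le>n. a p * moment \<mu> \<nu> \<alpha> p)\<bar>
     \<le> real k * \<epsilon> + (\<Sum>p\<le>n. \<bar>a p\<bar> * (4 * real p * (2 * \<bar>\<mu>\<bar> + 2 * \<bar>\<nu>\<bar>) ^ p))"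
proof -
  let ?K = "2 * \<bar>\<mu>\<bar> + 2 * \<bar>\<nu>\<bar>"
  define tr where "tr p \<theta> = Re (\<Sum>i<k. (box_mat \<mu> \<nu> \<alpha> \<theta> k ^\<^sub>m p) $$ (i, i))" for p \<theta>
  let ?f = "\<lambda>\<theta>. ln (cmod (box_det \<mu> \<nu> \<alpha> \<theta> z k))"
  have pw: "\<bar>?f \<theta> - (\<Sum>p\<le>n. a p * tr p \<theta>)\<bar> \<le> real k * \<epsilon>" for \<theta>
  proof -
    obtain e where e: "\<And>i. i < k \<Longrightarrow> \<bar>e i\<bar> \<le> ?K"
      "\<And>z. box_det \<mu> \<nu> \<alpha> \<theta> z k = (\<Prod>i<k. z - of_real (e i))"
      "\<And>p. (\<Sum>i<k. (box_mat \<mu> \<nu> \<alpha> \<theta> k ^\<^sub>m p) $$ (i,i)) = of_real (\<Sum>i<k. e i ^ p)"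
      by (rule box_det_eigenvalues[of k \<mu> \<nu> \<alpha> \<theta>]) (rule that)
    have nz: "z - of_real x \<noteq> 0" for x using z by (auto simp: complex_eq_iff)
    have "?f \<theta> = (\<Sum>i<k. ln (cmod (z - of_real (e i))))"
      unfolding e(2) prod_norm[symmetric] using nz by (intro ln_prod) auto
    moreover have "(\<Sum>p\<le>n. a p * tr p \<theta>) = (\<Sum>i<k. \<Sum>p\<le>n. a p * e i ^ p)"
      unfolding tr_def e(3) Re_complex_of_real sum_distrib_left by (rule sum.swap)
    ultimately have "\<bar>?f \<theta> - (\<Sum>p\<le>n. a p * tr p \<theta>)\<bar> = \<bar>\<Sum>i<k. ln (cmod (z - of_real (e i))) - (\<Sum>p\<le>n. a p * e i ^ p)\<bar>"
      by (simp add: sum_subtractf)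
    also have "\<dots> \<le> (\<Sum>i<k. \<bar>ln (cmod (z - of_real (e i))) - (\<Sum>p\<le>n. a p * e i ^ p)\<bar>)" by (rule sum_abs)
    also have "\<dots> \<le> (\<Sum>i<k. \<epsilon>)" using e(1) by (intro sum_mono approx) auto
    finally show ?thesis by simp
  qed
  have ct: "continuous_on {0..1} (tr p)" for p unfolding tr_def
    by (intro continuous_intros continuous_on_box_mat_pow) auto
  have cS: "continuous_on {0..1} (\<lambda>\<theta>. \<Sum>p\<le>n. a p * tr p \<theta>)" by (intro continuous_intros ct)
  have cf: "continuous_on {0..1} ?f" by (rule continuous_on_log_det[OF z])
  have "integral {0..1} ?f - integral {0..1} (\<lambda>\<theta>. \<Sum>p\<le>n. a p * tr p \<theta>) = integral {0..1} (\<lambda>\<theta>. ?f \<theta> - (\<Sum>p\<le>n. a p * tr p \<theta>))"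
    using cf cS by (intro integral_diff[symmetric] integrable_continuous_interval)
  moreover have "norm (integral {0..1} (\<lambda>\<theta>. ?f \<theta> - (\<Sum>p\<le>n. a p * tr p \<theta>))) \<le> real k * \<epsilon> * (1 - 0)"
    using pw by (intro integral_bound continuous_on_diff cf cS) auto
  moreover have "integral {0..1} (\<lambda>\<theta>. \<Sum>p\<le>n. a p * tr p \<theta>) = (\<Sum>p\<le>n. a p * integral {0..1} (tr p))"
    using ct by (subst integral_sum) (auto intro!: integrable_continuous_interval continuous_intros)
  ultimately have 1: "\<bar>mean_log_det \<mu> \<nu> \<alpha> z k - (\<Sum>p\<le>n. a p * integral {0..1} (tr p))\<bar> \<le> real k * \<epsilon>"
    by (simp add: mean_log_det_def)
  have "\<bar>(\<Sum>p\<le>n. a p * integral {0..1} (tr p)) - real k * (\<Sum>p\<le>n. a p * moment \<mu> \<nu> \<alpha> p)\<bar>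
     = \<bar>\<Sum>p\<le>n. a p * (integral {0..1} (tr p) - real k * moment \<mu> \<nu> \<alpha> p)\<bar>"
    by (simp add: sum_distrib_left sum_subtractf algebra_simps)
  also have "\<dots> \<le> (\<Sum>p\<le>n. \<bar>a p * (integral {0..1} (tr p) - real k * moment \<mu> \<nu> \<alpha> p)\<bar>)" by (rule sum_abs)
  also have "\<dots> \<le> (\<Sum>p\<le>n. \<bar>a p\<bar> * (4 * real p * ?K ^ p))"
    unfolding abs_mult using trace_integral[of \<mu> \<nu> \<alpha> k] by (intro sum_mono mult_left_mono) (auto simp: tr_def[abs_def])
  finally show ?thesis using 1 by linarith
qed

text \<open>For each tolerance one polynomial approximates ln |z - x| on an interval that holds all
  box eigenvalues. Interval and moments are unchanged when the couplings are exchanged, so both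
  sequences end up near the same number \<tau>; shrinking the tolerance gives a common
  limit.\<close>

lemma mean_log_det_dual_limit:
  assumes z: "Im z \<noteq> 0"
  obtains l where "(\<lambda>k. mean_log_det \<mu> \<nu> \<alpha> z k / real k) \<longlonglongrightarrow> l"
    "(\<lambda>k. mean_log_det \<nu> \<mu> \<alpha> z k / real k) \<longlonglongrightarrow> l"
proof -
  let ?K = "2 * \<bar>\<mu>\<bar> + 2 * \<bar>\<nu>\<bar>"
  let ?A = "\<lambda>k. mean_log_det \<mu> \<nu> \<alpha> z k / real k" and ?B = "\<lambda>k. mean_log_det \<nu> \<mu> \<alpha> z k / real k"
  have main: "\<exists>\<tau> N. \<forall>k\<ge>N. \<bar>?A k - \<tau>\<bar> < \<epsilon> \<and> \<bar>?B k - \<tau>\<bar> < \<epsilon>" if \<epsilon>: "\<epsilon> > 0" for \<epsilon>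
  proof -
    have nz: "z - of_real x \<noteq> 0" for x using z by (auto simp: complex_eq_iff)
    have "continuous_on {-?K..?K} (\<lambda>x. ln (cmod (z - of_real x)))"
      using nz by (intro continuous_intros) auto
    moreover have "\<epsilon> / 3 > 0" using \<epsilon> by simp
    ultimately obtain g where g: "real_polynomial_function g"
      "\<And>x. x \<in> {-?K..?K} \<Longrightarrow> \<bar>ln (cmod (z - of_real x)) - g x\<bar> < \<epsilon> / 3"
      using Stone_Weierstrass_real_polynomial_function[OF compact_Icc] by blast
    obtain a n where gn: "g = (\<lambda>x. \<Sum>p\<le>n. a p * x ^ p)"
      using g(1) unfolding real_polynomial_function_iff_sum by blast
    define \<tau> where "\<tau> = (\<Sum>p\<le>n. a p * moment \<mu> \<nu> \<alpha> p)"
    define M where "M = (\<Sum>p\<le>n. \<bar>a p\<bar> * (4 * real p * ?K ^ p))"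
    have ap: "\<bar>ln (cmod (z - of_real x)) - (\<Sum>p\<le>n. a p * x ^ p)\<bar> \<le> \<epsilon> / 3" if "\<bar>x\<bar> \<le> ?K" for x
      using g(2)[of x] that unfolding gn by force
    have A: "\<bar>mean_log_det \<mu> \<nu> \<alpha> z k - real k * \<tau>\<bar> \<le> real k * (\<epsilon> / 3) + M" for k
      unfolding \<tau>_def M_def by (rule mean_log_det_approx[OF z ap])
    have B: "\<bar>mean_log_det \<nu> \<mu> \<alpha> z k - real k * \<tau>\<bar> \<le> real k * (\<epsilon> / 3) + M" for k
    proof -
      have "\<bar>mean_log_det \<nu> \<mu> \<alpha> z k - real k * (\<Sum>p\<le>n. a p * moment \<nu> \<mu> \<alpha> p)\<bar>
         \<le> real k * (\<epsilon> / 3) + (\<Sum>p\<le>n. \<bar>a p\<bar> * (4 * real p * (2 * \<bar>\<nu>\<bar> + 2 * \<bar>\<mu>\<bar>) ^ p))"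
        by (rule mean_log_det_approx[OF z ap]) simp
      then show ?thesis unfolding \<tau>_def M_def moment_dual[of \<nu> \<mu>] by (simp add: add.commute)
    qed
    obtain N where N: "real N > 3 * M / \<epsilon>" using reals_Archimedean2 by blast
    have *: "\<bar>d / real k - \<tau>\<bar> < \<epsilon>" if "\<bar>d - real k * \<tau>\<bar> \<le> real k * (\<epsilon> / 3) + M" "k \<ge> Suc N" for d k
    proof -
      have k: "real k > 0" "real k \<ge> real N" using that(2) by auto
      have "3 * M / \<epsilon> < real k" using N k(2) by linarith
      then have "M < real k * (\<epsilon> / 3)" using \<epsilon> by (simp add: field_simps)
      then have "\<bar>d - real k * \<tau>\<bar> < real k * (2 * \<epsilon> / 3)" using that(1) by simp
      then have "\<bar>d - real k * \<tau>\<bar> / real k < 2 * \<epsilon> / 3" using k by (simp add: field_simps)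
      moreover have "\<bar>d - real k * \<tau>\<bar> / real k = \<bar>d / real k - \<tau>\<bar>"
      proof -
        have "d / real k - \<tau> = (d - real k * \<tau>) / real k" using k by (simp add: field_simps)
        then show ?thesis using k by simp
      qed
      ultimately show ?thesis using \<epsilon> by linarith
    qed
    show ?thesis using *[OF A] *[OF B] by blast
  qed
  have "Cauchy ?A"
  proof (rule metric_CauchyI)
    fix e :: real assume "e > 0"
    then obtain \<tau> N where "\<forall>k\<ge>N. \<bar>?A k - \<tau>\<bar> < e / 2 \<and> \<bar>?B k - \<tau>\<bar> < e / 2" using main[of "e / 2"] by auto
    then show "\<exists>M. \<forall>m\<ge>M. \<forall>n\<ge>M. dist (?A m) (?A n) < e"
      by (intro exI[of _ N] allI impI) (smt (verit) dist_real_def field_sum_of_halves)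
  qed
  then obtain l where l: "?A \<longlonglongrightarrow> l" using Cauchy_convergent_iff convergent_def by blast
  have "(\<lambda>k. ?B k - ?A k) \<longlonglongrightarrow> 0"
  proof (rule LIMSEQ_I)
    fix e :: real assume "e > 0"
    then obtain \<tau> N where "\<forall>k\<ge>N. \<bar>?A k - \<tau>\<bar> < e / 2 \<and> \<bar>?B k - \<tau>\<bar> < e / 2" using main[of "e / 2"] by auto
    then show "\<exists>N. \<forall>k\<ge>N. norm (?B k - ?A k - 0) < e"
      by (intro exI[of _ N] allI impI) (smt (verit) real_norm_def field_sum_of_halves)
  qed
  then have "(\<lambda>k. (?B k - ?A k) + ?A k) \<longlonglongrightarrow> 0 + l" using l by (rule tendsto_add)
  then show ?thesis using that[OF l] by simp
qed

section \<open>Dual solutions of a localized eigenfunction\<close>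

lemma cis_2pi_eq_1_iff: "cis (2 * pi * x) = 1 \<longleftrightarrow> x \<in> \<int>"
proof
  assume "cis (2 * pi * x) = 1"
  then have "cos (2 * pi * x) = 1" by (metis cis.simps(1) one_complex.simps(1))
  then obtain n :: int where "2 * pi * x = of_int n * 2 * pi" using cos_one_2pi_int by auto
  then show "x \<in> \<int>" by simp
qed (auto elim!: Ints_cases)

lemma cis_plus_minus: "cis (a + b) + cis (a - b) = 2 * of_real (cos b) * cis a"
  by (auto simp: complex_eq_iff cos_add sin_add cos_diff sin_diff)

lemma has_sum_diff:
  fixes f g :: "'a \<Rightarrow> 'b :: real_normed_field"
  assumes "(f has_sum a) A" "(g has_sum b) A"
  shows "((\<lambda>x. f x - g x) has_sum (a - b)) A"
  using has_sum_add[OF assms(1) has_sum_cmult_right[OF assms(2), of "-1"]] by simp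

lemma has_sum_sum:
  fixes f :: "'i \<Rightarrow> 'a \<Rightarrow> 'b :: topological_comm_monoid_add"
  assumes "finite I" "\<And>i. i \<in> I \<Longrightarrow> (f i has_sum s i) A"
  shows "((\<lambda>x. \<Sum>i\<in>I. f i x) has_sum (\<Sum>i\<in>I. s i)) A"
  using assms by (induction I rule: finite_induct) (auto intro!: has_sum_add has_sum_0)

lemma norm_has_sum_le:
  fixes f :: "'a \<Rightarrow> 'b :: banach"
  assumes f: "(f has_sum a) A" and g: "(g has_sum S) A" and le: "\<And>x. x \<in> A \<Longrightarrow> norm (f x) \<le> g x"
  shows "norm a \<le> S"
proof -
  have s: "(\<lambda>x. norm (f x)) summable_on A"
    by (rule Infinite_Sum.abs_summable_on_comparison_test'[OF has_sum_imp_summable[OF g]]) (rule le)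
  have "norm a \<le> (\<Sum>\<^sub>\<infinity>x\<in>A. norm (f x))"
    by (rule norm_has_sum_bound[OF has_sum_infsum[OF s] f])
  also have "\<dots> \<le> S" by (rule has_sum_mono[OF has_sum_infsum[OF s] g]) (rule le)
  finally show ?thesis .
qed

lemma has_sum_int_shift:
  fixes f :: "int \<Rightarrow> 'a :: {comm_monoid_add, topological_space}"
  shows "((\<lambda>m. f (m + c)) has_sum S) UNIV \<longleftrightarrow> (f has_sum S) UNIV"
  by (rule has_sum_reindex_bij_betw) (auto intro!: bij_betwI[where g = "\<lambda>m. m - c"])

text \<open>Averages of characters detect atoms; \<open>wronskian_nonzero\<close> uses them in the
  manner of Wiener to isolate one atom of a measure on the circle.\<close>

lemma cesaro_cis:
  "(\<lambda>N. (\<Sum>n<N. cis (2 * pi * (real n * x))) / of_nat N) \<longlonglongrightarrow> (if x \<in> \<int> then 1 else 0)"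
proof (cases "x \<in> \<int>")
  case True
  have "cis (2 * pi * (real n * x)) = 1" for n
    using True by (subst cis_2pi_eq_1_iff) auto
  moreover have "\<forall>\<^sub>F N in sequentially. (of_nat N :: complex) / of_nat N = 1"
    using eventually_gt_at_top[of 0] by eventually_elim simp
  ultimately show ?thesis using True by (simp add: tendsto_eventually)
next
  case False
  let ?w = "cis (2 * pi * x)"
  have w: "?w \<noteq> 1" using False by (simp add: cis_2pi_eq_1_iff)
  have p: "cis (2 * pi * (real n * x)) = ?w ^ n" for n
    by (simp only: Complex.DeMoivre) (simp add: algebra_simps)
  have b: "cmod ((\<Sum>n<N. ?w ^ n) / of_nat N) \<le> (2 / cmod (?w - 1)) * inverse (real N)" for N
  proof -
    have "cmod (\<Sum>n<N. ?w ^ n) = cmod (?w ^ N - 1) / cmod (?w - 1)"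
      using geometric_sum[OF w, of N] by (simp add: norm_divide)
    also have "\<dots> \<le> 2 / cmod (?w - 1)"
      using norm_triangle_ineq4[of "?w ^ N" 1] by (intro divide_right_mono) (auto simp: norm_power)
    finally have "cmod (\<Sum>n<N. ?w ^ n) * inverse (real N) \<le> 2 / cmod (?w - 1) * inverse (real N)"
      by (intro mult_right_mono) auto
    then show ?thesis unfolding norm_divide norm_of_nat divide_inverse[of "cmod (sum _ _)"] .
  qed
  have "(\<lambda>N. (2 / cmod (?w - 1)) * inverse (real N)) \<longlonglongrightarrow> (2 / cmod (?w - 1)) * 0"
    by (intro tendsto_intros LIMSEQ_inverse_real_of_nat[THEN LIMSEQ_imp_Suc])
  then have "(\<lambda>N. (2 / cmod (?w - 1)) * inverse (real N)) \<longlonglongrightarrow> 0" by simp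
  then have "(\<lambda>N. (\<Sum>n<N. ?w ^ n) / of_nat N) \<longlonglongrightarrow> 0"
    by (rule Lim_null_comparison[rotated]) (use b in auto)
  then show ?thesis using False by (simp add: p)
qed

section \<open>Bilinear Fourier coefficients of a localized eigenfunction\<close>

locale localized_solution =
  fixes lam \<alpha> \<theta> E :: real and \<psi> :: "int \<Rightarrow> real"
  assumes lam: "lam > 0"
    and eq: "\<And>m. \<psi> (m + 1) + \<psi> (m - 1) + pot lam \<alpha> \<theta> m * \<psi> m = E * \<psi> m"
    and l2: "(\<lambda>m. (\<psi> m)\<^sup>2) summable_on UNIV"
    and nonzero: "\<exists>m. \<psi> m \<noteq> 0"
    and irrational: "\<And>k::int. k \<noteq> 0 \<Longrightarrow> of_int k * \<alpha> \<notin> \<int>"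
    and nonresonant: "\<And>k::int. 2 * \<theta> + of_int k * \<alpha> \<notin> \<int>"
begin

text \<open>Let f(x) be the Fourier series with coefficients \<psi>, and U_n(x) = cis (2 pi n
  \<theta>) f(x + n \<alpha>), which formally solves the dual equation. The sum over m is the k-th
  Fourier coefficient of U_n times the conjugate of U_0, and it makes sense for square summable
  \<psi>.\<close>

definition corr_term :: "int \<Rightarrow> int \<Rightarrow> int \<Rightarrow> complex" where
  "corr_term n k m = of_real (\<psi> m * \<psi> (m - k)) * cis (2 * pi * (of_int n * (\<theta> + of_int m * \<alpha>)))"

definition corr :: "int \<Rightarrow> int \<Rightarrow> complex" where "corr n k = (\<Sum>\<^sub>\<infinity>m. corr_term n k m)"

text \<open>Coefficients of U_n cnj U_0 - U_0 cnj U_n, the combination of the two dual solutions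
  that vanishes at site 0; at site 1 it is their Wronskian.\<close>

definition dual_coeff :: "int \<Rightarrow> int \<Rightarrow> complex" where "dual_coeff n k = corr n k - cnj (corr n (- k))"

definition mass :: real where "mass = (\<Sum>\<^sub>\<infinity>m. (\<psi> m)\<^sup>2)"

lemma mass_has_sum: "((\<lambda>m. (\<psi> m)\<^sup>2) has_sum mass) UNIV"
  unfolding mass_def using l2 by (rule has_sum_infsum)

lemma majorant_has_sum: "((\<lambda>m. ((\<psi> m)\<^sup>2 + (\<psi> (m - k))\<^sup>2) / 2) has_sum mass) UNIV"
proof -
  have "((\<lambda>m. (\<psi> (m - k))\<^sup>2) has_sum mass) UNIV"
    using has_sum_int_shift[of "\<lambda>m. (\<psi> m)\<^sup>2" "- k"] mass_has_sum by simp
  then have "((\<lambda>m. ((\<psi> m)\<^sup>2 + (\<psi> (m - k))\<^sup>2) * (1/2)) has_sum ((mass + mass) * (1/2))) UNIV"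
    by (intro has_sum_cmult_left has_sum_add mass_has_sum)
  then show ?thesis by simp
qed

lemma norm_corr_term: "cmod (corr_term n k m) \<le> ((\<psi> m)\<^sup>2 + (\<psi> (m - k))\<^sup>2) / 2"
proof -
  have "cmod (corr_term n k m) = \<bar>\<psi> m\<bar> * \<bar>\<psi> (m - k)\<bar>" by (simp add: corr_term_def norm_mult abs_mult)
  then show ?thesis using sum_squares_bound[of "\<bar>\<psi> m\<bar>" "\<bar>\<psi> (m - k)\<bar>"] by simp
qed

lemma corr_term_summable: "corr_term n k summable_on UNIV"
  by (rule abs_summable_summable,
    rule Infinite_Sum.abs_summable_on_comparison_test'[OF has_sum_imp_summable[OF majorant_has_sum[of k]]]) (rule norm_corr_term)

lemma corr_has_sum: "(corr_term n k has_sum corr n k) UNIV"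
  unfolding corr_def by (intro has_sum_infsum corr_term_summable)

lemma norm_corr: "cmod (corr n k) \<le> mass"
  using corr_has_sum majorant_has_sum norm_corr_term by (rule norm_has_sum_le)

lemma norm_dual_coeff: "cmod (dual_coeff n k) \<le> 2 * mass"
proof -
  have "cmod (dual_coeff n k) \<le> cmod (corr n k) + cmod (cnj (corr n (- k)))" unfolding dual_coeff_def by (rule norm_triangle_ineq4)
  then show ?thesis using norm_corr[of n k] norm_corr[of n "- k"] by simp
qed

lemma corr_rec:
  "of_real lam * (corr (n + 1) k + corr (n - 1) k) = of_real E * corr n k
     - cis (2 * pi * (of_int n * \<alpha>)) * corr n (k - 1) - cis (- (2 * pi * (of_int n * \<alpha>))) * corr n (k + 1)"
proof -
  let ?e = "cis (2 * pi * (of_int n * \<alpha>))" and ?f = "cis (- (2 * pi * (of_int n * \<alpha>)))"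
  have "((\<lambda>m. of_real lam * (corr_term (n + 1) k m + corr_term (n - 1) k m)) has_sum (of_real lam * (corr (n + 1) k + corr (n - 1) k))) UNIV"
    by (intro has_sum_cmult_right has_sum_add corr_has_sum)
  moreover have "((\<lambda>m. of_real E * corr_term n k m + (- ?e) * corr_term n (k - 1) (m + (-1)) + (- ?f) * corr_term n (k + 1) (m + 1))
      has_sum (of_real E * corr n k + (- ?e) * corr n (k - 1) + (- ?f) * corr n (k + 1))) UNIV"
    by (intro has_sum_cmult_right has_sum_add has_sum_int_shift[THEN iffD2] corr_has_sum)
  moreover have "of_real lam * (corr_term (n + 1) k m + corr_term (n - 1) k m) =
       of_real E * corr_term n k m + (- ?e) * corr_term n (k - 1) (m + (-1)) + (- ?f) * corr_term n (k + 1) (m + 1)" for m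
  proof -
    define t where "t = \<theta> + of_int m * \<alpha>"
    have e: "\<psi> (m + 1) + \<psi> (m - 1) + 2 * lam * cos (2 * pi * t) * \<psi> m = E * \<psi> m"
      using eq[of m] by (simp add: pot_def t_def)
    have c: "cis (2 * pi * (of_int (n + 1) * t)) + cis (2 * pi * (of_int (n - 1) * t))
        = 2 * of_real (cos (2 * pi * t)) * cis (2 * pi * (of_int n * t))"
      using cis_plus_minus[of "2 * pi * (of_int n * t)" "2 * pi * t"] by (simp add: algebra_simps)
    have "of_real lam * (corr_term (n + 1) k m + corr_term (n - 1) k m)
       = of_real (lam * \<psi> m * \<psi> (m - k)) * (cis (2 * pi * (of_int (n + 1) * t)) + cis (2 * pi * (of_int (n - 1) * t)))"
      by (simp add: corr_term_def t_def algebra_simps)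
    also have "\<dots> = of_real ((2 * lam * cos (2 * pi * t) * \<psi> m) * \<psi> (m - k)) * cis (2 * pi * (of_int n * t))"
      unfolding c by simp
    also have "2 * lam * cos (2 * pi * t) * \<psi> m = E * \<psi> m - \<psi> (m + 1) - \<psi> (m - 1)" using e by simp
    also have "of_real ((E * \<psi> m - \<psi> (m + 1) - \<psi> (m - 1)) * \<psi> (m - k)) * cis (2 * pi * (of_int n * t))
       = of_real E * corr_term n k m - of_real (\<psi> (m - 1) * \<psi> (m - k)) * cis (2 * pi * (of_int n * t))
           - of_real (\<psi> (m + 1) * \<psi> (m - k)) * cis (2 * pi * (of_int n * t))"
      by (simp add: corr_term_def t_def algebra_simps)
    \<comment> \<open>Moving m by one trades a neighbour of \<psi>(m) for a change of k, at the
      price of a phase. This produces the dual potential.\<close>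
    also have "of_real (\<psi> (m - 1) * \<psi> (m - k)) * cis (2 * pi * (of_int n * t)) = ?e * corr_term n (k - 1) (m + (-1))"
      by (simp add: corr_term_def t_def cis_mult algebra_simps)
    also have "of_real (\<psi> (m + 1) * \<psi> (m - k)) * cis (2 * pi * (of_int n * t)) = ?f * corr_term n (k + 1) (m + 1)"
      by (simp add: corr_term_def t_def cis_mult algebra_simps)
    finally show ?thesis by simp
  qed
  ultimately show ?thesis by (simp add: has_sum_unique)
qed

lemma dual_coeff_rec:
  "of_real lam * (dual_coeff (n + 1) k + dual_coeff (n - 1) k) = of_real E * dual_coeff n k
     - cis (2 * pi * (of_int n * \<alpha>)) * dual_coeff n (k - 1) - cis (- (2 * pi * (of_int n * \<alpha>))) * dual_coeff n (k + 1)"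
proof -
  have "cnj (of_real lam * (corr (n + 1) (- k) + corr (n - 1) (- k))) = cnj (of_real E * corr n (- k)
     - cis (2 * pi * (of_int n * \<alpha>)) * corr n (- k - 1) - cis (- (2 * pi * (of_int n * \<alpha>))) * corr n (- k + 1))"
    by (simp only: corr_rec)
  then have 2: "of_real lam * (cnj (corr (n + 1) (- k)) + cnj (corr (n - 1) (- k))) = of_real E * cnj (corr n (- k))
     - cis (- (2 * pi * (of_int n * \<alpha>))) * cnj (corr n (- (k + 1))) - cis (2 * pi * (of_int n * \<alpha>)) * cnj (corr n (- (k - 1)))"
    by (simp add: cis_cnj)
  show ?thesis using corr_rec[of n k] 2 unfolding dual_coeff_def by (simp add: algebra_simps)
qed

text \<open>Translating the summation index by k shows that conjugation amounts to n going to -n, up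
  to a phase. This makes the vanishing at site 0 visible.\<close>

lemma cnj_corr: "cnj (corr n (- k)) = cis (2 * pi * (of_int (n * k) * \<alpha>)) * corr (- n) k"
proof -
  have "((\<lambda>m. cnj (corr_term n (- k) m)) has_sum cnj (corr n (- k))) UNIV"
    using corr_has_sum by simp
  then have 1: "((\<lambda>m. cnj (corr_term n (- k) (m + (- k)))) has_sum cnj (corr n (- k))) UNIV"
    using has_sum_int_shift[of "\<lambda>m. cnj (corr_term n (- k) m)" "- k"] by blast
  have 2: "cnj (corr_term n (- k) (m + (- k))) = cis (2 * pi * (of_int (n * k) * \<alpha>)) * corr_term (- n) k m" for m
  proof -
    have "cis (- (2 * pi * (of_int n * (\<theta> + of_int (m + (- k)) * \<alpha>))))
       = cis (2 * pi * (of_int (n * k) * \<alpha>)) * cis (2 * pi * (of_int (- n) * (\<theta> + of_int m * \<alpha>)))"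
      unfolding cis_mult by (rule arg_cong[where f = cis]) (simp add: algebra_simps)
    then show ?thesis by (simp add: corr_term_def cis_cnj mult_ac)
  qed
  have 3: "((\<lambda>m. cis (2 * pi * (of_int (n * k) * \<alpha>)) * corr_term (- n) k m) has_sum
      (cis (2 * pi * (of_int (n * k) * \<alpha>)) * corr (- n) k)) UNIV"
    by (intro has_sum_cmult_right corr_has_sum)
  show ?thesis by (rule has_sum_unique[OF 1[unfolded 2] 3])
qed

lemma dual_coeff_alt: "dual_coeff n k = corr n k - cis (2 * pi * (of_int (n * k) * \<alpha>)) * corr (- n) k"
  unfolding dual_coeff_def cnj_corr ..

lemma dual_coeff_0: "dual_coeff 0 k = 0"
  unfolding dual_coeff_alt by simp

text \<open>The Wronskian is constant in x: the values at sites 1 and -1 are opposite by the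
  recursion at 0, and related by a translation by \<alpha> through \<open>dual_coeff_alt\<close>.
  Hence it is invariant under an irrational rotation, and only the coefficient at 0
  survives.\<close>

lemma dual_coeff_1: assumes "k \<noteq> 0" shows "dual_coeff 1 k = 0"
proof -
  have "dual_coeff 1 k + dual_coeff (- 1) k = 0" using dual_coeff_rec[of 0 k] lam by (simp add: dual_coeff_0)
  moreover have "dual_coeff (- 1) k = - cis (- (2 * pi * (of_int k * \<alpha>))) * dual_coeff 1 k"
    by (simp add: dual_coeff_alt cis_mult algebra_simps)
  ultimately have "dual_coeff 1 k * (1 - cis (- (2 * pi * (of_int k * \<alpha>)))) = 0" by (simp add: algebra_simps)
  moreover have "cis (- (2 * pi * (of_int k * \<alpha>))) \<noteq> 1"
    using irrational[of "- k"] assms cis_2pi_eq_1_iff[of "of_int (- k) * \<alpha>"] by simp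
  ultimately show ?thesis by simp
qed

lemma dual_coeff_Suc_Suc:
  "dual_coeff (n + 2) k = (of_real E * dual_coeff (n + 1) k - cis (2 * pi * (of_int (n + 1) * \<alpha>)) * dual_coeff (n + 1) (k - 1)
     - cis (- (2 * pi * (of_int (n + 1) * \<alpha>))) * dual_coeff (n + 1) (k + 1)) / of_real lam - dual_coeff n k"
  using dual_coeff_rec[of "n + 1" k] lam by (simp add: field_simps)

text \<open>The data at sites 0 and 1 live at k = 0 and each step widens the support by one, so the
  solution at site n is a trigonometric polynomial.\<close>

lemma dual_coeff_support: "\<bar>k\<bar> \<ge> int n \<Longrightarrow> k \<noteq> 0 \<or> n = 0 \<Longrightarrow> dual_coeff (int n) k = 0"
proof (induction n arbitrary: k rule: induct_nat_012)
  case 0 show ?case by (simp add: dual_coeff_0)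
next
  case 1 then show ?case by (simp add: dual_coeff_1)
next
  case (ge2 n)
  have "dual_coeff (int n) k = 0" "dual_coeff (int n + 1) k = 0" "dual_coeff (int n + 1) (k - 1) = 0" "dual_coeff (int n + 1) (k + 1) = 0"
    using ge2(1)[of k] ge2(2)[of k] ge2(2)[of "k - 1"] ge2(2)[of "k + 1"] ge2(3,4)
    by (auto simp: add.commute)
  then show ?case using dual_coeff_Suc_Suc[of "int n" k] by (simp add: add.commute)
qed

lemma dual_coeff_vanish:
  assumes "dual_coeff 1 0 = 0" shows "dual_coeff (int n) k = 0"
proof (induction n arbitrary: k rule: induct_nat_012)
  case 1 show ?case using assms dual_coeff_1 by (cases "k = 0") auto
next
  case (ge2 n)
  have "dual_coeff (int n) k = 0" "\<And>k. dual_coeff (int n + 1) k = 0"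
    using ge2 by (auto simp: add.commute)
  then show ?case using dual_coeff_Suc_Suc[of "int n" k] by (simp add: add.commute)
qed (simp add: dual_coeff_0)

text \<open>If the Wronskian vanished, the atomic measure with mass \<open>\<psi>(m)\<^sup>2\<close> at \<open>\<theta> + m\<alpha>\<close> would be symmetric
  under reflection, which forces a resonance \<open>2\<theta> \<in> \<alpha>\<int> + \<int>\<close>.\<close>

lemma wronskian_nonzero: "dual_coeff 1 0 \<noteq> 0"
proof
  assume W: "dual_coeff 1 0 = 0"
  obtain m0 where m0: "\<psi> m0 \<noteq> 0" using nonzero by blast
  define t where "t m = \<theta> + of_int m * \<alpha>" for m
  \<comment> \<open>A quarter, because the mass outside F enters twice: the sum over F stays below
    half of the squared value at \<open>m0\<close>, while its limit is all of it.\<close>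
  define \<epsilon> where "\<epsilon> = (\<psi> m0)\<^sup>2 / 4"
  have \<epsilon>: "\<epsilon> > 0" using m0 by (simp add: \<epsilon>_def)
  define a where "a N x = (\<Sum>n<N. cis (2 * pi * (real n * x))) / of_nat N" for N x
  have a1: "cmod (a N x) \<le> 1" for N x
  proof -
    have "cmod (\<Sum>n<N. cis (2 * pi * (real n * x))) \<le> real (card {..<N}) * 1"
      by (rule sum_norm_bound) simp
    then show ?thesis by (cases "N = 0") (auto simp: a_def norm_divide divide_le_eq)
  qed
  \<comment> \<open>The measure minus its reflection, tested against averaged characters centred at
    the atom \<open>t m0\<close>.\<close>
  define g where "g N m = of_real ((\<psi> m)\<^sup>2) * (a N (t m - t m0) - a N (- t m - t m0))" for N m
  have g0: "(g N has_sum 0) UNIV" for N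
  proof -
    have 1: "((\<lambda>m. corr_term (int n) 0 m - cnj (corr_term (int n) 0 m)) has_sum 0) UNIV" for n
    proof -
      have "((\<lambda>m. corr_term (int n) 0 m - cnj (corr_term (int n) 0 m)) has_sum (corr (int n) 0 - cnj (corr (int n) 0))) UNIV"
        by (intro has_sum_diff corr_has_sum) (simp add: corr_has_sum)
      moreover have "corr (int n) 0 - cnj (corr (int n) 0) = 0"
        using dual_coeff_vanish[OF W, of n 0] by (simp add: dual_coeff_def)
      ultimately show ?thesis by simp
    qed
    have "((\<lambda>m. \<Sum>n<N. cis (- (2 * pi * (real n * t m0))) * (corr_term (int n) 0 m - cnj (corr_term (int n) 0 m)))
        has_sum (\<Sum>n<N. cis (- (2 * pi * (real n * t m0))) * 0)) UNIV"
      by (intro has_sum_sum has_sum_cmult_right 1 finite_lessThan)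
    then have "((\<lambda>m. (\<Sum>n<N. cis (- (2 * pi * (real n * t m0))) * (corr_term (int n) 0 m - cnj (corr_term (int n) 0 m))) * (1 / of_nat N))
        has_sum ((\<Sum>n<N. cis (- (2 * pi * (real n * t m0))) * 0) * (1 / of_nat N))) UNIV"
      by (rule has_sum_cmult_left)
    moreover have "(\<Sum>n<N. cis (- (2 * pi * (real n * t m0))) * (corr_term (int n) 0 m - cnj (corr_term (int n) 0 m))) * (1 / of_nat N) = g N m" for m
    proof -
      have "cis (- (2 * pi * (real n * t m0))) * (corr_term (int n) 0 m - cnj (corr_term (int n) 0 m))
         = of_real ((\<psi> m)\<^sup>2) * (cis (2 * pi * (real n * (t m - t m0))) - cis (2 * pi * (real n * (- t m - t m0))))" for n
      proof -
        let ?b = "2 * pi * (real n * t m)" and ?a = "- (2 * pi * (real n * t m0))"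
        have corr_term: "corr_term (int n) 0 m = of_real ((\<psi> m)\<^sup>2) * cis ?b"
          by (simp add: corr_term_def t_def power2_eq_square)
        have 1: "cis ?a * cis ?b = cis (2 * pi * (real n * (t m - t m0)))"
          unfolding cis_mult by (rule arg_cong[where f = cis]) (simp add: algebra_simps)
        have 2: "cis ?a * cis (- ?b) = cis (2 * pi * (real n * (- t m - t m0)))"
          unfolding cis_mult by (rule arg_cong[where f = cis]) (simp add: algebra_simps)
        have "cis ?a * (corr_term (int n) 0 m - cnj (corr_term (int n) 0 m)) = of_real ((\<psi> m)\<^sup>2) * (cis ?a * cis ?b - cis ?a * cis (- ?b))"
          unfolding corr_term complex_cnj_mult complex_cnj_complex_of_real cis_cnj by (simp only: right_diff_distrib mult_ac)
        then show ?thesis unfolding 1 2 .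
      qed
      then show ?thesis
        by (simp add: g_def a_def sum_distrib_left[symmetric] sum_subtractf[symmetric] diff_divide_distrib[symmetric])
    qed
    ultimately show ?thesis by simp
  qed
  \<comment> \<open>The limit in N is taken term by term, hence on a finite set of atoms; the mass
    left outside is controlled uniformly in N.\<close>
  obtain F where F: "finite F" "m0 \<in> F" "\<bar>mass - (\<Sum>m\<in>F. (\<psi> m)\<^sup>2)\<bar> < \<epsilon>"
  proof -
    have "((sum (\<lambda>m. (\<psi> m)\<^sup>2)) \<longlongrightarrow> mass) (finite_subsets_at_top UNIV)"
      using mass_has_sum by (simp add: has_sum_def)
    then have "\<forall>\<^sub>F F in finite_subsets_at_top UNIV. dist (\<Sum>m\<in>F. (\<psi> m)\<^sup>2) mass < \<epsilon>"
      using \<epsilon> by (rule tendstoD)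
    then obtain F0 where F0: "finite F0" "\<And>F. finite F \<Longrightarrow> F0 \<subseteq> F \<Longrightarrow> dist (\<Sum>m\<in>F. (\<psi> m)\<^sup>2) mass < \<epsilon>"
      unfolding eventually_finite_subsets_at_top by auto
    show ?thesis using that[of "insert m0 F0"] F0(1) F0(2)[of "insert m0 F0"] by (auto simp: dist_real_def abs_minus_commute)
  qed
  have tail: "cmod (\<Sum>m\<in>F. g N m) \<le> 2 * \<epsilon>" for N
  proof -
    have s: "((\<lambda>m. 2 * (\<psi> m)\<^sup>2) has_sum (2 * (mass - (\<Sum>m\<in>F. (\<psi> m)\<^sup>2)))) (UNIV - F)"
      using mass_has_sum F(1) by (intro has_sum_cmult_right has_sum_Diff) auto
    have b: "cmod (g N m) \<le> 2 * (\<psi> m)\<^sup>2" for m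
    proof -
      have "cmod (a N (t m - t m0) - a N (- t m - t m0)) \<le> 2"
        using norm_triangle_ineq4[of "a N (t m - t m0)" "a N (- t m - t m0)"] a1[of N "t m - t m0"] a1[of N "- t m - t m0"] by linarith
      then have "(\<psi> m)\<^sup>2 * cmod (a N (t m - t m0) - a N (- t m - t m0)) \<le> (\<psi> m)\<^sup>2 * 2"
        by (intro mult_left_mono) auto
      then show ?thesis by (simp add: g_def norm_mult norm_power)
    qed
    have "(g N has_sum (0 - (\<Sum>m\<in>F. g N m))) (UNIV - F)"
      using g0 F(1) by (intro has_sum_Diff) auto
    then have "cmod (0 - (\<Sum>m\<in>F. g N m)) \<le> 2 * (mass - (\<Sum>m\<in>F. (\<psi> m)\<^sup>2))"
      using s b by (rule norm_has_sum_le)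
    then show ?thesis using F(3) by simp
  qed
  have "(\<lambda>N. g N m) \<longlonglongrightarrow> (if m = m0 then of_real ((\<psi> m0)\<^sup>2) else 0)" for m
  proof -
    \<comment> \<open>Nonresonance keeps every reflected atom away from \<open>t m0\<close> modulo
      1, so the reflected part averages out.\<close>
    have e: "- t m - t m0 \<notin> \<int>"
      using nonresonant[of "m + m0"] Ints_minus[of "- t m - t m0"] by (auto simp: t_def algebra_simps)
    have "t m - t m0 \<in> \<int> \<longleftrightarrow> m = m0"
      using irrational[of "m - m0"] by (auto simp: t_def algebra_simps)
    then have "(\<lambda>N. g N m) \<longlonglongrightarrow> of_real ((\<psi> m)\<^sup>2) * ((if m = m0 then 1 else 0) - 0)"
      unfolding g_def using cesaro_cis[of "t m - t m0"] cesaro_cis[of "- t m - t m0"] e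
      by (intro tendsto_intros) (auto simp: a_def)
    then show ?thesis by (cases "m = m0") auto
  qed
  then have "(\<lambda>N. \<Sum>m\<in>F. g N m) \<longlonglongrightarrow> (\<Sum>m\<in>F. if m = m0 then of_real ((\<psi> m0)\<^sup>2) else 0)"
    by (intro tendsto_sum)
  then have "(\<lambda>N. \<Sum>m\<in>F. g N m) \<longlonglongrightarrow> of_real ((\<psi> m0)\<^sup>2)" using F by simp
  then have "(\<lambda>N. cmod (\<Sum>m\<in>F. g N m)) \<longlonglongrightarrow> cmod (of_real ((\<psi> m0)\<^sup>2))" by (rule tendsto_norm)
  then have "cmod (of_real ((\<psi> m0)\<^sup>2)) \<le> 2 * \<epsilon>"
    using tail by (intro tendsto_upperbound[of _ _ sequentially]) auto
  then show False using m0 by (simp add: \<epsilon>_def norm_power)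
qed

text \<open>The function \<open>x \<mapsto> \<Sum> \<psi>(m) cis (2\<pi>mx)\<close> and its complex conjugate give two solutions of the dual
  equation at \<open>x\<close>; \<open>dual_coeff n\<close> lists the Fourier coefficients of the solution with Cauchy data \<open>(0, dual_coeff 1 0)\<close>.\<close>

lemma dual_solution:
  "((\<lambda>k. dual_coeff (int n) k * cis (2 * pi * (of_int k * x))) has_sum
     (dual_coeff 1 0 * (case n of 0 \<Rightarrow> 0 | Suc m \<Rightarrow> box_det lam 1 \<alpha> (x + \<alpha>) (of_real E) m / of_real (lam ^ m)))) UNIV"
proof (induction n rule: induct_nat_012)
  case 0 show ?case by (simp add: dual_coeff_0)
next
  case 1
  have "((\<lambda>k. dual_coeff 1 k * cis (2 * pi * (of_int k * x))) has_sum (dual_coeff 1 0)) UNIV"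
    by (rule has_sum_finite_neutralI[of "{0}"]) (auto simp: dual_coeff_1)
  then show ?case by simp
next
  case (ge2 n)
  let ?c = "\<lambda>k. cis (2 * pi * (of_int k * x))"
  let ?e = "cis (2 * pi * (of_int (int n + 1) * \<alpha>))" and ?f = "cis (- (2 * pi * (of_int (int n + 1) * \<alpha>)))"
  let ?u = "cis (2 * pi * x)" and ?v = "cis (- (2 * pi * x))"
  \<comment> \<open>The box on sites 1 to m, hence the phase \<open>x + \<alpha>\<close>, gives the
    solution at site \<open>Suc m\<close>. Each step of the dual recursion divides by the hopping,
    hence \<open>lam ^ m\<close>.\<close>
  define s where "s n = dual_coeff 1 0 * (case n of 0 \<Rightarrow> 0 | Suc m \<Rightarrow> box_det lam 1 \<alpha> (x + \<alpha>) (of_real E) m / of_real (lam ^ m))" for n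
  have h0: "((\<lambda>k. dual_coeff (int n) k * ?c k) has_sum s n) UNIV" using ge2(1) by (simp add: s_def)
  have h1: "((\<lambda>k. dual_coeff (int n + 1) k * ?c k) has_sum s (Suc n)) UNIV" using ge2(2) by (simp add: s_def add.commute)
  have "((\<lambda>k. (of_real E / of_real lam) * (dual_coeff (int n + 1) k * ?c k)
        + (- (?e * ?u) / of_real lam) * (dual_coeff (int n + 1) (k + (-1)) * ?c (k + (-1)))
        + (- (?f * ?v) / of_real lam) * (dual_coeff (int n + 1) (k + 1) * ?c (k + 1)) - dual_coeff (int n) k * ?c k)
      has_sum ((of_real E / of_real lam) * s (Suc n) + (- (?e * ?u) / of_real lam) * s (Suc n)
        + (- (?f * ?v) / of_real lam) * s (Suc n) - s n)) UNIV"
    by (intro has_sum_diff has_sum_add has_sum_cmult_right h0 h1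
         has_sum_int_shift[where f = "\<lambda>k. dual_coeff (int n + 1) k * ?c k", THEN iffD2])
  moreover have "(of_real E / of_real lam) * (dual_coeff (int n + 1) k * ?c k)
        + (- (?e * ?u) / of_real lam) * (dual_coeff (int n + 1) (k + (-1)) * ?c (k + (-1)))
        + (- (?f * ?v) / of_real lam) * (dual_coeff (int n + 1) (k + 1) * ?c (k + 1)) - dual_coeff (int n) k * ?c k
     = dual_coeff (int (Suc (Suc n))) k * ?c k" for k
  proof -
    have u: "?u * ?c (k + (-1)) = ?c k" and v: "?v * ?c (k + 1) = ?c k"
      by (simp_all add: cis_mult algebra_simps)
    have "(of_real E / of_real lam) * (dual_coeff (int n + 1) k * ?c k)
        + (- (?e * ?u) / of_real lam) * (dual_coeff (int n + 1) (k + (-1)) * ?c (k + (-1)))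
        + (- (?f * ?v) / of_real lam) * (dual_coeff (int n + 1) (k + 1) * ?c (k + 1)) - dual_coeff (int n) k * ?c k
      = (of_real E * dual_coeff (int n + 1) k * ?c k - ?e * dual_coeff (int n + 1) (k - 1) * (?u * ?c (k + (-1)))
        - ?f * dual_coeff (int n + 1) (k + 1) * (?v * ?c (k + 1))) / of_real lam - dual_coeff (int n) k * ?c k"
      by (simp add: divide_inverse algebra_simps)
    also have "\<dots> = dual_coeff (int n + 2) k * ?c k"
      unfolding u v dual_coeff_Suc_Suc by (simp add: divide_inverse algebra_simps)
    also have "int n + 2 = int (Suc (Suc n))" by simp
    finally show ?thesis .
  qed
  moreover have "(of_real E / of_real lam) * s (Suc n) + (- (?e * ?u) / of_real lam) * s (Suc n)
        + (- (?f * ?v) / of_real lam) * s (Suc n) - s n = s (Suc (Suc n))"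
  proof -
    have p: "of_real (pot 1 \<alpha> (x + \<alpha>) (int n)) = ?e * ?u + ?f * ?v"
    proof -
      have 1: "?e * ?u = cis (2 * pi * (x + of_int (int n + 1) * \<alpha>))"
        unfolding cis_mult by (rule arg_cong[where f = cis]) (simp add: algebra_simps)
      have 2: "?f * ?v = cis (- (2 * pi * (x + of_int (int n + 1) * \<alpha>)))"
        unfolding cis_mult by (rule arg_cong[where f = cis]) (simp add: algebra_simps)
      have 3: "pot 1 \<alpha> (x + \<alpha>) (int n) = 2 * cos (2 * pi * (x + of_int (int n + 1) * \<alpha>))"
        unfolding pot_def by (simp add: algebra_simps)
      show ?thesis unfolding 1 2 3 by (simp add: complex_eq_iff)
    qed
    have "(of_real E / of_real lam) * s (Suc n) + (- (?e * ?u) / of_real lam) * s (Suc n)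
        + (- (?f * ?v) / of_real lam) * s (Suc n) - s n
      = (of_real E - of_real (pot 1 \<alpha> (x + \<alpha>) (int n))) / of_real lam * s (Suc n) - s n"
      unfolding p by (simp add: divide_inverse algebra_simps)
    also have "\<dots> = s (Suc (Suc n))"
    proof (cases n)
      case 0 then show ?thesis using lam by (simp add: s_def)
    next
      case (Suc m)
      show ?thesis using lam unfolding Suc s_def
        by (simp add: field_simps power2_eq_square del: of_nat_Suc)
    qed
    finally show ?thesis .
  qed
  ultimately show ?case by (simp only: s_def)
qed

text \<open>At most 2n + 1 Fourier coefficients are present, each of modulus at most
  \<open>2 * mass\<close>, and the Wronskian is divided out. The constant depends on \<psi> but not
  on the phase.\<close>

lemma dual_box_det_bound:
  "\<exists>C. \<forall>x n. cmod (box_det lam 1 \<alpha> x (of_real E) n) \<le> C * real (Suc n) * lam ^ n"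
proof (intro exI allI)
  fix x :: real and n :: nat
  let ?d = "box_det lam 1 \<alpha> x (of_real E) n"
  let ?y = "x - \<alpha>"
  have mass: "mass \<ge> 0" unfolding mass_def by (rule infsum_nonneg) simp
  have "((\<lambda>k. dual_coeff (int (Suc n)) k * cis (2 * pi * (of_int k * ?y))) has_sum (dual_coeff 1 0 * (?d / of_real (lam ^ n)))) UNIV"
    using dual_solution[of "Suc n" ?y] by simp
  moreover have "((\<lambda>k. dual_coeff (int (Suc n)) k * cis (2 * pi * (of_int k * ?y))) has_sum
       (\<Sum>k\<in>{-int n..int n}. dual_coeff (int (Suc n)) k * cis (2 * pi * (of_int k * ?y)))) UNIV"
  proof (rule has_sum_finite_neutralI)
    fix k assume "k \<in> UNIV - {-int n..int n}"
    then show "dual_coeff (int (Suc n)) k * cis (2 * pi * (of_int k * ?y)) = 0"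
      using dual_coeff_support[of "Suc n" k] by auto
  qed auto
  ultimately have "dual_coeff 1 0 * (?d / of_real (lam ^ n)) = (\<Sum>k\<in>{-int n..int n}. dual_coeff (int (Suc n)) k * cis (2 * pi * (of_int k * ?y)))"
    by (rule has_sum_unique)
  then have "cmod (dual_coeff 1 0 * (?d / of_real (lam ^ n))) \<le> of_nat (card {-int n..int n}) * (2 * mass)"
    by (simp only:) (rule sum_norm_bound, simp only: norm_mult norm_cis mult_1_right norm_dual_coeff)
  also have "\<dots> \<le> (2 * real (Suc n)) * (2 * mass)" using mass by (intro mult_right_mono) auto
  also have "\<dots> = 4 * mass * real (Suc n)" by simp
  finally have "cmod (dual_coeff 1 0) * cmod ?d / lam ^ n \<le> 4 * mass * real (Suc n)"
    using lam by (simp add: norm_mult norm_divide norm_power del: of_nat_Suc)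
  then show "cmod ?d \<le> (4 * mass / cmod (dual_coeff 1 0)) * real (Suc n) * lam ^ n"
    using lam wronskian_nonzero by (simp add: field_simps)
qed

end

section \<open>Perturbation of the energy\<close>

text \<open>Discrete variation of constants: expand in the diagonal perturbation w according to the
  last site j that carries it. Sites before j keep the perturbed energy, sites after j the original
  one.\<close>

lemma box_det_duhamel:
  "box_det \<mu> \<nu> \<alpha> \<theta> (z + w) n = box_det \<mu> \<nu> \<alpha> \<theta> z n
     + w * (\<Sum>j<n. box_det \<mu> \<nu> \<alpha> (\<theta> + of_int (int (Suc j)) * \<alpha>) z (n - Suc j) * box_det \<mu> \<nu> \<alpha> \<theta> (z + w) j)"
proof (induction n rule: induct_nat_012)
  case (ge2 n)
  let ?D = "\<lambda>j. box_det \<mu> \<nu> \<alpha> (\<theta> + of_int (int (Suc j)) * \<alpha>) z"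
  let ?W = "box_det \<mu> \<nu> \<alpha> \<theta> (z + w)"
  let ?v = "z - of_real (pot \<nu> \<alpha> \<theta> (int (Suc n)))"
  let ?m = "(of_real \<mu> :: complex)\<^sup>2"
  define S1 where "S1 = (\<Sum>j<n. ?D j (n - Suc j) * ?W j)"
  define S2 where "S2 = (\<Sum>j<n. ?D j (Suc n - Suc j) * ?W j)"
  have rec: "?D j (Suc (Suc n) - Suc j) = ?v * ?D j (Suc n - Suc j) - ?m * ?D j (n - Suc j)" if "j < n" for j
  proof -
    from less_imp_Suc_add[OF that] obtain d where d: "n = Suc (j + d)" by auto
    have "pot \<nu> \<alpha> (\<theta> + of_int (int (Suc j)) * \<alpha>) (int (Suc d)) = pot \<nu> \<alpha> \<theta> (int (Suc n))"
      unfolding pot_shift d by simp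
    then show ?thesis unfolding d by (simp del: of_nat_Suc)
  qed
  have "(\<Sum>j<n. ?D j (Suc (Suc n) - Suc j) * ?W j) = (\<Sum>j<n. ?v * (?D j (Suc n - Suc j) * ?W j) - ?m * (?D j (n - Suc j) * ?W j))"
    by (intro sum.cong refl) (simp only: rec lessThan_iff left_diff_distrib mult.assoc)
  also have "\<dots> = ?v * S2 - ?m * S1"
    by (simp add: sum_subtractf sum_distrib_left S1_def S2_def)
  finally have main: "(\<Sum>j<n. ?D j (Suc (Suc n) - Suc j) * ?W j) = ?v * S2 - ?m * S1" .
  have D1: "?D n (Suc 0) = ?v"
    by (simp add: pot_shift del: of_nat_Suc of_int_of_nat_eq)
  have full: "(\<Sum>j<Suc (Suc n). ?D j (Suc (Suc n) - Suc j) * ?W j) = ?v * S2 - ?m * S1 + ?v * ?W n + ?W (Suc n)"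
    using main D1 by (simp add: Suc_diff_le del: of_nat_Suc of_int_of_nat_eq)
  have I1: "?W n = box_det \<mu> \<nu> \<alpha> \<theta> z n + w * S1" using ge2(1) by (simp add: S1_def del: of_nat_Suc)
  have I2: "?W (Suc n) = box_det \<mu> \<nu> \<alpha> \<theta> z (Suc n) + w * (S2 + ?W n)"
    using ge2(2) by (simp add: S2_def del: of_nat_Suc box_det.simps(3) of_int_of_nat_eq)
  have "?W (Suc (Suc n)) = ?v * ?W (Suc n) + w * ?W (Suc n) - ?m * ?W n"
    by (simp add: algebra_simps del: of_nat_Suc)
  also have "\<dots> = ?v * (box_det \<mu> \<nu> \<alpha> \<theta> z (Suc n) + w * (S2 + ?W n)) + w * ?W (Suc n)
       - ?m * (box_det \<mu> \<nu> \<alpha> \<theta> z n + w * S1)"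
    by (subst I2[symmetric], subst I1[symmetric]) (rule refl)
  also have "\<dots> = box_det \<mu> \<nu> \<alpha> \<theta> z (Suc (Suc n)) + w * (?v * S2 - ?m * S1 + ?v * ?W n + ?W (Suc n))"
    by (simp add: algebra_simps del: of_nat_Suc)
  finally show ?case unfolding full .
qed simp_all

text \<open>The constant is the sum of m / q^m over all m > 0, obtained by dividing the left side by
  q^n.\<close>

lemma sum_linear_geometric_le:
  fixes q :: real
  assumes "q > 1"
  shows "(\<Sum>j<n. real (n - j) * q ^ j) \<le> q / (q - 1)\<^sup>2 * q ^ n"
proof (induction n)
  case 0 then show ?case using assms by simp
next
  case (Suc n)
  have "(\<Sum>j<Suc n. real (Suc n - j) * q ^ j) = (\<Sum>j<n. real (n - j) * q ^ j) + (\<Sum>j<Suc n. q ^ j)"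
    by (simp add: sum.distrib[symmetric] Suc_diff_le algebra_simps)
  also have "(\<Sum>j<Suc n. q ^ j) = (q ^ Suc n - 1) / (q - 1)"
    using assms by (intro geometric_sum) simp
  also have "\<dots> \<le> q ^ Suc n / (q - 1)" using assms by (intro divide_right_mono) auto
  finally have "(\<Sum>j<Suc n. real (Suc n - j) * q ^ j) \<le> q / (q - 1)\<^sup>2 * q ^ n + q ^ Suc n / (q - 1)"
    using Suc by linarith
  also have "\<dots> = q / (q - 1)\<^sup>2 * q ^ Suc n"
  proof -
    define c where "c = q / (q - 1)\<^sup>2"
    have e: "q ^ Suc n / (q - 1) = c * ((q - 1) * q ^ n)"
      using assms by (simp add: power2_eq_square c_def)
    have "c * q ^ n + c * ((q - 1) * q ^ n) = c * q ^ Suc n" by (simp add: algebra_simps)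
    then show ?thesis using e by (simp add: c_def)
  qed
  finally show ?case .
qed

text \<open>Strong induction through the Duhamel formula: the unperturbed determinant and the
  Duhamel sum each account for half of the bound.\<close>

lemma box_det_growth_perturb:
  assumes bound: "\<And>\<theta> n. cmod (box_det \<mu> \<nu> \<alpha> \<theta> z n) \<le> C * real (Suc n) * L ^ n"
    and L: "L > 0" and \<kappa>: "\<kappa> > 0"
  obtains \<eta> B :: real where "\<eta> > 0" "B > 0"
    "\<And>\<theta> n. cmod (box_det \<mu> \<nu> \<alpha> \<theta> (z + \<i> * of_real \<eta>) n) \<le> B * (exp \<kappa> * L) ^ n"
proof -
  define q where "q = exp \<kappa>"
  have q: "q > 1" using \<kappa> by (simp add: q_def)
  have C: "C \<ge> 1" using bound[of 0 0] by simp
  define S where "S = q / (q - 1)\<^sup>2"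
  have S: "S > 0" using q by (simp add: S_def)
  \<comment> \<open>Makes \<eta> C S / L equal to 1/2, the share of the Duhamel sum.\<close>
  define \<eta> where "\<eta> = L / (2 * C * S)"
  have \<eta>: "\<eta> > 0" using L C S by (simp add: \<eta>_def)
  \<comment> \<open>By Bernoulli's inequality the linear factor \<open>Suc n\<close> is at most
    \<open>M * q ^ n\<close>.\<close>
  define M where "M = 1 + 1 / (q - 1)"
  define B where "B = 2 * C * M"
  have M: "M \<ge> 1" using q by (simp add: M_def)
  have B: "B > 0" using C M by (simp add: B_def)
  have Mq: "real (Suc n) \<le> M * q ^ n" for n
  proof -
    have "1 + real n * (q - 1) \<le> q ^ n" using Bernoulli_inequality[of "q - 1" n] q by simp
    then have "M * (1 + real n * (q - 1)) \<le> M * q ^ n" using M by (intro mult_left_mono) auto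
    moreover have "M * (1 + real n * (q - 1)) = 1 + real n + real n * (q - 1) + 1 / (q - 1)"
      using q by (simp add: M_def field_simps)
    moreover have "real n * (q - 1) + 1 / (q - 1) \<ge> 0" using q by simp
    ultimately show ?thesis by simp
  qed
  have "cmod (box_det \<mu> \<nu> \<alpha> \<theta> (z + \<i> * of_real \<eta>) n) \<le> B * (q * L) ^ n" for \<theta> n
  proof (induction n rule: less_induct)
    case (less n)
    let ?w = "\<i> * complex_of_real \<eta>"
    let ?D = "\<lambda>j. box_det \<mu> \<nu> \<alpha> (\<theta> + of_int (int (Suc j)) * \<alpha>) z (n - Suc j)"
    let ?W = "box_det \<mu> \<nu> \<alpha> \<theta> (z + ?w)"
    have t: "cmod (?D j * ?W j) \<le> C * B / L * L ^ n * (real (n - j) * q ^ j)" if j: "j < n" for j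
    proof -
      have e1: "Suc (n - Suc j) = n - j" using j by simp
      have e2: "L ^ (n - Suc j) * L ^ j = L ^ n / L"
      proof -
        have "n = Suc (n - Suc j + j)" using j by simp
        then have "L ^ n = L * (L ^ (n - Suc j) * L ^ j)" by (metis power_Suc power_add)
        then show ?thesis using L by simp
      qed
      have "cmod (?D j * ?W j) \<le> (C * real (Suc (n - Suc j)) * L ^ (n - Suc j)) * (B * (q * L) ^ j)"
        unfolding norm_mult using bound less[OF j] C L by (intro mult_mono) auto
      then have "cmod (?D j * ?W j) \<le> (C * real (n - j) * L ^ (n - Suc j)) * (B * (q * L) ^ j)"
        unfolding e1 .
      also have "(C * real (n - j) * L ^ (n - Suc j)) * (B * (q * L) ^ j) = C * B * (real (n - j) * q ^ j) * (L ^ (n - Suc j) * L ^ j)"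
        by (simp add: power_mult_distrib mult_ac)
      also have "\<dots> = C * B / L * L ^ n * (real (n - j) * q ^ j)"
        unfolding e2 by simp
      finally show ?thesis .
    qed
    have "cmod (\<Sum>j<n. ?D j * ?W j) \<le> (\<Sum>j<n. C * B / L * L ^ n * (real (n - j) * q ^ j))"
      using t by (intro sum_norm_le) auto
    also have "\<dots> = C * B / L * L ^ n * (\<Sum>j<n. real (n - j) * q ^ j)"
      by (simp add: sum_distrib_left)
    also have "\<dots> \<le> C * B / L * L ^ n * (S * q ^ n)"
      using sum_linear_geometric_le[OF q] C B L unfolding S_def by (intro mult_left_mono) auto
    finally have "\<eta> * cmod (\<Sum>j<n. ?D j * ?W j) \<le> \<eta> * (C * B / L * L ^ n * (S * q ^ n))"
      using \<eta> by (intro mult_left_mono) auto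
    also have "\<dots> = B / 2 * (q * L) ^ n"
      using L C S by (simp add: \<eta>_def power_mult_distrib)
    finally have 1: "cmod (?w * (\<Sum>j<n. ?D j * ?W j)) \<le> B / 2 * (q * L) ^ n"
      using \<eta> by (simp add: norm_mult)
    have "cmod (box_det \<mu> \<nu> \<alpha> \<theta> z n) \<le> C * real (Suc n) * L ^ n" by (rule bound)
    also have "\<dots> \<le> C * (M * q ^ n) * L ^ n" using Mq[of n] C L by (intro mult_right_mono mult_left_mono) auto
    also have "\<dots> = B / 2 * (q * L) ^ n" by (simp add: B_def power_mult_distrib)
    finally have 2: "cmod (box_det \<mu> \<nu> \<alpha> \<theta> z n) \<le> B / 2 * (q * L) ^ n" .
    have "cmod (?W n) \<le> cmod (box_det \<mu> \<nu> \<alpha> \<theta> z n) + cmod (?w * (\<Sum>j<n. ?D j * ?W j))"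
      by (subst box_det_duhamel) (rule norm_triangle_ineq)
    then show ?case using 1 2 by linarith
  qed
  then show ?thesis using that[OF \<eta> B] by (simp add: q_def)
qed

section \<open>Orthonormal eigenbases and the resolvent\<close>

text \<open>The free weight \<epsilon> lets this stand in for the Cauchy-Schwarz inequality: an
  inner product is small as soon as one of the two vectors is small.\<close>

lemma cmod_mult_le_mean: "cmod (a * b) \<le> (\<epsilon> * (cmod a)\<^sup>2 + (cmod b)\<^sup>2 / \<epsilon>) / 2" if "\<epsilon> > 0"
proof -
  have "0 \<le> (sqrt \<epsilon> * cmod a - cmod b / sqrt \<epsilon>)\<^sup>2" by simp
  also have "\<dots> = \<epsilon> * (cmod a)\<^sup>2 + (cmod b)\<^sup>2 / \<epsilon> - 2 * cmod (a * b)"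
    using that by (simp add: power2_diff power_mult_distrib power_divide norm_mult)
  finally show ?thesis by simp
qed

lemma l2Z_inner_has_sum:
  assumes "l2Z u" "l2Z v"
  shows "((\<lambda>m. cnj (u m) * v m) has_sum l2_inner u v) UNIV"
  unfolding l2_inner_def
proof (rule has_sum_infsum, rule abs_summable_summable, rule Infinite_Sum.abs_summable_on_comparison_test')
  show "(\<lambda>m. (1/2) * (cmod (u m))\<^sup>2 + (1/2) * (cmod (v m))\<^sup>2) summable_on UNIV"
    using assms unfolding l2Z_def by (intro summable_on_add summable_on_cmult_right)
  show "norm (cnj (u m) * v m) \<le> (1/2) * (cmod (u m))\<^sup>2 + (1/2) * (cmod (v m))\<^sup>2" for m
    using cmod_mult_le_mean[of 1 "cnj (u m)" "v m"] by simp
qed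

lemma l2Z_norm_has_sum: "l2Z u \<Longrightarrow> ((\<lambda>m. (cmod (u m))\<^sup>2) has_sum (\<Sum>\<^sub>\<infinity>m. (cmod (u m))\<^sup>2)) UNIV"
  unfolding l2Z_def by (rule has_sum_infsum)

lemma l2_inner_bound:
  assumes "l2Z u" "l2Z v" "\<epsilon> > 0"
  shows "cmod (l2_inner u v) \<le> (\<epsilon> * (\<Sum>\<^sub>\<infinity>m. (cmod (u m))\<^sup>2) + (\<Sum>\<^sub>\<infinity>m. (cmod (v m))\<^sup>2) / \<epsilon>) / 2"
proof (rule norm_has_sum_le[OF l2Z_inner_has_sum[OF assms(1,2)]])
  show "((\<lambda>m. (\<epsilon> * (cmod (u m))\<^sup>2 + (cmod (v m))\<^sup>2 * (1 / \<epsilon>)) * (1/2)) has_sum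
     (\<epsilon> * (\<Sum>\<^sub>\<infinity>m. (cmod (u m))\<^sup>2) + (\<Sum>\<^sub>\<infinity>m. (cmod (v m))\<^sup>2) / \<epsilon>) / 2) UNIV"
    using has_sum_cmult_left[OF has_sum_add[OF has_sum_cmult_right[OF l2Z_norm_has_sum[OF assms(1)], of \<epsilon>]
       has_sum_cmult_left[OF l2Z_norm_has_sum[OF assms(2)], of "1 / \<epsilon>"]], of "1/2"] by simp
  show "cmod (cnj (u m) * v m) \<le> (\<epsilon> * (cmod (u m))\<^sup>2 + (cmod (v m))\<^sup>2 * (1 / \<epsilon>)) * (1/2)" for m
    using cmod_mult_le_mean[OF assms(3), of "cnj (u m)" "v m"] by simp
qed

lemma l2Z_boundedI:
  assumes "\<And>F. finite F \<Longrightarrow> (\<Sum>m\<in>F. (cmod (u m))\<^sup>2) \<le> S"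
  shows "l2Z u" "(\<Sum>\<^sub>\<infinity>m. (cmod (u m))\<^sup>2) \<le> S"
proof -
  have s: "(\<lambda>m. (cmod (u m))\<^sup>2) summable_on UNIV"
    by (rule nonneg_bdd_above_summable_on) (auto intro!: bdd_aboveI2[where M = S] assms)
  then show "l2Z u" by (simp add: l2Z_def)
  show "(\<Sum>\<^sub>\<infinity>m. (cmod (u m))\<^sup>2) \<le> S"
    by (rule infsum_le_finite_sums[OF s]) (auto intro: assms)
qed

section \<open>Expansion in an orthonormal basis of square summable sequences\<close>

locale l2_basis =
  fixes \<phi> :: "nat \<Rightarrow> int \<Rightarrow> complex"
  assumes l2: "\<And>s. l2Z (\<phi> s)"
    and orthonormal: "\<And>s t. l2_inner (\<phi> s) (\<phi> t) = (if s = t then 1 else 0)"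
    and complete: "\<And>u. l2Z u \<Longrightarrow> (\<And>s. l2_inner (\<phi> s) u = 0) \<Longrightarrow> u = (\<lambda>_. 0)"
begin

lemma combination_norm:
  assumes "finite I"
  shows "((\<lambda>m. (cmod (\<Sum>s\<in>I. c s * \<phi> s m))\<^sup>2) has_sum (\<Sum>s\<in>I. (cmod (c s))\<^sup>2)) UNIV"
proof -
  have "((\<lambda>m. \<Sum>s\<in>I. \<Sum>t\<in>I. (cnj (c s) * c t) * (cnj (\<phi> s m) * \<phi> t m)) has_sum
      (\<Sum>s\<in>I. \<Sum>t\<in>I. (cnj (c s) * c t) * l2_inner (\<phi> s) (\<phi> t))) UNIV"
    using assms by (intro has_sum_sum has_sum_cmult_right l2Z_inner_has_sum l2)
  moreover have "(\<Sum>s\<in>I. \<Sum>t\<in>I. (cnj (c s) * c t) * (cnj (\<phi> s m) * \<phi> t m)) = of_real ((cmod (\<Sum>s\<in>I. c s * \<phi> s m))\<^sup>2)" for m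
    unfolding complex_norm_square cnj_sum sum_product by (subst sum.swap) (simp add: mult_ac)
  moreover have "(\<Sum>s\<in>I. \<Sum>t\<in>I. (cnj (c s) * c t) * l2_inner (\<phi> s) (\<phi> t)) = of_real (\<Sum>s\<in>I. (cmod (c s))\<^sup>2)"
    using assms by (simp add: orthonormal complex_norm_square mult.commute if_distrib del: of_real_power cong: if_cong)
  ultimately have "((\<lambda>m. complex_of_real ((cmod (\<Sum>s\<in>I. c s * \<phi> s m))\<^sup>2)) has_sum of_real (\<Sum>s\<in>I. (cmod (c s))\<^sup>2)) UNIV"
    by simp
  then show ?thesis by (simp only: has_sum_of_real_iff)
qed

lemma combination_finite_le:
  assumes "finite I" "finite F"
  shows "(\<Sum>m\<in>F. (cmod (\<Sum>s\<in>I. c s * \<phi> s m))\<^sup>2) \<le> (\<Sum>s\<in>I. (cmod (c s))\<^sup>2)"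
  by (rule has_sum_mono_neutral[OF has_sum_finite[OF assms(2)] combination_norm[OF assms(1)]]) auto

text \<open>The combination with coefficients \<open>cnj (\<phi> s n)\<close> has squared norm b and
  takes the value b at n, so b^2 is at most b.\<close>

lemma bessel: assumes "finite I" shows "(\<Sum>s\<in>I. (cmod (\<phi> s n))\<^sup>2) \<le> 1"
proof -
  define b where "b = (\<Sum>s\<in>I. (cmod (\<phi> s n))\<^sup>2)"
  have "(\<Sum>m\<in>{n}. (cmod (\<Sum>s\<in>I. cnj (\<phi> s n) * \<phi> s m))\<^sup>2) \<le> (\<Sum>s\<in>I. (cmod (cnj (\<phi> s n)))\<^sup>2)"
    by (rule combination_finite_le) (use assms in auto)
  moreover have "(\<Sum>s\<in>I. cnj (\<phi> s n) * \<phi> s n) = of_real b"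
    by (simp add: b_def complex_norm_square mult.commute del: of_real_power)
  ultimately have "b\<^sup>2 \<le> b" by (simp add: b_def[symmetric])
  moreover have "b \<ge> 0" by (simp add: b_def sum_nonneg)
  ultimately show ?thesis unfolding b_def[symmetric] by (cases "b = 0") (auto simp: power2_eq_square)
qed

lemma summable_row: "summable (\<lambda>s. (cmod (\<phi> s n))\<^sup>2)"
  by (rule summableI_nonneg_bounded[where x = 1]) (auto intro: bessel)

lemma summable_pair: "summable (\<lambda>s. cmod (\<phi> s m * \<phi> s n))"
proof (rule summable_comparison_test')
  show "summable (\<lambda>s. (cmod (\<phi> s m))\<^sup>2 + (cmod (\<phi> s n))\<^sup>2)" by (intro summable_add summable_row)
  show "norm (cmod (\<phi> s m * \<phi> s n)) \<le> (cmod (\<phi> s m))\<^sup>2 + (cmod (\<phi> s n))\<^sup>2" for s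
  proof -
    have A: "cmod (\<phi> s m * \<phi> s n) \<le> (1 * (cmod (\<phi> s m))\<^sup>2 + (cmod (\<phi> s n))\<^sup>2 / 1) / 2"
      by (rule cmod_mult_le_mean) simp
    have "c \<le> p + q" if "c \<le> (1 * p + q / 1) / 2" "0 \<le> p" "0 \<le> q" for c p q :: real
      using that by simp
    from this[OF A] show ?thesis by simp
  qed
qed

lemma suminf_pair_le: "(\<Sum>s. cmod (\<phi> s m * \<phi> s n)) \<le> 1"
proof (rule suminf_le_const[OF summable_pair])
  fix N
  have "(\<Sum>s<N. cmod (\<phi> s m * \<phi> s n)) \<le> (\<Sum>s<N. (1 * (cmod (\<phi> s m))\<^sup>2 + (cmod (\<phi> s n))\<^sup>2 / 1) / 2)"
    by (intro sum_mono cmod_mult_le_mean) simp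
  also have "\<dots> = ((\<Sum>s<N. (cmod (\<phi> s m))\<^sup>2) + (\<Sum>s<N. (cmod (\<phi> s n))\<^sup>2)) / 2"
    by (simp add: sum.distrib sum_divide_distrib[symmetric])
  also have "\<dots> \<le> 1" using bessel[of "{..<N}" m] bessel[of "{..<N}" n] by simp
  finally show "(\<Sum>s<N. cmod (\<phi> s m * \<phi> s n)) \<le> 1" .
qed

text \<open>Completeness only says that a vector orthogonal to the basis is zero. Hence the
  candidate expansion h of the delta function at n is built first, and then h minus that delta
  function is shown to be square summable and orthogonal to the basis.\<close>

lemma resolution_of_identity:
  "(\<lambda>s. \<phi> s m * cnj (\<phi> s n)) sums (if m = n then 1 else 0)"
proof -
  define c where "c s = cnj (\<phi> s n)" for s
  define tail where "tail S = (\<Sum>s. (cmod (c (s + S)))\<^sup>2)" for S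
  have sc: "summable (\<lambda>s. (cmod (c s))\<^sup>2)" using summable_row by (simp add: c_def)
  have tail0: "tail \<longlonglongrightarrow> 0" unfolding tail_def by (rule suminf_exist_split2[OF sc])
  have sh: "summable (\<lambda>s. c s * \<phi> s m)" for m
    using summable_pair[of n m] by - (rule summable_norm_cancel, simp add: c_def norm_mult)
  define h where "h m = (\<Sum>s. c s * \<phi> s m)" for m
  define r where "r S m = h m - (\<Sum>s<S. c s * \<phi> s m)" for S m
  \<comment> \<open>Pythagoras for finite combinations passes to the pointwise limit on each finite
    set of sites; the bound does not depend on the set.\<close>
  have r_bound: "(\<Sum>m\<in>F. (cmod (r S m))\<^sup>2) \<le> tail S" if "finite F" for F S
  proof -
    have "(\<lambda>N. \<Sum>m\<in>F. (cmod (\<Sum>s<N. c (s + S) * \<phi> (s + S) m))\<^sup>2) \<longlonglongrightarrow> (\<Sum>m\<in>F. (cmod (r S m))\<^sup>2)"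
    proof (intro tendsto_sum tendsto_power tendsto_norm)
      fix m
      have "(\<lambda>s. c (s + S) * \<phi> (s + S) m) sums (h m - (\<Sum>s<S. c s * \<phi> s m))"
        unfolding h_def by (rule sums_split_initial_segment[OF summable_sums[OF sh]])
      then show "(\<lambda>N. \<Sum>s<N. c (s + S) * \<phi> (s + S) m) \<longlonglongrightarrow> r S m" by (simp add: sums_def r_def)
    qed
    moreover have "(\<Sum>m\<in>F. (cmod (\<Sum>s<N. c (s + S) * \<phi> (s + S) m))\<^sup>2) \<le> tail S" for N
    proof -
      have e: "(\<Sum>s<N. c (s + S) * \<phi> (s + S) m) = (\<Sum>s\<in>(\<lambda>s. s + S) ` {..<N}. c s * \<phi> s m)" for m
        by (subst sum.reindex) (auto simp: inj_on_def)
      have "(\<Sum>m\<in>F. (cmod (\<Sum>s<N. c (s + S) * \<phi> (s + S) m))\<^sup>2) \<le> (\<Sum>s\<in>(\<lambda>s. s + S) ` {..<N}. (cmod (c s))\<^sup>2)"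
        unfolding e by (rule combination_finite_le) (use that in auto)
      also have "\<dots> = (\<Sum>s<N. (cmod (c (s + S)))\<^sup>2)" by (subst sum.reindex) (auto simp: inj_on_def)
      also have "\<dots> \<le> tail S" unfolding tail_def
        by (rule sum_le_suminf) (use summable_ignore_initial_segment[OF sc] in auto)
      finally show ?thesis .
    qed
    ultimately show ?thesis by (intro tendsto_upperbound[of _ _ sequentially]) auto
  qed
  have r_l2: "l2Z (r S)" "(\<Sum>\<^sub>\<infinity>m. (cmod (r S m))\<^sup>2) \<le> tail S" for S
    using l2Z_boundedI[of "r S" "tail S"] r_bound by auto
  have h_l2: "l2Z h" using r_l2(1)[of 0] by (simp add: r_def[abs_def])
  have inner_h: "l2_inner (\<phi> t) h = c t" for t
  proof -
    have norm1: "(\<Sum>\<^sub>\<infinity>m. (cmod (\<phi> t m))\<^sup>2) = 1"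
      using combination_norm[of "{t}" "\<lambda>_. 1"] by (simp add: infsumI)
    \<comment> \<open>With \<epsilon> fixed, S tends to infinity and removes the tail; only then is
      \<epsilon> sent to 0.\<close>
    have *: "cmod (l2_inner (\<phi> t) h - c t) \<le> (\<epsilon> + tail S / \<epsilon>) / 2" if "\<epsilon> > 0" "S > t" for \<epsilon> S
    proof -
      have "((\<lambda>m. cnj (\<phi> t m) * r S m + (\<Sum>s<S. c s * (cnj (\<phi> t m) * \<phi> s m))) has_sum
         (l2_inner (\<phi> t) (r S) + (\<Sum>s<S. c s * l2_inner (\<phi> t) (\<phi> s)))) UNIV"
        by (intro has_sum_add has_sum_sum has_sum_cmult_right l2Z_inner_has_sum l2 r_l2 finite_lessThan)
      moreover have "cnj (\<phi> t m) * r S m + (\<Sum>s<S. c s * (cnj (\<phi> t m) * \<phi> s m)) = cnj (\<phi> t m) * h m" for m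
        by (simp add: r_def right_diff_distrib sum_distrib_left mult_ac)
      moreover have "(\<Sum>s<S. c s * l2_inner (\<phi> t) (\<phi> s)) = c t"
        using that(2) by (simp add: orthonormal if_distrib cong: if_cong)
      ultimately have "l2_inner (\<phi> t) h = l2_inner (\<phi> t) (r S) + c t"
        using l2Z_inner_has_sum[OF l2 h_l2, of t] by (simp add: has_sum_unique)
      then have "cmod (l2_inner (\<phi> t) h - c t) \<le> (\<epsilon> * 1 + (\<Sum>\<^sub>\<infinity>m. (cmod (r S m))\<^sup>2) / \<epsilon>) / 2"
        using l2_inner_bound[OF l2 r_l2(1) that(1), of t S] by (simp add: norm1)
      also have "\<dots> \<le> (\<epsilon> + tail S / \<epsilon>) / 2"
        using r_l2(2)[of S] that(1) by (simp add: divide_right_mono)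
      finally show ?thesis .
    qed
    have "cmod (l2_inner (\<phi> t) h - c t) \<le> 0 + \<epsilon>" if "\<epsilon> > 0" for \<epsilon>
    proof -
      have "(\<lambda>S. (\<epsilon> + tail S / \<epsilon>) / 2) \<longlonglongrightarrow> (\<epsilon> + 0 / \<epsilon>) / 2" by (intro tendsto_intros tail0) (use that in auto)
      moreover have "\<forall>\<^sub>F S in sequentially. cmod (l2_inner (\<phi> t) h - c t) \<le> (\<epsilon> + tail S / \<epsilon>) / 2"
        using eventually_gt_at_top[of t] by eventually_elim (rule *[OF that])
      ultimately have "cmod (l2_inner (\<phi> t) h - c t) \<le> (\<epsilon> + 0 / \<epsilon>) / 2"
        by (intro tendsto_lowerbound[of _ _ sequentially]) auto
      then show ?thesis using that by simp
    qed
    then have "cmod (l2_inner (\<phi> t) h - c t) \<le> 0" by (rule field_le_epsilon)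
    then show ?thesis by simp
  qed
  define d where "d m = (if m = n then 1 else 0 :: complex)" for m
  have hs: "((\<lambda>m. cnj (u m) * d m) has_sum cnj (u n)) UNIV" for u
    by (rule has_sum_finite_neutralI[of "{n}"]) (auto simp: d_def)
  have w: "((\<lambda>m. cnj (\<phi> t m) * (h m - d m)) has_sum 0) UNIV" for t
    using has_sum_diff[OF l2Z_inner_has_sum[OF l2 h_l2, of t] hs[of "\<phi> t"]]
    by (simp add: inner_h c_def algebra_simps)
  have "l2Z (\<lambda>m. h m - d m)"
  proof -
    have "(\<lambda>m. (cmod (h m))\<^sup>2) summable_on (UNIV - {n})"
      using h_l2 unfolding l2Z_def by (rule summable_on_subset_banach) simp
    then have "(\<lambda>m. (cmod (h m - d m))\<^sup>2) summable_on (UNIV - {n})"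
      by (rule summable_on_cong[THEN iffD1, rotated]) (simp add: d_def)
    then have "(\<lambda>m. (cmod (h m - d m))\<^sup>2) summable_on ((UNIV - {n}) \<union> {n})"
      by (intro summable_on_Un_disjoint) auto
    then show ?thesis by (simp add: l2Z_def)
  qed
  moreover have "l2_inner (\<phi> t) (\<lambda>m. h m - d m) = 0" for t
    unfolding l2_inner_def using w by (rule infsumI)
  ultimately have "(\<lambda>m. h m - d m) = (\<lambda>_. 0)" by (rule complete)
  then have "h m = d m" by (metis eq_iff_diff_eq_0)
  then have "(\<lambda>s. c s * \<phi> s m) sums d m" using summable_sums[OF sh[of m]] by (simp add: h_def)
  then show ?thesis by (simp add: c_def d_def mult.commute)
qed

end

text \<open>For a finitely supported trial vector g, symmetry of H gives (z - E_s) <\<phi>_s, g> =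
  <\<phi>_s, (z - H) g>, reality of E_s gives |z - E_s| >= \<open>Im z\<close>, and completeness
  recovers \<open>g 0\<close>. A trial vector avoids inverting z - H on the whole lattice.\<close>

lemma resolvent_bound:
  assumes onb: "eigen_onb lam \<alpha> \<theta> \<phi>"
    and z: "Im z > 0"
    and F: "finite F" "\<And>m. m \<notin> F \<Longrightarrow> g m = 0"
    and J: "finite J" "\<And>m. m \<notin> J \<Longrightarrow> z * g m - amo lam \<alpha> \<theta> g m = 0"
  shows "Im z * cmod (g 0) \<le> (\<Sum>j\<in>J. cmod (z * g j - amo lam \<alpha> \<theta> g j) * (\<Sum>s. cmod (\<phi> s 0 * \<phi> s j)))"
proof -
  interpret l2_basis \<phi>
    using onb unfolding eigen_onb_def is_eigenfunction_def by unfold_locales auto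
  obtain E :: "nat \<Rightarrow> real" where E: "\<And>s m. amo lam \<alpha> \<theta> (\<phi> s) m = of_real (E s) * \<phi> s m"
    using onb unfolding eigen_onb_def is_eigenfunction_def by metis
  define R where "R m = z * g m - amo lam \<alpha> \<theta> g m" for m
  define \<gamma> where "\<gamma> s = (\<Sum>m\<in>F. cnj (\<phi> s m) * g m)" for s
  have \<gamma>_eq: "(z - of_real (E s)) * \<gamma> s = (\<Sum>j\<in>J. cnj (\<phi> s j) * R j)" for s
  proof -
    let ?V = "\<lambda>m. complex_of_real (2 * lam * cos (2 * pi * (\<theta> + of_int m * \<alpha>)))"
    have fin: "\<exists>S. ((\<lambda>m. w m * g m) has_sum S) UNIV" for w
      using has_sum_finite_neutralI[of F UNIV "\<lambda>m. w m * g m"] F by auto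
    obtain S1 where S1: "((\<lambda>m. cnj (\<phi> s (m - 1)) * g m) has_sum S1) UNIV" using fin[of "\<lambda>m. cnj (\<phi> s (m - 1))"] by blast
    obtain S2 where S2: "((\<lambda>m. cnj (\<phi> s (m + 1)) * g m) has_sum S2) UNIV" using fin[of "\<lambda>m. cnj (\<phi> s (m + 1))"] by blast
    obtain S3 where S3: "((\<lambda>m. (z - ?V m) * cnj (\<phi> s m) * g m) has_sum S3) UNIV" using fin[of "\<lambda>m. (z - ?V m) * cnj (\<phi> s m)"] by blast
    \<comment> \<open>Index shifts move the hopping between g and the eigenfunction, so that the
      total \<open>S3 - S1 - S2\<close> can be read in two ways.\<close>
    have S1': "((\<lambda>m. cnj (\<phi> s m) * g (m + 1)) has_sum S1) UNIV"
      using has_sum_int_shift[of "\<lambda>m. cnj (\<phi> s (m - 1)) * g m" 1 S1] S1 by simp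
    have S2': "((\<lambda>m. cnj (\<phi> s m) * g (m - 1)) has_sum S2) UNIV"
      using has_sum_int_shift[of "\<lambda>m. cnj (\<phi> s (m + 1)) * g m" "-1" S2] S2 by simp
    have "((\<lambda>m. (z - ?V m) * cnj (\<phi> s m) * g m - cnj (\<phi> s m) * g (m + 1) - cnj (\<phi> s m) * g (m - 1)) has_sum (S3 - S1 - S2)) UNIV"
      by (intro has_sum_diff S3 S1' S2')
    moreover have "(z - ?V m) * cnj (\<phi> s m) * g m - cnj (\<phi> s m) * g (m + 1) - cnj (\<phi> s m) * g (m - 1) = cnj (\<phi> s m) * R m" for m
      by (simp add: R_def amo_def algebra_simps)
    ultimately have A: "((\<lambda>m. cnj (\<phi> s m) * R m) has_sum (S3 - S1 - S2)) UNIV" by simp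
    have "((\<lambda>m. (z - ?V m) * cnj (\<phi> s m) * g m - cnj (\<phi> s (m - 1)) * g m - cnj (\<phi> s (m + 1)) * g m) has_sum (S3 - S1 - S2)) UNIV"
      by (intro has_sum_diff S3 S1 S2)
    moreover have "(z - ?V m) * cnj (\<phi> s m) * g m - cnj (\<phi> s (m - 1)) * g m - cnj (\<phi> s (m + 1)) * g m
        = (z - of_real (E s)) * cnj (\<phi> s m) * g m" for m
    proof -
      have "cnj (amo lam \<alpha> \<theta> (\<phi> s) m) = of_real (E s) * cnj (\<phi> s m)" by (simp add: E)
      then have "cnj (\<phi> s (m + 1)) + cnj (\<phi> s (m - 1)) + ?V m * cnj (\<phi> s m) = of_real (E s) * cnj (\<phi> s m)"
        by (simp add: amo_def)
      then have "(cnj (\<phi> s (m + 1)) + cnj (\<phi> s (m - 1)) + ?V m * cnj (\<phi> s m)) * g m = of_real (E s) * cnj (\<phi> s m) * g m"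
        by simp
      then show ?thesis by (simp add: algebra_simps)
    qed
    ultimately have B: "((\<lambda>m. (z - of_real (E s)) * cnj (\<phi> s m) * g m) has_sum (S3 - S1 - S2)) UNIV" by simp
    have "((\<lambda>m. (z - of_real (E s)) * cnj (\<phi> s m) * g m) has_sum (z - of_real (E s)) * \<gamma> s) UNIV"
      using F by (intro has_sum_finite_neutralI[of F]) (auto simp: \<gamma>_def sum_distrib_left mult_ac)
    then have 1: "(z - of_real (E s)) * \<gamma> s = S3 - S1 - S2" using B by (rule has_sum_unique)
    have "((\<lambda>m. cnj (\<phi> s m) * R m) has_sum (\<Sum>j\<in>J. cnj (\<phi> s j) * R j)) UNIV"
      using J by (intro has_sum_finite_neutralI[of J]) (auto simp: R_def)
    then have 2: "(\<Sum>j\<in>J. cnj (\<phi> s j) * R j) = S3 - S1 - S2" using A by (rule has_sum_unique)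
    show ?thesis using 1 2 by simp
  qed
  have le: "Im z * cmod (\<phi> s 0 * \<gamma> s) \<le> (\<Sum>j\<in>J. cmod (R j) * cmod (\<phi> s 0 * \<phi> s j))" for s
  proof -
    have "Im z \<le> cmod (z - of_real (E s))" using abs_Im_le_cmod[of "z - of_real (E s)"] z by simp
    then have "Im z * cmod (\<phi> s 0 * \<gamma> s) \<le> cmod (z - of_real (E s)) * cmod (\<phi> s 0 * \<gamma> s)"
      by (intro mult_right_mono) auto
    also have "\<dots> = cmod (\<phi> s 0) * cmod ((z - of_real (E s)) * \<gamma> s)" by (simp add: norm_mult)
    also have "\<dots> = cmod (\<phi> s 0) * cmod (\<Sum>j\<in>J. cnj (\<phi> s j) * R j)" by (simp only: \<gamma>_eq)
    also have "\<dots> \<le> cmod (\<phi> s 0) * (\<Sum>j\<in>J. cmod (cnj (\<phi> s j) * R j))"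
      by (intro mult_left_mono norm_sum) auto
    also have "\<dots> = (\<Sum>j\<in>J. cmod (R j) * cmod (\<phi> s 0 * \<phi> s j))"
      by (simp add: sum_distrib_left norm_mult mult_ac)
    finally show ?thesis .
  qed
  have "(\<lambda>s. \<Sum>m\<in>F. (\<phi> s 0 * cnj (\<phi> s m)) * g m) sums (\<Sum>m\<in>F. (if 0 = m then 1 else 0) * g m)"
    by (intro sums_sum sums_mult2 resolution_of_identity)
  moreover have "(\<Sum>m\<in>F. (if 0 = m then 1 else 0) * g m) = g 0"
    using F by (cases "0 \<in> F") (auto simp: if_distrib[of "\<lambda>x. x * _"] cong: if_cong)
  moreover have "(\<Sum>m\<in>F. (\<phi> s 0 * cnj (\<phi> s m)) * g m) = \<phi> s 0 * \<gamma> s" for s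
    by (simp add: \<gamma>_def sum_distrib_left mult.assoc)
  ultimately have sm: "(\<lambda>s. \<phi> s 0 * \<gamma> s) sums g 0" by simp
  have sR: "(\<lambda>s. \<Sum>j\<in>J. cmod (R j) * cmod (\<phi> s 0 * \<phi> s j)) sums
      (\<Sum>j\<in>J. cmod (R j) * (\<Sum>s. cmod (\<phi> s 0 * \<phi> s j)))"
    by (intro sums_sum sums_mult summable_sums summable_pair)
  have "(\<lambda>N. Im z * cmod (\<Sum>s<N. \<phi> s 0 * \<gamma> s)) \<longlonglongrightarrow> Im z * cmod (g 0)"
    using sm unfolding sums_def by (intro tendsto_intros)
  moreover have "Im z * cmod (\<Sum>s<N. \<phi> s 0 * \<gamma> s) \<le> (\<Sum>s<N. \<Sum>j\<in>J. cmod (R j) * cmod (\<phi> s 0 * \<phi> s j))" for N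
  proof -
    have "Im z * cmod (\<Sum>s<N. \<phi> s 0 * \<gamma> s) \<le> Im z * (\<Sum>s<N. cmod (\<phi> s 0 * \<gamma> s))"
      using z by (intro mult_left_mono norm_sum) auto
    also have "\<dots> \<le> (\<Sum>s<N. \<Sum>j\<in>J. cmod (R j) * cmod (\<phi> s 0 * \<phi> s j))"
      unfolding sum_distrib_left by (intro sum_mono le)
    finally show ?thesis .
  qed
  ultimately have "Im z * cmod (g 0) \<le> (\<Sum>j\<in>J. cmod (R j) * (\<Sum>s. cmod (\<phi> s 0 * \<phi> s j)))"
    using sR unfolding sums_def by (intro LIMSEQ_le) auto
  then show ?thesis by (simp add: R_def)
qed

section \<open>Green functions of boxes\<close>

text \<open>An elementary Combes-Thomas estimate. Flux and the arithmetic-geometric mean make the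
  partial sums S of the squared moduli grow by the factor 1 + 2 \<open>Im z\<close> every two sites;
  the flux at the last site bounds the final determinant below by \<open>Im z\<close> times the root
  of S.\<close>

lemma box_det_decay:
  assumes z: "Im z > 0" and le: "i + 2 * m < K"
  shows "cmod (box_det 1 \<nu> \<alpha> \<theta> z i) / cmod (box_det 1 \<nu> \<alpha> \<theta> z K) \<le> 1 / (Im z * sqrt (1 + 2 * Im z) ^ m)"
proof -
  let ?D = "\<lambda>n. cmod (box_det 1 \<nu> \<alpha> \<theta> z n)" and ?\<eta> = "Im z"
  define S where "S n = (\<Sum>j\<le>n. (?D j)\<^sup>2)" for n
  have S1: "S n \<ge> 1" for n
  proof -
    have "S 0 \<le> S n" unfolding S_def by (intro sum_mono2) auto
    then show ?thesis by (simp add: S_def)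
  qed
  have flux: "?\<eta> * S n \<le> ?D (Suc n) * ?D n" for n
  proof -
    have "?\<eta> * S n \<le> cmod (box_det 1 \<nu> \<alpha> \<theta> z (Suc n) * cnj (box_det 1 \<nu> \<alpha> \<theta> z n))"
      unfolding S_def box_det_flux[symmetric] using abs_Im_le_cmod abs_le_iff by blast
    then show ?thesis by (simp only: norm_mult complex_mod_cnj)
  qed
  have S_Suc: "S (Suc n) = S n + (?D (Suc n))\<^sup>2" for n by (simp add: S_def)
  have mono: "S n \<le> S k" if "n \<le> k" for n k
    unfolding S_def using that by (intro sum_mono2) auto
  have DS: "(?D n)\<^sup>2 \<le> S n" for n unfolding S_def by (rule member_le_sum) auto
  have step: "(1 + 2 * ?\<eta>) * S n \<le> S (Suc (Suc n))" for n
  proof -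
    have "2 * (?D (Suc (Suc n)) * ?D (Suc n)) \<le> (?D (Suc (Suc n)))\<^sup>2 + (?D (Suc n))\<^sup>2"
      using sum_squares_bound[of "?D (Suc (Suc n))" "?D (Suc n)"] by simp
    moreover have "?\<eta> * S n \<le> ?\<eta> * S (Suc n)" using mono[of n "Suc n"] z by simp
    ultimately show ?thesis using flux[of "Suc n"] S_Suc[of n] S_Suc[of "Suc n"] by (simp add: algebra_simps)
  qed
  have grow: "(1 + 2 * ?\<eta>) ^ m * S n \<le> S (n + 2 * m)" for m n
  proof (induction m)
    case (Suc m)
    have "(1 + 2 * ?\<eta>) * ((1 + 2 * ?\<eta>) ^ m * S n) \<le> (1 + 2 * ?\<eta>) * S (n + 2 * m)"
      using Suc z by (intro mult_left_mono) auto
    then show ?case using step[of "n + 2 * m"] by (simp add: mult.assoc)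
  qed simp
  obtain k where k: "K = Suc k" using le by (cases K) auto
  have "(?\<eta> * S k)\<^sup>2 \<le> (?D K * ?D k)\<^sup>2"
    using flux[of k] S1[of k] z unfolding k by (intro power_mono) auto
  also have "\<dots> \<le> (?D K)\<^sup>2 * S k" using DS[of k] by (simp add: power_mult_distrib mult_left_mono)
  finally have "?\<eta>\<^sup>2 * S k * S k \<le> (?D K)\<^sup>2 * S k" by (simp add: power2_eq_square mult_ac)
  then have le1: "?\<eta>\<^sup>2 * S k \<le> (?D K)\<^sup>2" using S1[of k] by (auto dest: mult_right_le_imp_le)
  have le2: "?\<eta>\<^sup>2 * ((1 + 2 * ?\<eta>) ^ m * (?D i)\<^sup>2) \<le> ?\<eta>\<^sup>2 * S k"
  proof (intro mult_left_mono)
    have "(1 + 2 * ?\<eta>) ^ m * (?D i)\<^sup>2 \<le> (1 + 2 * ?\<eta>) ^ m * S i" using DS[of i] z by (intro mult_left_mono) auto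
    also have "\<dots> \<le> S k" using grow[of m i] mono[of "i + 2 * m" k] le k by simp
    finally show "(1 + 2 * ?\<eta>) ^ m * (?D i)\<^sup>2 \<le> S k" .
  qed simp
  have "(?\<eta> * sqrt (1 + 2 * ?\<eta>) ^ m * ?D i)\<^sup>2 \<le> (?D K)\<^sup>2"
  proof -
    have "(sqrt (1 + 2 * ?\<eta>) ^ m)\<^sup>2 = (sqrt (1 + 2 * ?\<eta>))\<^sup>2 ^ m"
      by (simp only: power_mult[symmetric] mult.commute)
    then have "(sqrt (1 + 2 * ?\<eta>) ^ m)\<^sup>2 = (1 + 2 * ?\<eta>) ^ m" using z by simp
    then have "(?\<eta> * sqrt (1 + 2 * ?\<eta>) ^ m * ?D i)\<^sup>2 = ?\<eta>\<^sup>2 * ((1 + 2 * ?\<eta>) ^ m * (?D i)\<^sup>2)"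
      by (simp only: power_mult_distrib mult.assoc)
    then show ?thesis using le1 le2 by linarith
  qed
  then have "?\<eta> * sqrt (1 + 2 * ?\<eta>) ^ m * ?D i \<le> ?D K" by (rule power2_le_imp_le) simp
  moreover have "?D K > 0" using box_det_nonzero_upper[OF z] by simp
  moreover have "?\<eta> * sqrt (1 + 2 * ?\<eta>) ^ m > 0" using z by simp
  ultimately show ?thesis by (simp add: field_simps)
qed

text \<open>\<open>Im z\<close> times the modulus of the Green function between 0 and n of a box
  with a further sites on each side, by Cramer's rule with hopping 1. The numerator consists of the
  two end blocks, the right one read from the right edge.\<close>

definition green_lower :: "real \<Rightarrow> real \<Rightarrow> complex \<Rightarrow> int \<Rightarrow> nat \<Rightarrow> real \<Rightarrow> real" where
  "green_lower lam \<alpha> z n a \<theta> = Im z *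
     (cmod (box_det 1 lam \<alpha> (\<theta> + of_int (min 0 n - int a) * \<alpha>) z a) *
      cmod (box_det 1 lam \<alpha> (- (\<theta> + of_int (max 0 n + int a) * \<alpha>)) z a) /
      cmod (box_det 1 lam \<alpha> (\<theta> + of_int (min 0 n - int a) * \<alpha>) z (2 * a + nat \<bar>n\<bar> + 1)))"

lemma green_lower_le:
  assumes onb: "eigen_onb lam \<alpha> \<theta> \<phi>" and z: "Im z > 0"
  shows "green_lower lam \<alpha> z n (2 * m) \<theta> - 2 / (Im z * sqrt (1 + 2 * Im z) ^ m)
    \<le> (\<Sum>s. cmod (\<phi> s 0 * \<phi> s n))"
proof -
  interpret l2_basis \<phi>
    using onb unfolding eigen_onb_def is_eigenfunction_def by unfold_locales auto
  \<comment> \<open>The padding is \<open>2 * m\<close> because each of the m factors in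
    \<open>box_det_decay\<close> takes two sites.\<close>
  define l r where "l = min 0 n - int (2 * m)" and "r = max 0 n + int (2 * m)"
  have lr: "l \<le> 0" "0 \<le> r" "l \<le> n" "n \<le> r" by (auto simp: l_def r_def)
  define DL where "DL = box_det 1 lam \<alpha> (\<theta> + of_int l * \<alpha>) z"
  define DR where "DR = box_det 1 lam \<alpha> (- (\<theta> + of_int r * \<alpha>)) z"
  define V where "V j = complex_of_real (pot lam \<alpha> \<theta> j)" for j
  \<comment> \<open>The solutions u and w start at the left and the right edge and vanish just
    outside the box. Their Wronskian is the determinant of the box.\<close>
  define u where "u j = (if j < l then 0 else DL (nat (j - l)))" for j
  define w where "w j = (if j > r then 0 else DR (nat (r - j)))" for j
  have u_rec: "u (j + 1) = (z - V j) * u j - u (j - 1)" if j: "l \<le> j" for j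
  proof (cases "j = l")
    case True then show ?thesis by (simp add: u_def DL_def V_def pot_shift del: of_int_add)
  next
    case False
    define k where "k = nat (j - 1 - l)"
    have k: "j = l + 1 + int k" using False j by (simp add: k_def)
    have e: "nat (j + 1 - l) = Suc (Suc k)" "nat (j - l) = Suc k" "nat (j - 1 - l) = k" unfolding k by auto
    have p: "pot lam \<alpha> (\<theta> + of_int l * \<alpha>) (int (Suc k)) = pot lam \<alpha> \<theta> j" unfolding pot_shift k by (simp add: add_ac)
    show ?thesis using j False unfolding u_def e DL_def box_det.simps(3) p V_def by simp
  qed
  have w_rec: "w (j - 1) = (z - V j) * w j - w (j + 1)" if j: "j \<le> r" for j
  proof (cases "j = r")
    case True then show ?thesis by (simp add: w_def DR_def V_def pot_reflect del: of_int_add minus_add_distrib)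
  next
    case False
    define k where "k = nat (r - j - 1)"
    have k: "j = r - 1 - int k" using False j by (simp add: k_def)
    have e: "nat (r - (j - 1)) = Suc (Suc k)" "nat (r - j) = Suc k" "nat (r - (j + 1)) = k" unfolding k by auto
    have p: "pot lam \<alpha> (- (\<theta> + of_int r * \<alpha>)) (int (Suc k)) = pot lam \<alpha> \<theta> j" unfolding pot_reflect k by (simp add: algebra_simps)
    show ?thesis using j False unfolding w_def e DR_def box_det.simps(3) p V_def by simp
  qed
  define Dt where "Dt = u (r + 1)"
  have bnd: "u l = 1" "u (l - 1) = 0" "w r = 1" "w (r + 1) = 0" by (simp_all add: u_def w_def DL_def DR_def)
  have wr: "u (r - int i + 1) * w (r - int i) - u (r - int i) * w (r - int i + 1) = Dt" if "l - 1 \<le> r - int i" for i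
    using that
  proof (induction i)
    case 0 show ?case using bnd by (simp add: Dt_def)
  next
    case (Suc i)
    define j where "j = r - int i"
    have j: "l \<le> j" "j \<le> r" using Suc(2) by (auto simp: j_def)
    have e: "r - int (Suc i) = j - 1" by (simp add: j_def)
    have "u (j + 1) * w j - u j * w (j + 1) = Dt" using Suc j by (simp add: j_def)
    then show ?case unfolding e u_rec[OF j(1)] w_rec[OF j(2)] by (simp add: algebra_simps)
  qed
  have wron: "u (j + 1) * w j - u j * w (j + 1) = Dt" if "l - 1 \<le> j" "j \<le> r" for j
    using wr[of "nat (r - j)"] that by simp
  have Dt_u: "Dt = DL (nat (r + 1 - l))" using lr by (simp add: Dt_def u_def)
  \<comment> \<open>The determinant is also read from the right edge, so that each edge term becomes
    a quotient of determinants at a common phase, as \<open>box_det_decay\<close> requires.\<close>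
  have Dt_w: "Dt = DR (nat (r + 1 - l))"
    using wron[of "l - 1"] bnd lr by (simp add: w_def algebra_simps)
  have Dt0: "Dt \<noteq> 0" unfolding Dt_u DL_def by (rule box_det_nonzero_upper[OF z])
  \<comment> \<open>The Green function of the box with source n, extended by zero. Its residual is
    the delta function at n plus one term just outside each edge.\<close>
  define g where "g j = (if j < l \<or> r < j then 0 else if j \<le> n then u j * w n / Dt else u n * w j / Dt)" for j
  have g_out: "g j = 0" if "j \<notin> {l..r}" for j using that by (auto simp: g_def)
  have gl: "g j = u j * w n / Dt" if "l - 1 \<le> j" "j \<le> n" for j
    using that lr bnd by (cases "j = l - 1") (auto simp: g_def)
  have gr: "g j = u n * w j / Dt" if "n \<le> j" "j \<le> r + 1" for j
    using that lr bnd by (cases "j = r + 1"; cases "j = n") (auto simp: g_def)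
  define R where "R j = z * g j - amo lam \<alpha> \<theta> g j" for j
  have R: "R j = (z - V j) * g j - g (j + 1) - g (j - 1)" for j
    by (simp add: R_def amo_def V_def pot_def algebra_simps)
  have R0: "R j = 0" if nj: "j \<notin> {l - 1, n, r + 1}" for j
  proof -
    consider "j < l - 1 \<or> r + 1 < j" | "l \<le> j" "j < n" | "n < j" "j \<le> r" using nj lr by force
    then show ?thesis
    proof cases
      case 1 then show ?thesis by (auto simp: R g_def)
    next
      case 2
      then show ?thesis unfolding R using gl[of j] gl[of "j + 1"] gl[of "j - 1"] u_rec[of j]
        by (simp add: diff_divide_distrib[symmetric] left_diff_distrib[symmetric] mult.assoc[symmetric])
    next
      case 3
      then show ?thesis unfolding R using gr[of j] gr[of "j + 1"] gr[of "j - 1"] w_rec[of j] lr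
        by (simp add: divide_inverse algebra_simps)
    qed
  qed
  have Rn: "R n = 1"
  proof -
    have "R n = ((z - V n) * u n * w n - u n * w (n + 1) - u (n - 1) * w n) / Dt"
      unfolding R using gl[of n] gr[of "n + 1"] gl[of "n - 1"] lr by (simp add: diff_divide_distrib)
    also have "\<dots> = (u (n + 1) * w n - u n * w (n + 1)) / Dt" unfolding u_rec[OF lr(3)] by (simp add: algebra_simps)
    also have "\<dots> = 1" using wron[of n] lr Dt0 by simp
    finally show ?thesis .
  qed
  have Rl: "R (l - 1) = - (w n / Dt)" unfolding R using lr gl[of l] bnd by (simp add: g_def)
  have Rr: "R (r + 1) = - (u n / Dt)" unfolding R using lr gr[of r] bnd by (simp add: g_def)
  let ?Q = "\<lambda>j. \<Sum>s. cmod (\<phi> s 0 * \<phi> s j)"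
  have "Im z * cmod (g 0) \<le> (\<Sum>j\<in>{l - 1, n, r + 1}. cmod (R j) * ?Q j)"
    unfolding R_def
    by (rule resolvent_bound[OF onb z, of "{l..r}"]) (use R0 g_out in \<open>auto simp: R_def\<close>)
  also have "\<dots> = cmod (w n / Dt) * ?Q (l - 1) + ?Q n + cmod (u n / Dt) * ?Q (r + 1)"
    using lr by (simp add: Rn Rl Rr)
  also have "\<dots> \<le> cmod (w n / Dt) * 1 + ?Q n + cmod (u n / Dt) * 1"
    by (intro add_mono mult_left_mono suminf_pair_le) auto
  finally have main: "Im z * cmod (g 0) - (cmod (w n / Dt) + cmod (u n / Dt)) \<le> ?Q n" by simp
  have "cmod (w n / Dt) \<le> 1 / (Im z * sqrt (1 + 2 * Im z) ^ m)"
    unfolding Dt_w norm_divide using lr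
    by (simp add: w_def DR_def del: minus_add_distrib) (intro box_det_decay[OF z], simp add: l_def r_def)
  moreover have "cmod (u n / Dt) \<le> 1 / (Im z * sqrt (1 + 2 * Im z) ^ m)"
    unfolding Dt_u norm_divide using lr
    by (simp add: u_def DL_def) (intro box_det_decay[OF z], simp add: l_def r_def)
  moreover have "Im z * cmod (g 0) = green_lower lam \<alpha> z n (2 * m) \<theta>"
  proof -
    have 1: "g 0 = u (min 0 n) * w (max 0 n) / Dt"
      using gl[of 0] gr[of 0] lr by (cases "0 \<le> n") (auto simp: min_def max_def)
    have "nat (min 0 n - l) = 2 * m" "nat (r - max 0 n) = 2 * m" by (simp_all add: l_def r_def)
    then have 2: "u (min 0 n) = DL (2 * m)" "w (max 0 n) = DR (2 * m)"
      unfolding u_def w_def by (simp_all only: if_False) (simp_all add: l_def r_def)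
    have 3: "nat (r + 1 - l) = 2 * (2 * m) + nat \<bar>n\<bar> + 1" by (auto simp: l_def r_def)
    have "Im z * cmod (g 0) = Im z * (cmod (DL (2 * m)) * cmod (DR (2 * m)) / cmod (DL (2 * (2 * m) + nat \<bar>n\<bar> + 1)))"
      unfolding 1 2 Dt_u 3 norm_mult norm_divide ..
    then show ?thesis unfolding green_lower_def DL_def DR_def l_def r_def .
  qed
  ultimately show ?thesis using main by simp
qed

lemma continuous_on_green_lower:
  assumes "Im z > 0" shows "continuous_on A (green_lower lam \<alpha> z n a)"
proof -
  have c: "continuous_on A (\<lambda>\<theta>. box_det 1 lam \<alpha> (g \<theta>) z k)" if "continuous_on A g" for g k
    by (rule continuous_on_compose2[OF continuous_on_box_det[of UNIV] that]) simp
  have c1: "continuous_on A (\<lambda>\<theta>. box_det 1 lam \<alpha> (\<theta> + x) z k)" for x k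
    by (rule c) (intro continuous_intros)
  have c2: "continuous_on A (\<lambda>\<theta>. box_det 1 lam \<alpha> (- (\<theta> + x)) z k)" for x k
    by (rule c) (intro continuous_intros)
  show ?thesis unfolding green_lower_def
    by (intro continuous_on_mult continuous_on_divide continuous_on_norm continuous_on_const c1 c2)
      (simp add: box_det_nonzero_upper[OF assms])
qed

section \<open>Averaging the Green function over the phase\<close>

lemma integral_period_reflect:
  fixes f :: "real \<Rightarrow> real"
  assumes cont: "continuous_on UNIV f" and per: "\<And>x. f (x + 1) = f x"
  shows "integral {0..1} (\<lambda>x. f (- (x + c))) = integral {0..1} f"
proof -
  have "integral {0..1} (\<lambda>x. f (- (x + c))) = integral {0..1} (\<lambda>x. f (- x))"
  proof (rule integral_period_shift[where f = "\<lambda>x. f (- x)"])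
    show "continuous_on UNIV (\<lambda>x. f (- x))" by (intro continuous_on_compose2[OF cont] continuous_intros) auto
    show "f (- (x + 1)) = f (- x)" for x using per[of "- (x + 1)"] by simp
  qed
  also have "\<dots> = integral {-1..0} f"
    using Henstock_Kurzweil_Integration.integral_reflect_real[of 0 "-1" f] by simp
  also have "\<dots> = integral {0..1} (f \<circ> (+) (-1))"
    using integral_shift_Icc_real[of 0 1 f "-1"] by simp
  also have "f \<circ> (+) (-1) = f"
  proof
    fix x show "(f \<circ> (+) (-1)) x = f x" using per[of "x - 1"] by simp
  qed
  finally show ?thesis .
qed

lemma integral_green_lower:
  assumes z: "Im z > 0"
  shows "Im z * exp (2 * mean_log_det 1 lam \<alpha> z a - mean_log_det 1 lam \<alpha> z (2 * a + nat \<bar>n\<bar> + 1))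
    \<le> integral {0..1} (green_lower lam \<alpha> z n a)"
proof -
  define N where "N = 2 * a + nat \<bar>n\<bar> + 1"
  define cl cr where "cl = of_int (min 0 n - int a) * \<alpha>" and "cr = of_int (max 0 n + int a) * \<alpha>"
  define f where "f k \<theta> = ln (cmod (box_det 1 lam \<alpha> \<theta> z k))" for k \<theta>
  have z0: "Im z \<noteq> 0" using z by simp
  have fc: "continuous_on A (f k)" for A k unfolding f_def by (rule continuous_on_log_det[OF z0])
  have fp: "f k (\<theta> + 1) = f k \<theta>" for k \<theta> by (simp add: f_def box_det_period)
  have c1: "continuous_on {0..1} (\<lambda>\<theta>. f k (\<theta> + cl))" for k by (intro continuous_on_compose2[OF fc[of UNIV]] continuous_intros) auto
  have c2: "continuous_on {0..1} (\<lambda>\<theta>. f k (- (\<theta> + cr)))" for k by (intro continuous_on_compose2[OF fc[of UNIV]] continuous_intros) auto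
  have i1: "integral {0..1} (\<lambda>\<theta>. f k (\<theta> + cl)) = mean_log_det 1 lam \<alpha> z k" for k
    using integral_period_shift[OF fc fp, of k cl] by (simp add: mean_log_det_def f_def)
  have i2: "integral {0..1} (\<lambda>\<theta>. f k (- (\<theta> + cr))) = mean_log_det 1 lam \<alpha> z k" for k
    using integral_period_reflect[OF fc fp, of k cr] by (simp add: mean_log_det_def f_def)
  define h where "h \<theta> = f a (\<theta> + cl) + f a (- (\<theta> + cr)) - f N (\<theta> + cl)" for \<theta>
  define c where "c = 2 * mean_log_det 1 lam \<alpha> z a - mean_log_det 1 lam \<alpha> z N"
  have hc: "continuous_on {0..1} h" unfolding h_def by (intro continuous_intros c1 c2)
  have "integral {0..1} h = integral {0..1} (\<lambda>\<theta>. f a (\<theta> + cl) + f a (- (\<theta> + cr))) - integral {0..1} (\<lambda>\<theta>. f N (\<theta> + cl))"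
    unfolding h_def by (intro integral_diff integrable_continuous_interval continuous_intros c1 c2)
  also have "integral {0..1} (\<lambda>\<theta>. f a (\<theta> + cl) + f a (- (\<theta> + cr))) = integral {0..1} (\<lambda>\<theta>. f a (\<theta> + cl)) + integral {0..1} (\<lambda>\<theta>. f a (- (\<theta> + cr)))"
    by (intro integral_add integrable_continuous_interval c1 c2)
  finally have ih: "integral {0..1} h = c" unfolding i1 i2 by (simp add: c_def)
  have gh: "green_lower lam \<alpha> z n a \<theta> = Im z * exp (h \<theta>)" for \<theta>
    using box_det_nonzero_upper[OF z]
    by (simp add: green_lower_def h_def f_def cl_def[symmetric] cr_def[symmetric] N_def exp_add exp_diff
        del: minus_add_distrib of_int_add of_int_diff)
  \<comment> \<open>Jensen's inequality through the tangent of exp at the mean c: the linear term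
    integrates to zero.\<close>
  have "integral {0..1} (\<lambda>\<theta>. Im z * (exp c * (1 + (h \<theta> - c)))) \<le> integral {0..1} (green_lower lam \<alpha> z n a)"
  proof (rule integral_le)
    fix \<theta>
    have "exp c * (1 + (h \<theta> - c)) \<le> exp c * exp (h \<theta> - c)" by (intro mult_left_mono exp_ge_add_one_self) simp
    also have "\<dots> = exp (h \<theta>)" by (simp add: exp_add[symmetric])
    finally show "Im z * (exp c * (1 + (h \<theta> - c))) \<le> green_lower lam \<alpha> z n a \<theta>"
      unfolding gh using z by (intro mult_left_mono) auto
  qed (intro integrable_continuous_interval continuous_intros hc continuous_on_green_lower z)+
  also have "integral {0..1} (\<lambda>\<theta>. Im z * (exp c * (1 + (h \<theta> - c)))) = Im z * exp c"
  proof -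
    have "((\<lambda>\<theta>. Im z * (exp c * (1 + (h \<theta> - c)))) has_integral (Im z * (exp c * ((1 - 0) *\<^sub>R 1 + (c - (1 - 0) *\<^sub>R c))))) {0..1}"
      using hc ih integrable_integral[OF integrable_continuous_interval[OF hc]]
        has_integral_const_real[of "1::real" 0 1] has_integral_const_real[of c 0 1]
      by (intro has_integral_mult_right has_integral_add has_integral_diff) auto
    moreover have "Im z * (exp c * ((1 - 0) *\<^sub>R 1 + (c - (1 - 0) *\<^sub>R c))) = Im z * exp c" by simp
    ultimately show ?thesis by (simp only: integral_unique)
  qed
  finally show ?thesis by (simp add: c_def N_def)
qed

section \<open>The lower bound\<close>

lemma diophantine_irrational:
  assumes "diophantine \<alpha>" "k \<noteq> (0::int)"
  shows "of_int k * \<alpha> \<notin> \<int>"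
proof
  assume "of_int k * \<alpha> \<in> \<int>"
  then have "dist_Z (of_int k * \<alpha>) = 0" by (auto simp: dist_Z_def elim!: Ints_cases)
  moreover obtain \<kappa> \<tau> where "\<tau> > 0" "dist_Z (of_int k * \<alpha>) \<ge> \<tau> / \<bar>of_int k\<bar> powr \<kappa>"
    using assms unfolding diophantine_def by blast
  moreover have "\<bar>real_of_int k\<bar> powr \<kappa> > 0" using assms(2) by simp
  ultimately show False by (simp add: divide_le_0_iff)
qed

lemma AE_nonresonant:
  fixes \<alpha> :: real
  shows "AE \<theta> in lborel. \<forall>k::int. 2 * \<theta> + of_int k * \<alpha> \<notin> \<int>"
proof (rule AE_I')
  define S where "S = range (\<lambda>(j::int, k::int). (of_int j - of_int k * \<alpha>) / 2)"
  have "countable S" unfolding S_def by simp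
  then show "S \<in> null_sets lborel" by (rule countable_imp_null_set_lborel)
  show "{\<theta> \<in> space lborel. \<not> (\<forall>k::int. 2 * \<theta> + of_int k * \<alpha> \<notin> \<int>)} \<subseteq> S"
  proof
    fix \<theta> assume "\<theta> \<in> {\<theta> \<in> space lborel. \<not> (\<forall>k::int. 2 * \<theta> + of_int k * \<alpha> \<notin> \<int>)}"
    then obtain k j :: int where "2 * \<theta> + of_int k * \<alpha> = of_int j" by (auto elim!: Ints_cases)
    then have "\<theta> = (\<lambda>(j::int, k::int). (of_int j - of_int k * \<alpha>) / 2) (j, k)" by simp
    then show "\<theta> \<in> S" unfolding S_def by blast
  qed
qed

text \<open>Potential and energy are real, so real and imaginary parts solve the same equation and
  one of them is nonzero. For real \<psi> the conjugate coefficients describe the second dual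
  solution.\<close>

lemma real_eigenfunction:
  assumes "is_eigenfunction lam \<alpha> \<theta> u"
  obtains \<psi> E where "\<And>m. \<psi> (m + 1) + \<psi> (m - 1) + pot lam \<alpha> \<theta> m * \<psi> m = E * \<psi> m"
    "(\<lambda>m. (\<psi> m)\<^sup>2) summable_on UNIV" "\<exists>m::int. \<psi> m \<noteq> (0::real)"
proof -
  obtain E where l2: "l2Z u" and nz: "u \<noteq> (\<lambda>_. 0)" and E: "\<And>m. amo lam \<alpha> \<theta> u m = of_real E * u m"
    using assms unfolding is_eigenfunction_def by metis
  have E': "u (m + 1) + u (m - 1) + of_real (pot lam \<alpha> \<theta> m) * u m = of_real E * u m" for m
    using E[of m] unfolding amo_def pot_def .
  obtain m where "u m \<noteq> 0" using nz by (auto simp: fun_eq_iff)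
  then have "Re (u m) \<noteq> 0 \<or> Im (u m) \<noteq> 0" by (auto simp: complex_eq_iff)
  then show ?thesis
  proof
    assume "Re (u m) \<noteq> 0"
    moreover have "Re (u (m + 1)) + Re (u (m - 1)) + pot lam \<alpha> \<theta> m * Re (u m) = E * Re (u m)" for m
      using arg_cong[OF E'[of m], of Re] by simp
    moreover have "(\<lambda>m. (Re (u m))\<^sup>2) summable_on UNIV"
      by (rule summable_on_comparison_test[OF l2[unfolded l2Z_def]]) (auto simp: cmod_power2)
    ultimately show ?thesis using that[of "\<lambda>m. Re (u m)" E] by blast
  next
    assume "Im (u m) \<noteq> 0"
    moreover have "Im (u (m + 1)) + Im (u (m - 1)) + pot lam \<alpha> \<theta> m * Im (u m) = E * Im (u m)" for m
      using arg_cong[OF E'[of m], of Im] by simp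
    moreover have "(\<lambda>m. (Im (u m))\<^sup>2) summable_on UNIV"
      by (rule summable_on_comparison_test[OF l2[unfolded l2Z_def]]) (auto simp: cmod_power2)
    ultimately show ?thesis using that[of "\<lambda>m. Im (u m)" E] by blast
  qed
qed

lemma mean_log_det_rate_le:
  assumes z: "Im z \<noteq> 0" and B: "B > 0"
    and growth: "\<And>\<theta> n. cmod (box_det \<mu> \<nu> \<alpha> \<theta> z n) \<le> B * q ^ n" and q: "q > 0"
    and lim: "(\<lambda>k. mean_log_det \<mu> \<nu> \<alpha> z k / real k) \<longlonglongrightarrow> l"
  shows "l \<le> ln q"
proof (rule LIMSEQ_le[OF lim])
  have "(\<lambda>k. ln B * inverse (real k) + ln q) \<longlonglongrightarrow> ln B * 0 + ln q"
    by (intro tendsto_intros lim_inverse_n)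
  then show "(\<lambda>k. ln B * inverse (real k) + ln q) \<longlonglongrightarrow> ln q" by simp
  have "mean_log_det \<mu> \<nu> \<alpha> z k / real k \<le> ln B * inverse (real k) + ln q" if k: "k \<ge> 1" for k
  proof -
    have "mean_log_det \<mu> \<nu> \<alpha> z k \<le> integral {0..1} (\<lambda>\<theta>::real. ln B + real k * ln q)"
      unfolding mean_log_det_def
    proof (intro integral_le integrable_continuous_interval continuous_on_log_det z continuous_on_const)
      fix \<theta> :: real
      have "ln (cmod (box_det \<mu> \<nu> \<alpha> \<theta> z k)) \<le> ln (B * q ^ k)"
        using growth[of \<theta> k] box_det_nonzero[OF z] B q by (subst ln_le_cancel_iff) auto
      also have "\<dots> = ln B + real k * ln q" using B q by (simp add: ln_mult ln_realpow)
      finally show "ln (cmod (box_det \<mu> \<nu> \<alpha> \<theta> z k)) \<le> ln B + real k * ln q" .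
    qed
    then have "mean_log_det \<mu> \<nu> \<alpha> z k / real k \<le> (ln B + real k * ln q) / real k"
      using k by (intro divide_right_mono) auto
    also have "\<dots> = ln B * inverse (real k) + ln q" using k by (simp add: field_simps)
    finally show ?thesis .
  qed
  then show "\<exists>N. \<forall>k\<ge>N. mean_log_det \<mu> \<nu> \<alpha> z k / real k \<le> ln B * inverse (real k) + ln q" by blast
qed

text \<open>The eigenbasis is an arbitrary choice at each phase, so F carries no measurability; it
  is only compared from below with a continuous function. That function is truncated at 0 to match
  \<open>ennreal\<close>.\<close>

lemma nn_integral_lower_bound:
  assumes cont: "continuous_on UNIV f"
    and le: "AE \<theta> in lborel. ennreal (f \<theta>) \<le> F \<theta>"
  shows "ennreal (integral {0..1} f) \<le> (\<integral>\<^sup>+ \<theta>\<in>{0..1::real}. F \<theta> \<partial>lborel)"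
proof -
  let ?g = "\<lambda>\<theta>. max 0 (f \<theta>)"
  have gc: "continuous_on A ?g" for A by (intro continuous_intros continuous_on_subset[OF cont]) simp
  have fc: "continuous_on A f" for A by (rule continuous_on_subset[OF cont]) simp
  have "integral {0..1} f \<le> integral {0..1} ?g"
    by (intro integral_le integrable_continuous_interval gc fc) simp
  then have "ennreal (integral {0..1} f) \<le> ennreal (integral {0..1} ?g)" by (rule ennreal_leI)
  also have "ennreal (integral {0..1} ?g) = (\<integral>\<^sup>+ \<theta>. indicator {0..1} \<theta> * ?g \<theta> \<partial>lborel)"
    by (rule nn_integral_has_integral_lebesgue[symmetric])
      (auto intro!: integrable_integral integrable_continuous_interval gc)
  also have "\<dots> \<le> (\<integral>\<^sup>+ \<theta>\<in>{0..1}. F \<theta> \<partial>lborel)"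
  proof (rule nn_integral_mono_AE)
    show "AE \<theta> in lborel. ennreal (indicator {0..1} \<theta> * ?g \<theta>) \<le> F \<theta> * indicator {0..1} \<theta>"
      using le by eventually_elim (auto simp: indicator_def max_def)
  qed
  finally show ?thesis .
qed

text \<open>The logarithmic inequality in exponentiated form, between extended nonnegative reals, so
  that series and integral are always defined.\<close>

theorem theorem4p1:
  fixes lam \<alpha> \<Gamma> :: real and \<phi> :: "real \<Rightarrow> nat \<Rightarrow> int \<Rightarrow> complex"
  assumes "lam > 1"
    and "diophantine \<alpha>"
    and "AE \<theta> in lborel. eigen_onb lam \<alpha> \<theta> (\<phi> \<theta>)"
    and "ln lam < \<Gamma>" and "\<Gamma> \<le> 2 * ln lam"
  shows "\<exists>N. \<forall>n::int. \<bar>n\<bar> \<ge> N \<longrightarrow>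
     (\<integral>\<^sup>+ \<theta>\<in>{0..1}. (\<Sum>s. ennreal (cmod (\<phi> \<theta> s 0 * \<phi> \<theta> s n))) \<partial>lborel)
       \<ge> ennreal (exp (- \<Gamma> * of_int \<bar>n\<bar>))"
proof -
  have lam: "lam > 0" using assms(1) by simp
  \<comment> \<open>The margin is split: a quarter pays for leaving the real axis, a quarter for the
    convergence to the rate l, and the remaining half outgrows the prefactor and the edge
    error.\<close>
  define \<delta> where "\<delta> = \<Gamma> - ln lam"
  have \<delta>: "\<delta> > 0" using assms(4) by (simp add: \<delta>_def)
  have \<Gamma>: "\<Gamma> > 0" using assms(4) ln_gt_zero[OF assms(1)] by linarith
  have "AE \<theta> in lborel. eigen_onb lam \<alpha> \<theta> (\<phi> \<theta>) \<and> (\<forall>k::int. 2 * \<theta> + of_int k * \<alpha> \<notin> \<int>)"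
    using assms(3) AE_nonresonant[of \<alpha>] by eventually_elim simp
  moreover have "ae_filter (lborel :: real measure) \<noteq> bot" by (simp add: ae_filter_eq_bot_iff)
  ultimately obtain \<theta>0 where \<theta>0: "eigen_onb lam \<alpha> \<theta>0 (\<phi> \<theta>0)" "\<And>k::int. 2 * \<theta>0 + of_int k * \<alpha> \<notin> \<int>"
    using eventually_happens' by blast
  \<comment> \<open>One eigenvalue at one nonresonant phase is enough to fix E, because the
    resulting bound on dual determinants is uniform in the phase.\<close>
  have "is_eigenfunction lam \<alpha> \<theta>0 (\<phi> \<theta>0 0)" using \<theta>0(1) by (simp add: eigen_onb_def)
  then obtain \<psi> E where \<psi>: "\<And>m. \<psi> (m + 1) + \<psi> (m - 1) + pot lam \<alpha> \<theta>0 m * \<psi> m = E * \<psi> m"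
    "(\<lambda>m. (\<psi> m)\<^sup>2) summable_on UNIV" "\<exists>m::int. \<psi> m \<noteq> (0::real)"
    by (rule real_eigenfunction) (rule that)
  interpret localized_solution lam \<alpha> \<theta>0 E \<psi>
    by unfold_locales (use lam \<psi> \<theta>0 diophantine_irrational[OF assms(2)] in auto)
  obtain C where C: "\<And>\<theta> n. cmod (box_det lam 1 \<alpha> \<theta> (of_real E) n) \<le> C * real (Suc n) * lam ^ n"
    using dual_box_det_bound by blast
  obtain \<eta> B where \<eta>: "\<eta> > 0" and B: "B > 0"
    and growth: "\<And>\<theta> n. cmod (box_det lam 1 \<alpha> \<theta> (of_real E + \<i> * of_real \<eta>) n) \<le> B * (exp (\<delta> / 4) * lam) ^ n"
    using box_det_growth_perturb[OF C lam, of "\<delta> / 4"] \<delta> by auto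
  define z where "z = of_real E + \<i> * of_real \<eta>"
  have Imz: "Im z = \<eta>" by (simp add: z_def)
  have z: "Im z > 0" "Im z \<noteq> 0" using \<eta> by (simp_all add: Imz)
  obtain l where l: "(\<lambda>k. mean_log_det lam 1 \<alpha> z k / real k) \<longlonglongrightarrow> l"
    "(\<lambda>k. mean_log_det 1 lam \<alpha> z k / real k) \<longlonglongrightarrow> l"
    using mean_log_det_dual_limit[OF z(2)] by blast
  have "l \<le> ln (exp (\<delta> / 4) * lam)"
    by (rule mean_log_det_rate_le[OF z(2) B growth[folded z_def] _ l(1)]) (use lam in simp)
  also have "\<dots> = \<delta> / 4 + ln lam" using lam by (simp add: ln_mult)
  finally have l_le: "l \<le> \<Gamma> - 3 * \<delta> / 4" unfolding \<delta>_def by (simp add: field_simps)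

  \<comment> \<open>With padding \<open>2 * (M * N)\<close> the edge terms decay like this power
    raised to -N, which M brings below the target exp (-\<Gamma> N).\<close>
  obtain M where M: "sqrt (1 + 2 * \<eta>) ^ M > exp (\<Gamma> + 1)"
    using real_arch_pow[of "sqrt (1 + 2 * \<eta>)"] \<eta> by auto
  have M0: "M > 0" using M \<Gamma> by (cases M) auto
  define d where "d k = mean_log_det 1 lam \<alpha> z k" for k
  \<comment> \<open>The padding cancels: the two end blocks have 4MN sites together and the whole
    box N + 1 more, which leaves -l per unit of N.\<close>
  have "(\<lambda>N. (2 * d (2 * (M * N)) - d (2 * (2 * (M * N)) + N + 1)) / real N) \<longlonglongrightarrow> - l"
  proof -
    have 1: "(\<lambda>N. d (2 * (M * N)) / real (2 * (M * N))) \<longlonglongrightarrow> l"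
      using M0 by (intro filterlim_compose[OF l(2)[folded d_def]] filterlim_subseq) (auto simp: strict_mono_def)
    have 2: "(\<lambda>N. d (2 * (2 * (M * N)) + N + 1) / real (2 * (2 * (M * N)) + N + 1)) \<longlonglongrightarrow> l"
      by (intro filterlim_compose[OF l(2)[folded d_def]] filterlim_subseq) (auto simp: strict_mono_def intro!: add_mono_thms_linordered_field(4))
    \<comment> \<open>The two coefficients are box sizes divided by N, so that only the convergent
      quotients d(k)/k occur.\<close>
    have "(\<lambda>N. 4 * real M * (d (2 * (M * N)) / real (2 * (M * N)))
        - (4 * real M + 1 + inverse (real N)) * (d (2 * (2 * (M * N)) + N + 1) / real (2 * (2 * (M * N)) + N + 1)))
        \<longlonglongrightarrow> 4 * real M * l - (4 * real M + 1 + 0) * l"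
      by (intro tendsto_intros 1 2 lim_inverse_n)
    moreover have "\<forall>\<^sub>F N in sequentially. 4 * real M * (d (2 * (M * N)) / real (2 * (M * N)))
        - (4 * real M + 1 + inverse (real N)) * (d (2 * (2 * (M * N)) + N + 1) / real (2 * (2 * (M * N)) + N + 1))
        = (2 * d (2 * (M * N)) - d (2 * (2 * (M * N)) + N + 1)) / real N"
      using eventually_gt_at_top[of 0]
    proof eventually_elim
      fix N :: nat assume N: "0 < N"
      have a: "4 * real M * (x / real (2 * (M * N))) = 2 * x / real N" for x using N M0 by simp
      define K where "K = 2 * (2 * (M * N)) + N + 1"
      have e: "4 * real M + 1 + inverse (real N) = real K / real N"
        using N by (simp add: K_def field_simps)
      have "real K \<noteq> 0" by (simp add: K_def del: of_nat_add of_nat_mult)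
      then have b: "(4 * real M + 1 + inverse (real N)) * (x / real K) = x / real N" for x
        unfolding e by simp
      show "4 * real M * (d (2 * (M * N)) / real (2 * (M * N)))
        - (4 * real M + 1 + inverse (real N)) * (d (2 * (2 * (M * N)) + N + 1) / real (2 * (2 * (M * N)) + N + 1))
        = (2 * d (2 * (M * N)) - d (2 * (2 * (M * N)) + N + 1)) / real N"
        unfolding a b[unfolded K_def] by (simp only: diff_divide_distrib)
    qed
    ultimately have "(\<lambda>N. (2 * d (2 * (M * N)) - d (2 * (2 * (M * N)) + N + 1)) / real N)
       \<longlonglongrightarrow> 4 * real M * l - (4 * real M + 1 + 0) * l"
      by (rule Lim_transform_eventually)
    then show ?thesis by (simp add: algebra_simps)
  qed
  moreover have "- l > - (\<Gamma> - \<delta> / 2)" using l_le \<delta> by simp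
  ultimately have "\<forall>\<^sub>F N in sequentially. (2 * d (2 * (M * N)) - d (2 * (2 * (M * N)) + N + 1)) / real N > - (\<Gamma> - \<delta> / 2)"
    by (rule order_tendstoD)
  then obtain N0 where N0: "\<And>N. N \<ge> N0 \<Longrightarrow> (2 * d (2 * (M * N)) - d (2 * (2 * (M * N)) + N + 1)) / real N > - (\<Gamma> - \<delta> / 2)"
    unfolding eventually_sequentially by blast
  \<comment> \<open>Ensures that \<eta> exp (\<delta> N / 2) is at least 1 + 2/\<eta>, where, in
    units of exp (-\<Gamma> N), 1 is the target and 2/\<eta> bounds the edge error
    \<open>c\<close>.\<close>
  obtain N1 where N1: "real N1 > 2 * (1 + 2 / \<eta>) / (\<eta> * \<delta>)" using reals_Archimedean2 by blast
  have bound: "ennreal (exp (- \<Gamma> * of_int \<bar>n\<bar>)) \<le> (\<integral>\<^sup>+ \<theta>\<in>{0..1}. (\<Sum>s. ennreal (cmod (\<phi> \<theta> s 0 * \<phi> \<theta> s n))) \<partial>lborel)"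
    if n: "\<bar>n\<bar> \<ge> int (max (max N0 N1) 1)" for n :: int
  proof -
    define N where "N = nat \<bar>n\<bar>"
    have N: "N \<ge> N0" "N \<ge> N1" "N \<ge> 1" "of_int \<bar>n\<bar> = real N" using n by (auto simp: N_def)
    define c where "c = 2 / (Im z * sqrt (1 + 2 * Im z) ^ (M * N))"
    let ?f = "\<lambda>\<theta>. green_lower lam \<alpha> z n (2 * (M * N)) \<theta> - c"
    have "ennreal (integral {0..1} ?f) \<le> (\<integral>\<^sup>+ \<theta>\<in>{0..1}. (\<Sum>s. ennreal (cmod (\<phi> \<theta> s 0 * \<phi> \<theta> s n))) \<partial>lborel)"
    proof (rule nn_integral_lower_bound)
      show "continuous_on UNIV ?f" by (intro continuous_intros continuous_on_green_lower z)
      show "AE \<theta> in lborel. ennreal (?f \<theta>) \<le> (\<Sum>s. ennreal (cmod (\<phi> \<theta> s 0 * \<phi> \<theta> s n)))"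
        using assms(3)
      proof eventually_elim
        fix \<theta> assume onb: "eigen_onb lam \<alpha> \<theta> (\<phi> \<theta>)"
        interpret l2_basis "\<phi> \<theta>"
          using onb unfolding eigen_onb_def is_eigenfunction_def by unfold_locales auto
        have "?f \<theta> \<le> (\<Sum>s. cmod (\<phi> \<theta> s 0 * \<phi> \<theta> s n))"
          unfolding c_def by (rule green_lower_le[OF onb z(1)])
        then have "ennreal (?f \<theta>) \<le> ennreal (\<Sum>s. cmod (\<phi> \<theta> s 0 * \<phi> \<theta> s n))" by (rule ennreal_leI)
        also have "\<dots> = (\<Sum>s. ennreal (cmod (\<phi> \<theta> s 0 * \<phi> \<theta> s n)))"
          by (rule suminf_ennreal2[symmetric]) (auto intro: summable_pair)
        finally show "ennreal (?f \<theta>) \<le> (\<Sum>s. ennreal (cmod (\<phi> \<theta> s 0 * \<phi> \<theta> s n)))" .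
      qed
    qed
    moreover have "exp (- \<Gamma> * of_int \<bar>n\<bar>) \<le> integral {0..1} ?f"
    proof -
      have "integral {0..1} ?f = integral {0..1} (green_lower lam \<alpha> z n (2 * (M * N))) - integral {0..1} (\<lambda>\<theta>::real. c)"
        by (intro integral_diff integrable_continuous_interval continuous_on_green_lower z continuous_on_const)
      also have "\<dots> \<ge> \<eta> * exp (2 * d (2 * (M * N)) - d (2 * (2 * (M * N)) + N + 1)) - c"
        using integral_green_lower[OF z(1), of lam \<alpha> "2 * (M * N)" n] by (simp add: Imz d_def N_def)
      finally have 1: "\<eta> * exp (2 * d (2 * (M * N)) - d (2 * (2 * (M * N)) + N + 1)) - c \<le> integral {0..1} ?f" .
      have "2 * d (2 * (M * N)) - d (2 * (2 * (M * N)) + N + 1) \<ge> - (\<Gamma> - \<delta> / 2) * real N"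
        using N0[OF N(1)] N(3) by (simp add: pos_less_divide_eq)
      then have A: "exp (- (\<Gamma> - \<delta> / 2) * real N) \<le> exp (2 * d (2 * (M * N)) - d (2 * (2 * (M * N)) + N + 1))" by simp
      have e: "exp (- (\<Gamma> - \<delta> / 2) * real N) = exp (- \<Gamma> * real N) * exp (\<delta> * real N / 2)"
        by (simp add: exp_add[symmetric] algebra_simps)
      have 2: "\<eta> * (exp (- \<Gamma> * real N) * exp (\<delta> * real N / 2)) \<le> \<eta> * exp (2 * d (2 * (M * N)) - d (2 * (2 * (M * N)) + N + 1))"
        using A[unfolded e] \<eta> by (intro mult_left_mono) auto
      have "exp (\<Gamma> * real N) \<le> sqrt (1 + 2 * \<eta>) ^ (M * N)"
      proof -
        have "exp (\<Gamma> * real N) \<le> exp (\<Gamma> + 1) ^ N" by (simp add: exp_of_nat_mult[symmetric] algebra_simps)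
        also have "\<dots> \<le> (sqrt (1 + 2 * \<eta>) ^ M) ^ N" using M by (intro power_mono) auto
        finally show ?thesis by (simp add: power_mult)
      qed
      then have "inverse (sqrt (1 + 2 * \<eta>) ^ (M * N)) \<le> inverse (exp (\<Gamma> * real N))" by (intro le_imp_inverse_le) auto
      then have "2 / \<eta> * inverse (sqrt (1 + 2 * \<eta>) ^ (M * N)) \<le> 2 / \<eta> * exp (- \<Gamma> * real N)"
        using \<eta> by (intro mult_left_mono) (auto simp: exp_minus)
      then have 3: "c \<le> 2 / \<eta> * exp (- \<Gamma> * real N)" by (simp add: c_def Imz divide_inverse)
      have 4: "\<eta> * exp (\<delta> * real N / 2) \<ge> 1 + 2 / \<eta>"
      proof -
        have "2 * (1 + 2 / \<eta>) / (\<eta> * \<delta>) \<le> real N" using N1 N(2) by linarith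
        then have "1 + 2 / \<eta> \<le> \<eta> * (\<delta> * real N / 2)" using \<eta> \<delta> by (simp add: pos_divide_le_eq algebra_simps)
        also have "\<dots> \<le> \<eta> * exp (\<delta> * real N / 2)"
          using \<eta> by (intro mult_left_mono order_trans[OF _ exp_ge_add_one_self]) auto
        finally show ?thesis .
      qed
      have "exp (- \<Gamma> * real N) * (1 + 2 / \<eta>) \<le> exp (- \<Gamma> * real N) * (\<eta> * exp (\<delta> * real N / 2))"
        using 4 by (intro mult_left_mono) auto
      then have "exp (- \<Gamma> * real N) \<le> \<eta> * (exp (- \<Gamma> * real N) * exp (\<delta> * real N / 2)) - 2 / \<eta> * exp (- \<Gamma> * real N)"
        by (simp add: algebra_simps)
      then show ?thesis using 1 2 3 unfolding N(4) by linarith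
    qed
    ultimately show ?thesis using ennreal_leI order_trans by blast
  qed
  show ?thesis by (intro exI[of _ "int (max (max N0 N1) 1)"] allI impI bound)
qed

end
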